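(* Let $F_n$ be the free group on $y_1,\dots,y_n$, and let $v_0,\dots,v_k\in F_n$ ($k\ge0$) with $v_0=\prod_{\ell=1}^{\rho}[u_\ell,u_{\ell+\rho}]$ for some $u_1,\dots,u_{2\rho}\in F_n$. Set $L=\mathbb{Z}^n$ and $\lambda=\sum_{\ell=1}^\rho\bar u_\ell\wedge\bar u_{\ell+\rho}\in\Lambda^2L$. Let $\epsilon_0,\dots,\epsilon_k\in\{\pm1\}$ with $\epsilon_0=-1$. If \[\lambda\wedge\bar v_1\wedge\cdots\wedge\bar v_k\neq0\quad\text{in }\Lambda^{k+2}L,\] then there exists a homomorphism $\psi:F_n\to Sp(1)$ with $\psi(v_i)=\epsilon_i$ for $i=0,\dots,k$.
   Context: For $w\in F_n$, $\bar w\in\mathbb{Z}^n$ is its image under abelianization, with $\bar y_i$ the $i$-th standard basis vector. $[a,b]=aba^{-1}b^{-1}$. $Sp(1)$ is the group of unit quaternions. *)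

theory Defs
  imports Complex_Main
begin

text \<open>A letter (i, True) stands for the generator y_i, (i, False) for its inverse.
  The free group F_n on y_0,...,y_(n-1) is represented by words all of whose letters
  have index < n; two words are equal in F_n iff they are related by free_equiv.\<close>

type_synonym word = "(nat \<times> bool) list"

definition in_Fn :: "nat \<Rightarrow> word \<Rightarrow> bool" where
  "in_Fn n w \<longleftrightarrow> (\<forall>x \<in> set w. fst x < n)"

definition letter_inv :: "nat \<times> bool \<Rightarrow> nat \<times> bool" where
  "letter_inv x = (fst x, \<not> snd x)"

definition word_inv :: "word \<Rightarrow> word" where
  "word_inv w = rev (map letter_inv w)"

definition red_step :: "word \<Rightarrow> word \<Rightarrow> bool" where
  "red_step w w' \<longleftrightarrow> (\<exists>a b x. w = a @ [x, letter_inv x] @ b \<and> w' = a @ b)"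

definition free_equiv :: "word \<Rightarrow> word \<Rightarrow> bool" where
  "free_equiv = equivclp red_step"

definition commutator :: "word \<Rightarrow> word \<Rightarrow> word" where
  "commutator a b = a @ b @ word_inv a @ word_inv b"

definition abel :: "word \<Rightarrow> nat \<Rightarrow> int" where
  "abel w i = (\<Sum>x \<leftarrow> w. if fst x = i then (if snd x then 1 else -1) else 0)"

text \<open>An element of the exterior algebra of Z^n is given by its coefficients with respect
  to the basis e_I = e_(i_1) \<and> ... \<and> e_(i_m) (i_1 < ... < i_m, I = {i_1,...,i_m}).\<close>
type_synonym ext = "nat set \<Rightarrow> int"

definition shuffle_sign :: "nat set \<Rightarrow> nat set \<Rightarrow> int" where
  "shuffle_sign J K = (-1) ^ card {(j, k). j \<in> J \<and> k \<in> K \<and> k < j}"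

text \<open>e_J \<and> e_K = shuffle_sign J K * e_(J \<union> K) for disjoint J, K (and 0 otherwise).\<close>
definition ext_mult :: "ext \<Rightarrow> ext \<Rightarrow> ext" (infixl "\<and>\<^sub>e" 70) where
  "ext_mult \<alpha> \<beta> I = (\<Sum>J \<in> Pow I. shuffle_sign J (I - J) * \<alpha> J * \<beta> (I - J))"

definition ext_vec :: "(nat \<Rightarrow> int) \<Rightarrow> ext" where
  "ext_vec v I = (if card I = 1 then v (the_elem I) else 0)"

definition ext_add :: "ext \<Rightarrow> ext \<Rightarrow> ext" where
  "ext_add \<alpha> \<beta> I = \<alpha> I + \<beta> I"

definition ext_zero :: ext where
  "ext_zero I = 0"

datatype quat = Quat (re: real) (im_i: real) (im_j: real) (im_k: real)

definition qmult :: "quat \<Rightarrow> quat \<Rightarrow> quat" where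
  "qmult p q = Quat
     (re p * re q - im_i p * im_i q - im_j p * im_j q - im_k p * im_k q)
     (re p * im_i q + im_i p * re q + im_j p * im_k q - im_k p * im_j q)
     (re p * im_j q - im_i p * im_k q + im_j p * re q + im_k p * im_i q)
     (re p * im_k q + im_i p * im_j q - im_j p * im_i q + im_k p * re q)"

definition qone :: quat where "qone = Quat 1 0 0 0"

definition qconj :: "quat \<Rightarrow> quat" where
  "qconj q = Quat (re q) (- im_i q) (- im_j q) (- im_k q)"

definition Sp1 :: "quat set" where
  "Sp1 = {q. (re q)\<^sup>2 + (im_i q)\<^sup>2 + (im_j q)\<^sup>2 + (im_k q)\<^sup>2 = 1}"

definition qreal :: "real \<Rightarrow> quat" where
  "qreal r = Quat r 0 0 0"

text \<open>A homomorphism F_n \<rightarrow> Sp(1) is the same as a choice of images q_i \<in> Sp(1) of the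
  generators (universal property); its value on a word is the ordered product.
  (Inverse in Sp(1) is conjugation.)\<close>
definition qletter :: "(nat \<Rightarrow> quat) \<Rightarrow> nat \<times> bool \<Rightarrow> quat" where
  "qletter q x = (if snd x then q (fst x) else qconj (q (fst x)))"

definition word_hom :: "(nat \<Rightarrow> quat) \<Rightarrow> word \<Rightarrow> quat" where
  "word_hom q w = foldr (\<lambda>x acc. qmult (qletter q x) acc) w qone"

end

theory Submission
  imports Defs "HOL-Analysis.Analysis"
begin

text \<open>
  The circle of unit complex numbers acts on tuples of unit quaternions by conjugation; its fixed points are the
  tuples in the maximal torus. For a word map \<open>v\<close> to the three-sphere, the bi-invariant volume form extends to an
  equivariantly closed form \<open>chi v\<close>, and the Polyakov--Wiegmann identity makes \<open>chi\<close> additive on products up to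
  explicit exact terms. Hence \<open>chi v\<^sub>0 = D P\<close> for a product of commutators \<open>v\<^sub>0\<close>, where \<open>D = d - \<iota>\<close> is the
  equivariant differential, and \<open>P\<close> restricts to a multiple of \<open>\<lambda>\<close> on the torus. If the system has no solution,
  then \<open>v\<^sub>0\<close> avoids \<open>-1\<close> wherever all other \<open>v\<^sub>i\<close> are close to \<open>\<epsilon>\<^sub>i\<close>. There \<open>chi v\<^sub>0\<close> has a second primitive,
  pulled back from the sphere minus the point \<open>-1\<close> and vanishing on the torus. The difference of the two primitives,
  multiplied by equivariantly closed bump forms around the \<open>\<epsilon>\<^sub>i\<close>, is equivariantly closed, so by localization
  (iterated use of Stokes' theorem, collapsing one generator at a time to the torus) its integral over the torus
  is zero. But this integral is a nonzero multiple of a coefficient of \<open>\<lambda> \<and> v\<^sub>1 \<and> \<dots> \<and> v\<^sub>k\<close>.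
\<close>

section \<open>The exterior algebra over a real algebra\<close>

text \<open>The integral over the torus vanishes for a degree reason. Take an index set
  \<open>I\<close> of size k+2 at which the coefficient of the product in the hypothesis is nonzero,
  and put the remaining generators equal to 1. The form has degree at most 2 + 3k, two from the
  primitives and three from each bump, and this is below the dimension 3(k+2) of the remaining
  product of spheres. So there is no top part to integrate, and localization carries this zero to
  the part of degree k+2 on the torus. Ordinary closed forms would be useless here: on the torus a
  word takes values in a circle, where three-forms pull back to 0. The equivariant extension gives
  each volume form a part of degree one, and this part survives. Nonvanishing of the torus integral
  needs a sign as well. The bumps are built so that the integrand has constant sign, and linear
  independence of the abelianized v_1, ..., v_k on \<open>I\<close> yields a torus point at which it
  is not 0. Forms are coefficient families on a coordinate space; the collapsing circles of the
  coordinates appear only as vanishing coefficients on two faces.\<close>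

definition sg :: "nat set \<Rightarrow> nat set \<Rightarrow> real" where
  "sg J K = of_int (shuffle_sign J K)"

lemma sg_empty [simp]: "sg {} K = 1" "sg J {} = 1"
  by (simp_all add: sg_def shuffle_sign_def)

lemma finite_inversions:
  assumes "finite A" "finite B"
  shows "finite {(j, k). j \<in> A \<and> k \<in> B \<and> k < (j::nat)}"
  by (rule finite_subset[of _ "A \<times> B"]) (use assms in auto)

lemma sg_Un_left:
  assumes "finite A" "finite B" "finite C" "A \<inter> B = {}"
  shows "sg (A \<union> B) C = sg A C * sg B C"
proof -
  have "{(j, k). j \<in> A \<union> B \<and> k \<in> C \<and> k < j} =
      {(j, k). j \<in> A \<and> k \<in> C \<and> k < j} \<union> {(j, k). j \<in> B \<and> k \<in> C \<and> k < j}"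
    by auto
  moreover have "{(j, k). j \<in> A \<and> k \<in> C \<and> k < j} \<inter> {(j, k). j \<in> B \<and> k \<in> C \<and> k < j} = {}"
    using assms by auto
  ultimately show ?thesis
    using assms by (simp add: sg_def shuffle_sign_def card_Un_disjoint finite_inversions power_add)
qed

lemma sg_Un_right:
  assumes "finite A" "finite B" "finite C" "A \<inter> B = {}"
  shows "sg C (A \<union> B) = sg C A * sg C B"
proof -
  have "{(j, k). j \<in> C \<and> k \<in> A \<union> B \<and> k < j} =
      {(j, k). j \<in> C \<and> k \<in> A \<and> k < j} \<union> {(j, k). j \<in> C \<and> k \<in> B \<and> k < j}"
    by auto
  moreover have "{(j, k). j \<in> C \<and> k \<in> A \<and> k < j} \<inter> {(j, k). j \<in> C \<and> k \<in> B \<and> k < j} = {}"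
    using assms by auto
  ultimately show ?thesis
    using assms by (simp add: sg_def shuffle_sign_def card_Un_disjoint finite_inversions power_add)
qed

lemma sg_square [simp]: "sg A B * sg A B = 1" "sg A B * (sg A B * r) = r"
  by (simp_all add: sg_def shuffle_sign_def flip: power_mult_distrib mult.assoc)

lemma sg_nonzero [simp]: "sg A B \<noteq> 0"
  by (simp add: sg_def shuffle_sign_def)

text \<open>Disjointness makes every pair of \<open>A \<times> B\<close> an inversion for exactly
  one of the two orders, so the two inversion counts add up to
  \<open>card A * card B\<close>.\<close>

lemma sg_swap:
  assumes "finite A" "finite B" "A \<inter> B = {}"
  shows "sg B A = (-1) ^ (card A * card B) * sg A B"
proof -
  let ?S = "{(j, k). j \<in> A \<and> k \<in> B \<and> k < j}" and ?T = "{(j, k). j \<in> B \<and> k \<in> A \<and> k < j}"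
  have "A \<times> B = ?S \<union> prod.swap ` ?T"
    using assms by (auto simp: image_iff)
  moreover have "?S \<inter> prod.swap ` ?T = {}"
    by auto
  moreover have "card (prod.swap ` ?T) = card ?T"
    by (rule card_image) auto
  ultimately have "card (A \<times> B) = card ?S + card ?T"
    using assms by (simp only: card_Un_disjoint finite_imageI finite_inversions)
  then have "card A * card B = card ?S + card ?T"
    by (simp add: card_cartesian_product)
  then have "(-1) ^ (card A * card B) * sg A B = sg B A * (sg A B * sg A B)"
    by (simp add: sg_def shuffle_sign_def power_add)
  then show ?thesis by simp
qed

text \<open>Exterior forms at a point, with coefficients in an algebra that may be noncommutative
  (reals and quaternions below); coefficients commute with the basis covectors. Infinite index sets
  get coefficient 0, because \<open>card\<close> and sums over \<open>Pow J\<close> carry no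
  information there.\<close>

typedef (overloaded) 'a ga = "{f :: nat set \<Rightarrow> 'a::zero. \<forall>J. infinite J \<longrightarrow> f J = 0}"
  morphisms coef Abs_ga
  by (rule exI[of _ "\<lambda>_. 0"]) simp

definition mk :: "(nat set \<Rightarrow> 'a::zero) \<Rightarrow> 'a ga" where
  "mk f = Abs_ga (\<lambda>J. if finite J then f J else 0)"

lemma coef_mk: "coef (mk f) J = (if finite J then f J else 0)"
  by (simp add: mk_def Abs_ga_inverse)

lemma coef_infinite [simp]: "infinite J \<Longrightarrow> coef x J = 0"
  using coef[of x] by auto

lemma ga_eqI: "(\<And>J. finite J \<Longrightarrow> coef x J = coef y J) \<Longrightarrow> x = y"
  by (metis coef_infinite coef_inject ext)

instantiation ga :: (real_algebra_1) real_algebra_1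
begin

definition zero_ga_def: "0 = mk (\<lambda>_. 0 :: 'a)"
definition one_ga_def: "1 = mk (\<lambda>J. if J = {} then 1 else 0 :: 'a)"
definition plus_ga_def: "x + y = mk (\<lambda>J. coef x J + coef y J :: 'a)"
definition minus_ga_def: "x - y = mk (\<lambda>J. coef x J - coef y J :: 'a)"
definition uminus_ga_def: "- x = mk (\<lambda>J. - coef x J :: 'a)"
definition scaleR_ga_def: "r *\<^sub>R x = mk (\<lambda>J. r *\<^sub>R coef x J :: 'a)"
definition times_ga_def:
  "x * y = mk (\<lambda>J. \<Sum>A\<in>Pow J. sg A (J - A) *\<^sub>R (coef x A * coef y (J - A)) :: 'a)"

lemma coef_simps_aux:
  "coef (0 :: 'a ga) J = 0"
  "coef (a + b :: 'a ga) J = coef a J + coef b J"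
  "coef (a - b :: 'a ga) J = coef a J - coef b J"
  "coef (- a :: 'a ga) J = - coef a J"
  "coef (r *\<^sub>R a :: 'a ga) J = r *\<^sub>R coef a J"
  by (simp_all add: coef_mk zero_ga_def plus_ga_def minus_ga_def uminus_ga_def scaleR_ga_def)

lemma coef_mult_aux:
  "finite J \<Longrightarrow> coef (a * b :: 'a ga) J = (\<Sum>A\<in>Pow J. sg A (J - A) *\<^sub>R (coef a A * coef b (J - A)))"
  by (simp add: times_ga_def coef_mk)

text \<open>Both sides sum over the ordered partitions of \<open>J\<close> into three blocks. The
  reindexing replaces the pair (union of the first two blocks, first block) by (first block, second
  block), and either product of signs counts the inversions between all three blocks.\<close>

lemma mult_assoc_aux: "(a * b) * c = a * (b * c :: 'a ga)"
proof (rule ga_eqI)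
  fix J :: "nat set"
  assume J: "finite J"
  then have fin: "\<And>A. A \<in> Pow J \<Longrightarrow> finite A" "\<And>A. finite (J - A)"
    by (auto intro: finite_subset)
  have "coef ((a * b) * c) J = (\<Sum>A\<in>Pow J. \<Sum>B\<in>Pow A.
      sg A (J - A) *\<^sub>R (sg B (A - B) *\<^sub>R (coef a B * coef b (A - B)) * coef c (J - A)))"
    by (simp add: coef_mult_aux J fin sum_distrib_right scaleR_sum_right)
  also have "\<dots> = (\<Sum>(A, B)\<in>(SIGMA A:Pow J. Pow A).
      sg A (J - A) *\<^sub>R (sg B (A - B) *\<^sub>R (coef a B * coef b (A - B)) * coef c (J - A)))"
    using J fin by (intro sum.Sigma) auto
  also have "\<dots> = (\<Sum>(B, E)\<in>(SIGMA B:Pow J. Pow (J - B)).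
      sg B (J - B) *\<^sub>R (coef a B * (sg E (J - B - E) *\<^sub>R (coef b E * coef c (J - B - E)))))"
  proof (rule sum.reindex_bij_witness[of _ "\<lambda>(B, E). (B \<union> E, B)" "\<lambda>(A, B). (B, A - B)"])
    fix p assume "p \<in> (SIGMA A:Pow J. Pow A)"
    then obtain A B where p: "p = (A, B)" "A \<subseteq> J" "B \<subseteq> A" by auto
    define E F where "E = A - B" and "F = J - A"
    have finBEF: "finite B" "finite E" "finite F"
      using p J by (auto simp: E_def F_def intro: finite_subset)
    have eqs: "A = B \<union> E" "J - B = E \<union> F" "J - A = F" "A - B = E" "J - B - (A - B) = F" and
      dis: "B \<inter> E = {}" "E \<inter> F = {}"
      using p by (auto simp: E_def F_def)
    have "sg (B \<union> E) F * sg B E = sg B (E \<union> F) * sg E F"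
      using finBEF dis by (simp add: sg_Un_left sg_Un_right)
    then show "(case case p of (A, B) \<Rightarrow> (B, A - B) of (B, E) \<Rightarrow>
        sg B (J - B) *\<^sub>R (coef a B * (sg E (J - B - E) *\<^sub>R (coef b E * coef c (J - B - E))))) =
      (case p of (A, B) \<Rightarrow>
        sg A (J - A) *\<^sub>R (sg B (A - B) *\<^sub>R (coef a B * coef b (A - B)) * coef c (J - A)))"
      using eqs by (simp add: p mult.assoc)
  qed auto
  also have "\<dots> = (\<Sum>B\<in>Pow J. \<Sum>E\<in>Pow (J - B).
      sg B (J - B) *\<^sub>R (coef a B * (sg E (J - B - E) *\<^sub>R (coef b E * coef c (J - B - E)))))"
    using J by (intro sum.Sigma[symmetric]) auto
  also have "\<dots> = coef (a * (b * c)) J"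
    by (simp add: coef_mult_aux J sum_distrib_left scaleR_sum_right)
  finally show "coef ((a * b) * c) J = coef (a * (b * c)) J" .
qed

lemma one_mult_aux: "1 * a = (a :: 'a ga)" and mult_one_aux: "a * 1 = (a :: 'a ga)"
proof -
  show "1 * a = a"
  proof (rule ga_eqI)
    fix J :: "nat set" assume J: "finite J"
    have "coef (1 * a) J = (\<Sum>A\<in>Pow J. if A = {} then coef a J else 0)"
      unfolding coef_mult_aux[OF J] by (rule sum.cong) (use J in \<open>auto simp: one_ga_def coef_mk\<close>)
    then show "coef (1 * a) J = coef a J" using J by (simp add: sum.delta')
  qed
  show "a * 1 = a"
  proof (rule ga_eqI)
    fix J :: "nat set" assume J: "finite J"
    have "coef (a * 1) J = (\<Sum>A\<in>Pow J. if A = J then coef a J else 0)"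
      unfolding coef_mult_aux[OF J] by (rule sum.cong) (use J in \<open>auto simp: one_ga_def coef_mk\<close>)
    then show "coef (a * 1) J = coef a J" using J by (simp add: sum.delta')
  qed
qed

instance
proof
  fix a b c :: "'a ga" and r s :: real
  show "a * b * c = a * (b * c)" by (rule mult_assoc_aux)
  show "1 * a = a" "a * 1 = a" by (rule one_mult_aux, rule mult_one_aux)
  show "0 \<noteq> (1 :: 'a ga)"
  proof
    assume "0 = (1 :: 'a ga)"
    then have "coef (0 :: 'a ga) {} = coef 1 {}" by simp
    then show False by (simp add: coef_simps_aux one_ga_def coef_mk)
  qed
qed (rule ga_eqI; simp add: coef_simps_aux coef_mult_aux algebra_simps sum.distrib scaleR_sum_right)+

end

lemma coef_zero [simp]: "coef 0 J = 0"
  and coef_add [simp]: "coef (a + b) J = coef a J + coef b J"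
  and coef_diff [simp]: "coef (a - b) J = coef a J - coef b J"
  and coef_uminus [simp]: "coef (- a) J = - coef a J"
  and coef_scaleR [simp]: "coef (r *\<^sub>R a) J = r *\<^sub>R coef a J"
  by (rule coef_simps_aux)+

lemma coef_mult:
  "finite J \<Longrightarrow> coef (a * b) J = (\<Sum>A\<in>Pow J. sg A (J - A) *\<^sub>R (coef a A * coef b (J - A)))"
  by (rule coef_mult_aux)

lemma coef_sum [simp]: "coef (\<Sum>i\<in>S. f i) J = (\<Sum>i\<in>S. coef (f i) J)"
  by (induction S rule: infinite_finite_induct) auto

definition cst :: "'a::real_algebra_1 \<Rightarrow> 'a ga" where
  "cst a = mk (\<lambda>J. if J = {} then a else 0)"

lemma coef_cst: "coef (cst a) J = (if J = {} then a else 0)"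
  by (simp add: cst_def coef_mk)

definition evec :: "nat \<Rightarrow> 'a::real_algebra_1 ga" where
  "evec c = mk (\<lambda>J. if J = {c} then 1 else 0)"

lemma coef_evec: "coef (evec c) J = (if J = {c} then 1 else 0)"
  by (simp add: evec_def coef_mk)

lemma coef_cst_mult [simp]: "coef (cst a * x) J = a * coef x J"
proof (cases "finite J")
  case True
  have "coef (cst a * x) J = (\<Sum>A\<in>Pow J. if A = {} then a * coef x J else 0)"
    unfolding coef_mult[OF True] by (rule sum.cong) (auto simp: coef_cst)
  then show ?thesis using True by (simp add: sum.delta')
qed simp

lemma coef_mult_cst [simp]: "coef (x * cst a) J = coef x J * a"
proof (cases "finite J")
  case True
  have "coef (x * cst a) J = (\<Sum>A\<in>Pow J. if A = J then coef x J * a else 0)"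
    unfolding coef_mult[OF True] by (rule sum.cong) (auto simp: coef_cst)
  then show ?thesis using True by (simp add: sum.delta')
qed simp

lemma coef_evec_mult: "coef (evec c * x) J = (if c \<in> J then sg {c} (J - {c}) *\<^sub>R coef x (J - {c}) else 0)"
proof (cases "finite J")
  case True
  have "coef (evec c * x) J = (\<Sum>A\<in>Pow J. if A = {c} then sg {c} (J - {c}) *\<^sub>R coef x (J - {c}) else 0)"
    unfolding coef_mult[OF True] by (rule sum.cong) (auto simp: coef_evec)
  then show ?thesis using True by (simp add: sum.delta')
qed simp

lemma coef_mult_evec: "coef (x * evec c) J = (if c \<in> J then sg (J - {c}) {c} *\<^sub>R coef x (J - {c}) else 0)"
proof (cases "finite J")
  case True
  have "coef (x * evec c) J = (\<Sum>A\<in>Pow J. if A = J - {c} \<and> c \<in> J then sg (J - {c}) {c} *\<^sub>R coef x (J - {c}) else 0)"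
    unfolding coef_mult[OF True]
    by (rule sum.cong) (auto simp: coef_evec double_diff)
  also have "\<dots> = (if c \<in> J then sg (J - {c}) {c} *\<^sub>R coef x (J - {c}) else 0)"
    using True by (cases "c \<in> J") (auto simp: sum.delta')
  finally show ?thesis .
qed simp

lemma cst_simps [simp]: "cst 0 = 0" "cst 1 = 1"
  and cst_add: "cst (a + b) = cst a + cst b"
  and cst_diff: "cst (a - b) = cst a - cst b"
  and cst_uminus: "cst (- a) = - cst a"
  and cst_scaleR: "cst (r *\<^sub>R a) = r *\<^sub>R cst a"
  and cst_mult: "cst (a * b) = cst a * cst b"
  by (rule ga_eqI; simp add: coef_cst one_ga_def coef_mk)+

lemma cst_real: "cst (r::real) * x = r *\<^sub>R x" "x * cst r = r *\<^sub>R x"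
  by (rule ga_eqI; simp)+

definition gam :: "'a::real_algebra_1 ga \<Rightarrow> 'a ga" where
  "gam x = mk (\<lambda>J. (-1) ^ card J *\<^sub>R coef x J)"

lemma coef_gam [simp]: "coef (gam x) J = (-1) ^ card J *\<^sub>R coef x J"
  by (simp add: gam_def coef_mk)

lemma gam_simps [simp]: "gam 0 = 0" "gam 1 = 1" "gam (x + y) = gam x + gam y" "gam (x - y) = gam x - gam y"
  "gam (- x) = - gam x" "gam (r *\<^sub>R x) = r *\<^sub>R gam x" "gam (cst a) = cst a" "gam (evec c) = - evec c"
  by (rule ga_eqI; simp add: algebra_simps coef_cst coef_evec one_ga_def coef_mk)+

lemma gam_mult [simp]: "gam (x * y) = gam x * gam y"
proof (rule ga_eqI)
  fix J :: "nat set" assume J: "finite J"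
  have "card J = card A + card (J - A)" if "A \<in> Pow J" for A
    using that J by (metis PowD card_Diff_subset card_mono finite_subset le_add_diff_inverse)
  then show "coef (gam (x * y)) J = coef (gam x * gam y) J"
    using J by (auto simp: coef_mult scaleR_sum_right power_add mult_ac intro!: sum.cong)
qed

lemma evec_mult: "evec c * x = gam x * evec c"
proof (rule ga_eqI)
  fix J :: "nat set" assume J: "finite J"
  show "coef (evec c * x) J = coef (gam x * evec c) J"
    using J sg_swap[of "J - {c}" "{c}"] by (auto simp: coef_evec_mult coef_mult_evec)
qed

section \<open>Contraction with coordinate vector fields\<close>

definition iota1 :: "nat \<Rightarrow> 'a::real_algebra_1 ga \<Rightarrow> 'a ga" where
  "iota1 c x = mk (\<lambda>J. if c \<in> J then 0 else sg {c} J *\<^sub>R coef x (insert c J))"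

lemma coef_iota1: "coef (iota1 c x) J = (if c \<in> J then 0 else sg {c} J *\<^sub>R coef x (insert c J))"
  by (cases "finite J") (simp_all add: iota1_def coef_mk)

lemma iota1_simps [simp]: "iota1 c 0 = 0" "iota1 c (x + y) = iota1 c x + iota1 c y"
  "iota1 c (r *\<^sub>R x) = r *\<^sub>R iota1 c x" "iota1 c (cst a) = 0" "iota1 c (evec d) = (if c = d then 1 else 0)"
  by (rule ga_eqI; auto simp: algebra_simps coef_iota1 coef_cst coef_evec one_ga_def coef_mk)+

text \<open>If \<open>c\<close> lies in \<open>J\<close>, the left side has coefficient 0 and on the
  right the term of \<open>A\<close> without \<open>c\<close> cancels the term of
  \<open>insert c A\<close>. Otherwise the subsets of \<open>insert c J\<close> split into those
  without \<open>c\<close> and those with it, which gives the two terms on the right.\<close>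

lemma iota1_mult: "iota1 c (x * y) = iota1 c x * y + gam x * iota1 c y"
proof (rule ga_eqI)
  fix J :: "nat set" assume J: "finite J"
  show "coef (iota1 c (x * y)) J = coef (iota1 c x * y + gam x * iota1 c y) J"
  proof (cases "c \<in> J")
    case True
    have 1: "coef (iota1 c x * y) J =
        (\<Sum>A\<in>Pow (J - {c}). sg A (J - A) *\<^sub>R (coef (iota1 c x) A * coef y (J - A)))"
      unfolding coef_mult[OF J]
      by (rule sum.mono_neutral_right) (use J in \<open>auto simp: coef_iota1\<close>)
    have 2: "coef (gam x * iota1 c y) J =
        (\<Sum>A\<in>insert c ` Pow (J - {c}). sg A (J - A) *\<^sub>R (coef (gam x) A * coef (iota1 c y) (J - A)))"
      unfolding coef_mult[OF J]
    proof (rule sum.mono_neutral_right)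
      show "\<forall>A\<in>Pow J - insert c ` Pow (J - {c}).
        sg A (J - A) *\<^sub>R (coef (gam x) A * coef (iota1 c y) (J - A)) = 0"
      proof
        fix A assume A: "A \<in> Pow J - insert c ` Pow (J - {c})"
        then have "c \<notin> A"
          by (metis (no_types, lifting) DiffE Pow_iff insert_Diff image_iff Diff_mono subset_refl)
        then show "sg A (J - A) *\<^sub>R (coef (gam x) A * coef (iota1 c y) (J - A)) = 0"
          using True by (simp add: coef_iota1)
      qed
    qed (use J True in auto)
    have inj: "inj_on (insert c) (Pow (J - {c}))"
      by (rule inj_onI) (auto simp: insert_ident subset_Diff_insert)
    have "coef (iota1 c x * y + gam x * iota1 c y) J = 0"
      unfolding coef_add 1 2 sum.reindex[OF inj] sum.distrib[symmetric]
    proof (rule sum.neutral, rule ballI)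
      fix A assume A: "A \<in> Pow (J - {c})"
      define E where "E = J - insert c A"
      have fin: "finite A" "finite E" using A J by (auto simp: E_def intro: finite_subset)
      have e: "J - A = insert c E" "c \<notin> A" "c \<notin> E" "A \<inter> E = {}" using A True by (auto simp: E_def)
      have s1: "sg A (insert c E) = sg A {c} * sg A E"
        using sg_Un_right[of "{c}" E A] fin e by simp
      have s2: "sg (insert c A) E = sg {c} E * sg A E"
        using sg_Un_left[of "{c}" A E] fin e by simp
      have s3: "sg A {c} = (-1) ^ card A * sg {c} A"
        using sg_swap[of "{c}" A] fin e by simp
      show "sg A (J - A) *\<^sub>R (coef (iota1 c x) A * coef y (J - A)) +
          ((\<lambda>A. sg A (J - A) *\<^sub>R (coef (gam x) A * coef (iota1 c y) (J - A))) \<circ> insert c) A = 0"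
        unfolding e E_def[symmetric] o_def using fin e(2-4)
        by (simp add: coef_iota1 s1 s2 s3 mult_ac flip: scaleR_left_distrib)
    qed
    then show ?thesis using True by (simp add: coef_iota1)
  next
    case False
    have dis: "Pow J \<inter> insert c ` Pow J = {}" using False by auto
    have inj: "inj_on (insert c) (Pow J)"
      by (rule inj_onI) (use False in \<open>auto simp: insert_ident subset_Diff_insert\<close>)
    have "coef (iota1 c (x * y)) J = sg {c} J *\<^sub>R
        ((\<Sum>A\<in>Pow J. sg A (insert c J - A) *\<^sub>R (coef x A * coef y (insert c J - A))) +
        (\<Sum>A\<in>Pow J. sg (insert c A) (insert c J - insert c A) *\<^sub>R
          (coef x (insert c A) * coef y (insert c J - insert c A))))"
      using False J dis
      by (simp add: coef_iota1 coef_mult Pow_insert sum.union_disjoint sum.reindex[OF inj] o_def)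
    also have "\<dots> = coef (iota1 c x * y + gam x * iota1 c y) J"
      unfolding scaleR_right_distrib scaleR_sum_right coef_add coef_mult[OF J] sum.distrib[symmetric]
    proof (rule sum.cong[OF refl])
      fix A assume A: "A \<in> Pow J"
      define E where "E = J - A"
      have fin: "finite A" "finite E" using A J by (auto simp: E_def intro: finite_subset)
      have e: "insert c J - A = insert c E" "insert c J - insert c A = E" "J = A \<union> E" "c \<notin> A" "c \<notin> E" "A \<inter> E = {}"
        using A False by (auto simp: E_def)
      have s1: "sg A (insert c E) = sg A {c} * sg A E"
        using sg_Un_right[of "{c}" E A] fin e by simp
      have s2: "sg (insert c A) E = sg {c} E * sg A E"
        using sg_Un_left[of "{c}" A E] fin e by simp
      have s3: "sg A {c} = (-1) ^ card A * sg {c} A"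
        using sg_swap[of "{c}" A] fin e by simp
      have s4: "sg {c} J = sg {c} A * sg {c} E"
        using sg_Un_right[of A E "{c}"] fin e by simp
      show "sg {c} J *\<^sub>R (sg A (insert c J - A) *\<^sub>R (coef x A * coef y (insert c J - A))) +
        sg {c} J *\<^sub>R (sg (insert c A) (insert c J - insert c A) *\<^sub>R
          (coef x (insert c A) * coef y (insert c J - insert c A))) =
        sg A (J - A) *\<^sub>R (coef (iota1 c x) A * coef y (J - A)) +
        sg A (J - A) *\<^sub>R (coef (gam x) A * coef (iota1 c y) (J - A))"
        unfolding E_def[symmetric] e(1,2) s4 using fin e(4-6)
        by (simp add: coef_iota1 s1 s2 s3 mult_ac)
    qed
    finally show ?thesis .
  qed
qed

section \<open>Quaternions\<close>

instantiation quat :: real_algebra_1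
begin

definition zero_quat_def: "0 = Quat 0 0 0 0"
definition one_quat_def: "1 = qone"
definition plus_quat_def: "p + q = Quat (re p + re q) (im_i p + im_i q) (im_j p + im_j q) (im_k p + im_k q)"
definition minus_quat_def: "p - q = Quat (re p - re q) (im_i p - im_i q) (im_j p - im_j q) (im_k p - im_k q)"
definition uminus_quat_def: "- p = Quat (- re p) (- im_i p) (- im_j p) (- im_k p)"
definition times_quat_def: "p * q = qmult p q"
definition scaleR_quat_def: "r *\<^sub>R p = Quat (r * re p) (r * im_i p) (r * im_j p) (r * im_k p)"

instance
  by standard (auto simp: zero_quat_def one_quat_def qone_def plus_quat_def minus_quat_def uminus_quat_def
    times_quat_def qmult_def scaleR_quat_def algebra_simps intro!: quat.expand)

end

instantiation quat :: real_normed_algebra_1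
begin

text \<open>The sum norm: only the topology matters, and its axioms are immediate.\<close>
definition norm_quat_def: "norm p = \<bar>re p\<bar> + \<bar>im_i p\<bar> + \<bar>im_j p\<bar> + \<bar>im_k p\<bar>"
definition sgn_quat_def: "sgn (p::quat) = p /\<^sub>R norm p"
definition dist_quat_def: "dist (p::quat) q = norm (p - q)"
definition uniformity_quat_def [code del]:
  "(uniformity :: (quat \<times> quat) filter) = (INF e\<in>{0 <..}. principal {(x, y). dist x y < e})"
definition open_quat_def [code del]:
  "open (U :: quat set) \<longleftrightarrow> (\<forall>x\<in>U. eventually (\<lambda>(x', y). x' = x \<longrightarrow> y \<in> U) uniformity)"

instance
proof
  fix p q r :: quat and a b :: real
  note defs = zero_quat_def one_quat_def qone_def plus_quat_def minus_quat_def uminus_quat_def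
    times_quat_def qmult_def scaleR_quat_def norm_quat_def
  show "norm (p * q) \<le> norm p * norm q"
  proof -
    have *: "\<bar>x\<bar> \<le> X \<Longrightarrow> \<bar>y\<bar> \<le> Y \<Longrightarrow> \<bar>z\<bar> \<le> Z \<Longrightarrow> \<bar>t\<bar> \<le> T \<Longrightarrow> \<bar>x\<bar> + \<bar>y\<bar> + \<bar>z\<bar> + \<bar>t\<bar> \<le> X + Y + Z + T"
      for x y z t X Y Z T :: real by linarith
    have **: "\<bar>x + y + z + t\<bar> \<le> \<bar>x\<bar> + \<bar>y\<bar> + \<bar>z\<bar> + \<bar>t\<bar>" "\<bar>x - y - z - t\<bar> \<le> \<bar>x\<bar> + \<bar>y\<bar> + \<bar>z\<bar> + \<bar>t\<bar>"
      "\<bar>x + y + z - t\<bar> \<le> \<bar>x\<bar> + \<bar>y\<bar> + \<bar>z\<bar> + \<bar>t\<bar>" "\<bar>x - y + z + t\<bar> \<le> \<bar>x\<bar> + \<bar>y\<bar> + \<bar>z\<bar> + \<bar>t\<bar>"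
      "\<bar>x + y - z + t\<bar> \<le> \<bar>x\<bar> + \<bar>y\<bar> + \<bar>z\<bar> + \<bar>t\<bar>"
      for x y z t :: real by linarith+
    have "norm (p * q) \<le>
      (\<bar>re p * re q\<bar> + \<bar>im_i p * im_i q\<bar> + \<bar>im_j p * im_j q\<bar> + \<bar>im_k p * im_k q\<bar>) +
      (\<bar>re p * im_i q\<bar> + \<bar>im_i p * re q\<bar> + \<bar>im_j p * im_k q\<bar> + \<bar>im_k p * im_j q\<bar>) +
      (\<bar>re p * im_j q\<bar> + \<bar>im_i p * im_k q\<bar> + \<bar>im_j p * re q\<bar> + \<bar>im_k p * im_i q\<bar>) +
      (\<bar>re p * im_k q\<bar> + \<bar>im_i p * im_j q\<bar> + \<bar>im_j p * im_i q\<bar> + \<bar>im_k p * re q\<bar>)"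
      unfolding defs quat.sel by (intro * **)
    also have "\<dots> = norm p * norm q"
      by (simp add: norm_quat_def abs_mult algebra_simps)
    finally show ?thesis .
  qed
  show "dist p q = norm (p - q)" by (rule dist_quat_def)
  show "sgn p = p /\<^sub>R norm p" by (rule sgn_quat_def)
  show "(uniformity :: (quat \<times> quat) filter) = (INF e\<in>{0 <..}. principal {(x, y). dist x y < e})"
    by (rule uniformity_quat_def)
  show "open U \<longleftrightarrow> (\<forall>x\<in>U. eventually (\<lambda>(x', y). x' = x \<longrightarrow> y \<in> U) uniformity)" for U :: "quat set"
    by (rule open_quat_def)
  show "(norm p = 0) = (p = 0)"
    by (cases p) (auto simp: defs add_nonneg_eq_0_iff)
  show "norm (a *\<^sub>R p) = \<bar>a\<bar> * norm p"
    by (simp add: defs abs_mult algebra_simps)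
  have "norm (p + q) \<le> (\<bar>re p\<bar> + \<bar>re q\<bar>) + (\<bar>im_i p\<bar> + \<bar>im_i q\<bar>) + (\<bar>im_j p\<bar> + \<bar>im_j q\<bar>) + (\<bar>im_k p\<bar> + \<bar>im_k q\<bar>)"
    unfolding defs quat.sel by (intro add_mono abs_triangle_ineq)
  then show "norm (p + q) \<le> norm p + norm q"
    by (simp add: norm_quat_def add_ac)
  show "norm (1::quat) = 1"
    by (simp add: defs)
qed

end

lemma quat_sel [simp]:
  "re 0 = 0" "im_i 0 = 0" "im_j 0 = 0" "im_k 0 = 0"
  "re 1 = 1" "im_i 1 = 0" "im_j 1 = 0" "im_k 1 = 0"
  "re (p + q) = re p + re q" "im_i (p + q) = im_i p + im_i q" "im_j (p + q) = im_j p + im_j q" "im_k (p + q) = im_k p + im_k q"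
  "re (p - q) = re p - re q" "im_i (p - q) = im_i p - im_i q" "im_j (p - q) = im_j p - im_j q" "im_k (p - q) = im_k p - im_k q"
  "re (- p) = - re p" "im_i (- p) = - im_i p" "im_j (- p) = - im_j p" "im_k (- p) = - im_k p"
  "re (r *\<^sub>R p) = r * re p" "im_i (r *\<^sub>R p) = r * im_i p" "im_j (r *\<^sub>R p) = r * im_j p" "im_k (r *\<^sub>R p) = r * im_k p"
  "re (p * q) = re p * re q - im_i p * im_i q - im_j p * im_j q - im_k p * im_k q"
  "im_i (p * q) = re p * im_i q + im_i p * re q + im_j p * im_k q - im_k p * im_j q"
  "im_j (p * q) = re p * im_j q - im_i p * im_k q + im_j p * re q + im_k p * im_i q"
  "im_k (p * q) = re p * im_k q + im_i p * im_j q - im_j p * im_i q + im_k p * re q"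
  "re (qconj p) = re p" "im_i (qconj p) = - im_i p" "im_j (qconj p) = - im_j p" "im_k (qconj p) = - im_k p"
  by (simp_all add: zero_quat_def one_quat_def qone_def plus_quat_def minus_quat_def uminus_quat_def
    times_quat_def qmult_def scaleR_quat_def qconj_def)

lemma re_mult_commute: "re (p * q) = re (q * p)"
  by simp

lemma qconj_simps [simp]: "qconj 0 = 0" "qconj 1 = 1" "qconj (p + q) = qconj p + qconj q"
  "qconj (p - q) = qconj p - qconj q" "qconj (- p) = - qconj p" "qconj (r *\<^sub>R p) = r *\<^sub>R qconj p" "qconj (qconj p) = p"
  by (auto intro!: quat.expand)

lemma qconj_mult: "qconj (p * q) = qconj q * qconj p"
  by (auto intro!: quat.expand)

lemma Sp1_iff: "p \<in> Sp1 \<longleftrightarrow> p * qconj p = 1" "p \<in> Sp1 \<longleftrightarrow> qconj p * p = 1"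
  by (auto simp: Sp1_def quat.expand power2_eq_square intro!: quat.expand dest: arg_cong[where f = re])

lemma Sp1_mult: "p \<in> Sp1 \<Longrightarrow> q \<in> Sp1 \<Longrightarrow> p * q \<in> Sp1"
  by (simp add: Sp1_iff(1) qconj_mult mult.assoc) (metis Sp1_iff(1) mult.assoc mult_1_left)

lemma Sp1_qconj: "p \<in> Sp1 \<Longrightarrow> qconj p \<in> Sp1"
  by (simp add: Sp1_def)

lemma Sp1_one: "1 \<in> Sp1"
  by (simp add: Sp1_def)

lemma bounded_linear_quat:
  "bounded_linear re" "bounded_linear im_i" "bounded_linear im_j" "bounded_linear im_k" "bounded_linear qconj"
  by (rule bounded_linear_intro[where K = 1]; simp add: norm_quat_def)+

subsection \<open>Coefficientwise linear maps\<close>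

definition mapga :: "('a::real_algebra_1 \<Rightarrow> 'b::real_algebra_1) \<Rightarrow> 'a ga \<Rightarrow> 'b ga" where
  "mapga f x = mk (\<lambda>J. f (coef x J))"

lemma coef_mapga: "linear f \<Longrightarrow> coef (mapga f x) J = f (coef x J)"
  by (cases "finite J") (simp_all add: mapga_def coef_mk linear_0)

lemma mapga_simps:
  assumes "linear f"
  shows "mapga f 0 = 0" "mapga f (x + y) = mapga f x + mapga f y" "mapga f (x - y) = mapga f x - mapga f y"
    "mapga f (- x) = - mapga f x" "mapga f (r *\<^sub>R x) = r *\<^sub>R mapga f x" "mapga f (cst a) = cst (f a)"
    "mapga f (gam x) = gam (mapga f x)" "mapga f (evec c * x) = evec c * mapga f x"
    "mapga f (iota1 c x) = iota1 c (mapga f x)"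
  by (rule ga_eqI; simp add: coef_mapga[OF assms] linear_0[OF assms] linear_add[OF assms] linear_diff[OF assms]
      linear_neg[OF assms] linear_scale[OF assms] coef_cst coef_evec_mult coef_iota1)+

lemma mapga_sum: "linear f \<Longrightarrow> mapga f (\<Sum>i\<in>S. g i) = (\<Sum>i\<in>S. mapga f (g i))"
  by (induction S rule: infinite_finite_induct) (auto simp: mapga_simps)

abbreviation "Re_ga \<equiv> mapga re"

lemma linear_quat: "linear re" "linear im_i" "linear im_j" "linear im_k" "linear qconj"
  using bounded_linear_quat by (auto simp: bounded_linear.linear)

lemmas Re_ga_simps = mapga_simps[OF linear_quat(1)]

text \<open>The real part of a product of two quaternions does not depend on their order, and moving
  \<open>x\<close> past \<open>y\<close> costs no sign because an even form has coefficients only on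
  sets of even size.\<close>

lemma Re_ga_cyclic:
  assumes "gam x = x"
  shows "Re_ga (x * y) = Re_ga (y * x)"
proof (rule ga_eqI)
  fix J :: "nat set" assume J: "finite J"
  have "coef (Re_ga (x * y)) J = (\<Sum>A\<in>Pow J. sg A (J - A) * re (coef x A * coef y (J - A)))"
    using J by (simp add: coef_mapga linear_quat coef_mult linear_sum[OF linear_quat(1)] del: quat_sel(25))
  also have "\<dots> = (\<Sum>A\<in>Pow J. sg (J - A) A * re (coef y (J - A) * coef x A))"
  proof (rule sum.cong[OF refl])
    fix A assume A: "A \<in> Pow J"
    then have fin: "finite A" "finite (J - A)" using J by (auto intro: finite_subset)
    show "sg A (J - A) * re (coef x A * coef y (J - A)) = sg (J - A) A * re (coef y (J - A) * coef x A)"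
    proof (cases "even (card A)")
      case True
      then have "sg (J - A) A = sg A (J - A)" using sg_swap[of A "J - A"] fin by auto
      then show ?thesis by (simp add: re_mult_commute[of "coef x A"] del: quat_sel)
    next
      case False
      have "coef (gam x) A = coef x A" using assms by simp
      then have "coef x A = - coef x A" using False by simp
      then have "coef x A = 0" by (metis add.inverse_neutral add_eq_0_iff double_zero_sym eq_neg_iff_add_eq_0 scaleR_2 scaleR_eq_0_iff zero_neq_numeral)
      then show ?thesis by simp
    qed
  qed
  also have "\<dots> = (\<Sum>A\<in>Pow J. sg A (J - A) * re (coef y A * coef x (J - A)))"
    by (rule sum.reindex_bij_witness[of _ "\<lambda>A. J - A" "\<lambda>A. J - A"]) (auto simp: double_diff)
  also have "\<dots> = coef (Re_ga (y * x)) J"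
    using J by (simp add: coef_mapga linear_quat coef_mult linear_sum[OF linear_quat(1)] del: quat_sel(25))
  finally show "coef (Re_ga (x * y)) J = coef (Re_ga (y * x)) J" .
qed

section \<open>The equivariant differential\<close>

type_synonym pt = "nat \<Rightarrow> real"

definition iota :: "nat \<Rightarrow> 'a::real_algebra_1 ga \<Rightarrow> 'a ga" where
  "iota n x = (\<Sum>c\<in>{2*n..<3*n}. iota1 c x)"

lemma iota_simps [simp]: "iota n 0 = 0" "iota n (x + y) = iota n x + iota n y"
  "iota n (r *\<^sub>R x) = r *\<^sub>R iota n x" "iota n (cst a) = 0"
  "iota n (evec d) = (if 2*n \<le> d \<and> d < 3*n then 1 else 0)"
  by (simp_all add: iota_def sum.distrib scaleR_sum_right)

lemma iota_mult: "iota n (x * y) = iota n x * y + gam x * iota n y"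
  by (simp add: iota_def iota1_mult sum.distrib sum_distrib_left sum_distrib_right)

lemma iota_mapga: "linear f \<Longrightarrow> iota n (mapga f x) = mapga f (iota n x)"
  by (simp add: iota_def mapga_sum mapga_simps)

text \<open>Continuous partial derivatives along coordinate lines are all that Stokes' theorem on a
  box requires. Second derivatives are not part of the notion, so a second application of the
  differential always needs its own \<open>hasD\<close> fact.\<close>

definition C1 :: "(pt \<Rightarrow> 'a::real_normed_algebra_1 ga) \<Rightarrow> (nat \<Rightarrow> pt \<Rightarrow> 'a ga) \<Rightarrow> bool" where
  "C1 F F' \<longleftrightarrow> (\<forall>J. continuous_on UNIV (\<lambda>x. coef (F x) J)) \<and>
     (\<forall>c J. continuous_on UNIV (\<lambda>x. coef (F' c x) J)) \<and>
     (\<forall>c J x. ((\<lambda>s. coef (F (x(c := s))) J) has_vector_derivative coef (F' c x) J) (at (x c)))"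

text \<open>\<open>hasD n F G\<close>: the form \<open>F\<close> is continuously differentiable and \<open>G = d F - \<iota> F\<close>, where \<open>\<iota>\<close> is the
  contraction with the sum of the coordinate fields number \<open>2 n, \<dots>, 3 n - 1\<close>.\<close>
definition hasD :: "nat \<Rightarrow> (pt \<Rightarrow> 'a::real_normed_algebra_1 ga) \<Rightarrow> (pt \<Rightarrow> 'a ga) \<Rightarrow> bool" where
  "hasD n F G \<longleftrightarrow> (\<exists>F'. C1 F F' \<and> (\<forall>x. G x = (\<Sum>c<3*n. evec c * F' c x) - iota n (F x)))"

lemma hasD_cong: "hasD n F G \<Longrightarrow> (\<And>x. F x = F2 x) \<Longrightarrow> (\<And>x. G x = G2 x) \<Longrightarrow> hasD n F2 G2"
  by (metis ext)

lemma hasD_continuous: "hasD n F G \<Longrightarrow> continuous_on UNIV (\<lambda>x. coef (F x) J)"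
  by (auto simp: hasD_def C1_def)

lemma hasD_const: "hasD n (\<lambda>x. a) (\<lambda>x. - iota n a)"
  unfolding hasD_def C1_def by (rule exI[of _ "\<lambda>_ _. 0"]) simp

lemma hasD_zero: "hasD n (\<lambda>x. 0) (\<lambda>x. 0)"
  using hasD_const[of n 0] by simp

lemma hasD_add:
  assumes "hasD n F G" "hasD n F2 G2"
  shows "hasD n (\<lambda>x. F x + F2 x) (\<lambda>x. G x + G2 x)"
proof -
  from assms obtain F' F2' where *: "C1 F F'" "\<forall>x. G x = (\<Sum>c<3*n. evec c * F' c x) - iota n (F x)"
    "C1 F2 F2'" "\<forall>x. G2 x = (\<Sum>c<3*n. evec c * F2' c x) - iota n (F2 x)"
    by (auto simp: hasD_def)
  show ?thesis unfolding hasD_def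
  proof (intro exI conjI)
    show "C1 (\<lambda>x. F x + F2 x) (\<lambda>c x. F' c x + F2' c x)"
      using *(1,3) by (auto simp: C1_def intro!: continuous_intros has_vector_derivative_add)
  qed (simp add: * algebra_simps sum.distrib)
qed

lemma hasD_map:
  assumes "hasD n F G" "bounded_linear f"
  shows "hasD n (\<lambda>x. mapga f (F x)) (\<lambda>x. mapga f (G x))"
proof -
  from assms obtain F' where *: "C1 F F'" "\<forall>x. G x = (\<Sum>c<3*n. evec c * F' c x) - iota n (F x)"
    by (auto simp: hasD_def)
  have lin: "linear f" using assms(2) by (rule bounded_linear.linear)
  show ?thesis unfolding hasD_def
  proof (intro exI conjI)
    show "C1 (\<lambda>x. mapga f (F x)) (\<lambda>c x. mapga f (F' c x))"
      unfolding C1_def coef_mapga[OF lin]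
      by (intro conjI allI bounded_linear.continuous_on[OF assms(2)] bounded_linear.has_vector_derivative[OF assms(2)])
        (use *(1) in \<open>auto simp: C1_def\<close>)
  qed (simp add: * mapga_simps[OF lin] mapga_sum[OF lin] iota_mapga[OF lin])
qed

lemma hasD_scaleR: "hasD n F G \<Longrightarrow> hasD n (\<lambda>x. r *\<^sub>R F x) (\<lambda>x. r *\<^sub>R G x)"
  by (rule hasD_cong[OF hasD_map[OF _ bounded_linear_scaleR_right]])
    (auto intro!: ga_eqI simp: coef_mapga bounded_linear.linear[OF bounded_linear_scaleR_right])

lemma hasD_minus: "hasD n F G \<Longrightarrow> hasD n (\<lambda>x. - F x) (\<lambda>x. - G x)"
  using hasD_scaleR[of n F G "-1"] by simp

lemma hasD_diff: "hasD n F G \<Longrightarrow> hasD n F2 G2 \<Longrightarrow> hasD n (\<lambda>x. F x - F2 x) (\<lambda>x. G x - G2 x)"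
  using hasD_add[OF _ hasD_minus, of n F G F2 G2] by simp

lemma hasD_mult:
  assumes "hasD n F G" "hasD n F2 G2"
  shows "hasD n (\<lambda>x. F x * F2 x) (\<lambda>x. G x * F2 x + gam (F x) * G2 x)"
proof -
  from assms obtain F' F2' where *: "C1 F F'" "\<forall>x. G x = (\<Sum>c<3*n. evec c * F' c x) - iota n (F x)"
    "C1 F2 F2'" "\<forall>x. G2 x = (\<Sum>c<3*n. evec c * F2' c x) - iota n (F2 x)"
    by (auto simp: hasD_def)
  have c1: "\<And>J. continuous_on UNIV (\<lambda>x. coef (F x) J)" "\<And>J. continuous_on UNIV (\<lambda>x. coef (F2 x) J)"
    "\<And>c J. continuous_on UNIV (\<lambda>x. coef (F' c x) J)" "\<And>c J. continuous_on UNIV (\<lambda>x. coef (F2' c x) J)"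
    and d1: "\<And>c J x. ((\<lambda>s. coef (F (x(c := s))) J) has_vector_derivative coef (F' c x) J) (at (x c))"
    and d2: "\<And>c J x. ((\<lambda>s. coef (F2 (x(c := s))) J) has_vector_derivative coef (F2' c x) J) (at (x c))"
    using *(1,3) by (auto simp: C1_def)
  show ?thesis unfolding hasD_def
  proof (intro exI conjI allI)
    show "C1 (\<lambda>x. F x * F2 x) (\<lambda>c x. F' c x * F2 x + F x * F2' c x)"
      unfolding C1_def
    proof (intro conjI allI)
      fix J :: "nat set"
      show "continuous_on UNIV (\<lambda>x. coef (F x * F2 x) J)"
        by (cases "finite J") (auto simp: coef_mult intro!: continuous_intros c1)
      fix c
      show "continuous_on UNIV (\<lambda>x. coef (F' c x * F2 x + F x * F2' c x) J)"
        by (cases "finite J") (auto simp: coef_mult intro!: continuous_intros c1)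
      fix x
      show "((\<lambda>s. coef (F (x(c := s)) * F2 (x(c := s))) J) has_vector_derivative
          coef (F' c x * F2 x + F x * F2' c x) J) (at (x c))"
      proof (cases "finite J")
        case True
        have "((\<lambda>s. \<Sum>A\<in>Pow J. sg A (J - A) *\<^sub>R (coef (F (x(c := s))) A * coef (F2 (x(c := s))) (J - A)))
          has_vector_derivative (\<Sum>A\<in>Pow J. sg A (J - A) *\<^sub>R
            (coef (F (x(c := x c))) A * coef (F2' c x) (J - A) + coef (F' c x) A * coef (F2 (x(c := x c))) (J - A)))) (at (x c))"
          by (intro has_vector_derivative_sum bounded_linear.has_vector_derivative[OF bounded_linear_scaleR_right]
              has_vector_derivative_mult d1 d2)
        then show ?thesis using True
          by (simp add: coef_mult algebra_simps sum.distrib)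
      qed simp
    qed
    fix x
    have "evec c * (F x * F2' c x) = gam (F x) * (evec c * F2' c x)" for c
      by (metis evec_mult mult.assoc)
    then show "G x * F2 x + gam (F x) * G2 x =
        (\<Sum>c<3*n. evec c * (F' c x * F2 x + F x * F2' c x)) - iota n (F x * F2 x)"
      by (simp add: * iota_mult sum.distrib sum_distrib_left sum_distrib_right algebra_simps)
  qed
qed

lemma hasD_prod_list:
  assumes "\<And>i. i \<in> set is \<Longrightarrow> hasD n (F i) (\<lambda>x. 0)"
  shows "hasD n (\<lambda>x. prod_list (map (\<lambda>i. F i x) is)) (\<lambda>x. 0)"
  using assms
proof (induction "is")
  case Nil
  then show ?case using hasD_const[of n 1] by (simp flip: cst_simps(2))
next
  case (Cons a as)
  show ?case
    by (rule hasD_cong[OF hasD_mult[OF Cons.prems Cons.IH]]) (use Cons.prems in auto)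
qed

lemma hasD_coord: "c < 3 * n \<Longrightarrow> hasD n (\<lambda>x. cst (x c)) (\<lambda>x. evec c)"
  unfolding hasD_def
proof (intro exI conjI allI)
  assume c: "c < 3 * n"
  show "C1 (\<lambda>x. cst (x c)) (\<lambda>d x. if d = c then 1 else 0)"
    unfolding C1_def
  proof (intro conjI allI)
    fix J
    show "continuous_on UNIV (\<lambda>x::pt. coef (cst (x c)) J)"
      by (cases "J = {}") (auto simp: coef_cst)
    fix d x
    show "((\<lambda>s. coef (cst ((x(d := s)) c)) J) has_vector_derivative coef (if d = c then 1 else 0 :: real ga) J) (at (x d))"
      by (auto simp: coef_cst one_ga_def coef_mk)
  qed auto
  show "evec c = (\<Sum>d<3*n. evec d * (if d = c then 1 else 0 :: real ga)) - iota n (cst (x c))" for x :: pt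
    using c by (simp add: if_distrib[of "\<lambda>t. _ * t"] sum.delta cong: if_cong)
qed

lemma hasD_fun:
  assumes p: "hasD n (\<lambda>x. cst (p x)) dp"
    and f: "\<And>t. (f has_real_derivative f' t) (at t)" and f': "continuous_on UNIV f'"
  shows "hasD n (\<lambda>x. cst (f (p x))) (\<lambda>x. f' (p x) *\<^sub>R dp x)"
proof -
  from p obtain P' where *: "C1 (\<lambda>x. cst (p x)) P'" "\<forall>x. dp x = (\<Sum>c<3*n. evec c * P' c x) - iota n (cst (p x))"
    by (auto simp: hasD_def)
  have cp: "continuous_on UNIV p"
    using *(1)[unfolded C1_def, THEN conjunct1, rule_format, of "{}"] by (simp add: coef_cst)
  have f'p: "continuous_on UNIV (\<lambda>x. f' (p x))"
    by (rule continuous_on_compose2[OF f' cp]) simp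
  have fc: "continuous_on UNIV f"
    by (meson DERIV_continuous continuous_at_imp_continuous_on f)
  have fp: "continuous_on UNIV (\<lambda>x. f (p x))"
    by (rule continuous_on_compose2[OF fc cp]) simp
  have d: "((\<lambda>s. coef (cst (p (x(c := s)))) J) has_vector_derivative coef (P' c x) J) (at (x c))" for c J x
    using *(1) by (auto simp: C1_def)
  have zero: "coef (P' c x) J = 0" if "J \<noteq> {}" for c x J
    using d[of x c J] that by (simp add: coef_cst vector_derivative_unique_at[OF has_vector_derivative_const])
  show ?thesis unfolding hasD_def
  proof (intro exI conjI allI)
    show "C1 (\<lambda>x. cst (f (p x))) (\<lambda>c x. f' (p x) *\<^sub>R P' c x)"
      unfolding C1_def
    proof (intro conjI allI)
      fix J
      show "continuous_on UNIV (\<lambda>x::pt. coef (cst (f (p x))) J)"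
        by (cases "J = {}") (auto simp: coef_cst fp)
      fix c
      show "continuous_on UNIV (\<lambda>x. coef (f' (p x) *\<^sub>R P' c x) J)"
        using *(1) by (auto simp: C1_def intro!: continuous_intros f'p)
      fix x
      show "((\<lambda>s. coef (cst (f (p (x(c := s))))) J) has_vector_derivative coef (f' (p x) *\<^sub>R P' c x) J) (at (x c))"
      proof (cases "J = {}")
        case True
        have "((\<lambda>s. p (x(c := s))) has_real_derivative coef (P' c x) {}) (at (x c))"
          using d[of x c "{}"] by (simp add: coef_cst has_real_derivative_iff_has_vector_derivative)
        then have "((\<lambda>s. f (p (x(c := s)))) has_real_derivative f' (p (x(c := x c))) * coef (P' c x) {}) (at (x c))"
          by (rule DERIV_chain2[OF f])
        then show ?thesis
          by (simp add: True coef_cst has_real_derivative_iff_has_vector_derivative)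
      next
        case False
        then show ?thesis by (simp add: coef_cst zero)
      qed
    qed
    show "f' (p x) *\<^sub>R dp x = (\<Sum>c<3*n. evec c * (f' (p x) *\<^sub>R P' c x)) - iota n (cst (f (p x)))" for x
      by (simp add: * scaleR_sum_right)
  qed
qed

section \<open>Unit quaternion fields and the Polyakov--Wiegmann identity\<close>

text \<open>The infinitesimal generator of conjugation by exp(i s/2), which fixes the circle exp(i
  t) and turns the plane of j and k by the angle s.\<close>

definition ehalf :: quat where "ehalf = Quat 0 (1/2) 0 0"

lemma Sp1_inverse: "p \<in> Sp1 \<Longrightarrow> p * qconj p = 1" "p \<in> Sp1 \<Longrightarrow> qconj p * p = 1"
  using Sp1_iff by blast+

text \<open>When \<open>a\<close> is the differential of \<open>v\<close>, these are the left and
  right Maurer--Cartan forms.\<close>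

definition Lform :: "quat \<Rightarrow> quat ga \<Rightarrow> quat ga" where "Lform v a = cst (qconj v) * a"
definition Rform :: "quat \<Rightarrow> quat ga \<Rightarrow> quat ga" where "Rform v a = a * cst (qconj v)"

text \<open>Write e for \<open>ehalf\<close> and L for the left form. The contraction of Re(L^3) is
  3 Re((v^-1 e v - e) L^2), which is exactly the differential of the linear term; the contraction of
  the linear term is 0 by cyclicity of the real part. This determines the factor 3.\<close>

definition chi :: "quat \<Rightarrow> quat ga \<Rightarrow> real ga" where
  "chi v a = Re_ga (Lform v a * Lform v a * Lform v a + 3 *\<^sub>R (cst ehalf * (Lform v a + Rform v a)))"

lemma Re_ga_conj:
  assumes "gam X = X" "y * X = 1"
  shows "Re_ga (X * Z * y) = Re_ga Z"
  by (metis Re_ga_cyclic assms mult.assoc mult.right_neutral)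

text \<open>The Maurer--Cartan forms of the product are conjugates of \<open>L + R\<close>, by
  \<open>w\<close> for the left form and by \<open>v\<close> for the right one. Cyclicity reduces
  the mixed cubic terms to 3 Re(L L R + L R R), and the mixed linear terms give the summands with
  \<open>ehalf\<close>. The right side is arranged as the Leibniz rule will produce it from -3 Re(L
  R).\<close>

lemma chi_mult:
  fixes v w :: quat and a b :: "quat ga"
  assumes v: "v \<in> Sp1" and w: "w \<in> Sp1" and a: "gam a = - a" and b: "gam b = - b"
  defines "L \<equiv> Lform v a" and "R \<equiv> Rform w b"
  shows "chi (v * w) (a * cst w + cst v * b) - chi v a - chi w b =
    (-3) *\<^sub>R Re_ga ((- (L * L) + cst (ehalf - qconj v * ehalf * v)) * R
      - L * (R * R + cst (w * ehalf * qconj w - ehalf)))"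
proof -
  define x X y Y E where "x = cst v" and "X = cst (qconj v)" and "y = cst w" and "Y = cst (qconj w)" and "E = cst ehalf"
  have inv [simp]: "x * X = 1" "X * x = 1" "y * Y = 1" "Y * y = 1"
    using v w by (simp_all add: x_def X_def y_def Y_def Sp1_inverse flip: cst_mult)
  have inv2 [simp]: "x * (X * z) = z" "X * (x * z) = z" "y * (Y * z) = z" "Y * (y * z) = z" for z
    by (simp_all flip: mult.assoc)
  have gam [simp]: "gam x = x" "gam X = X" "gam y = y" "gam Y = Y" "gam E = E" "gam L = - L" "gam R = - R"
    using a b by (simp_all add: x_def X_def y_def Y_def E_def L_def R_def Lform_def Rform_def)
  define M where "M = L + R"
  have L: "L = X * a" and R: "R = b * Y"
    by (simp_all add: L_def R_def Lform_def Rform_def X_def Y_def)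
  have Lvw: "Lform (v * w) (a * cst w + cst v * b) = Y * M * y"
    by (simp add: Lform_def qconj_mult cst_mult M_def L R algebra_simps flip: X_def Y_def x_def y_def)
  have Rvw: "Rform (v * w) (a * cst w + cst v * b) = x * M * X"
    by (simp add: Rform_def qconj_mult cst_mult M_def L R algebra_simps flip: X_def Y_def x_def y_def)
  have Rv: "Rform v a = x * L * X" and Lw: "Lform w b = Y * R * y"
    by (simp_all add: Rform_def Lform_def L R algebra_simps flip: X_def Y_def x_def y_def)
  have 1: "Re_ga (Y * Z * y) = Re_ga Z" for Z
    by (rule Re_ga_conj) simp_all
  have chi_vw: "chi (v * w) (a * cst w + cst v * b) =
      Re_ga (M * M * M) + 3 *\<^sub>R (Re_ga (E * (Y * M * y)) + Re_ga (E * (x * M * X)))"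
    using 1[of "M * M * M"] unfolding chi_def Lvw Rvw E_def[symmetric]
    by (simp add: Re_ga_simps algebra_simps)
  have chi_v: "chi v a = Re_ga (L * L * L) + 3 *\<^sub>R (Re_ga (E * L) + Re_ga (E * (x * L * X)))"
    unfolding chi_def Rv E_def[symmetric] L_def[symmetric] by (simp add: Re_ga_simps algebra_simps)
  have chi_w: "chi w b = Re_ga (R * R * R) + 3 *\<^sub>R (Re_ga (E * (Y * R * y)) + Re_ga (E * R))"
    using 1[of "R * R * R"] unfolding chi_def Lw E_def[symmetric] R_def[symmetric]
    by (simp add: Re_ga_simps algebra_simps)
  have c1: "Re_ga (E * (Y * (L * y))) = Re_ga (L * (y * (E * Y)))"
    using Re_ga_cyclic[of "E * Y" "L * y"] by (simp add: mult.assoc)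
  have c2: "Re_ga (E * (x * (R * X))) = Re_ga (X * (E * (x * R)))"
    using Re_ga_cyclic[of X "E * (x * R)"] by (simp add: mult.assoc)
  have c3: "Re_ga (E * L) = Re_ga (L * E)"
    by (rule Re_ga_cyclic) simp
  have c4: "Re_ga (R * (L * L)) = Re_ga (L * (L * R))" "Re_ga (R * (R * L)) = Re_ga (L * (R * R))"
    using Re_ga_cyclic[of "L * L" R] Re_ga_cyclic[of "R * R" L] by (simp_all add: mult.assoc)
  have c5: "Re_ga (L * (R * L)) = Re_ga (L * (L * R))" "Re_ga (R * (L * R)) = Re_ga (L * (R * R))"
    using Re_ga_cyclic[of "R * L" L] Re_ga_cyclic[of "L * R" R] c4 by (simp_all add: mult.assoc)
  have three: "3 *\<^sub>R z = z + z + z" for z :: "real ga"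
    using scaleR_left_distrib[of 2 1 z] by (simp add: scaleR_2)
  show ?thesis
    unfolding chi_vw chi_v chi_w cst_diff cst_mult M_def
    by (simp add: Re_ga_simps algebra_simps c1 c2 c3 c4 c5 flip: X_def Y_def x_def y_def E_def)
      (simp add: three add_ac)
qed

text \<open>Allows identities to be differentiated: two computations of the differential of one form
  must agree, as for V times its conjugate being 1, or for the norm of V being 1.\<close>

lemma hasD_unique: "hasD n F G \<Longrightarrow> hasD n F H \<Longrightarrow> G x = H x"
proof -
  assume "hasD n F G" "hasD n F H"
  then obtain F1 F2 where *: "C1 F F1" "\<forall>x. G x = (\<Sum>c<3*n. evec c * F1 c x) - iota n (F x)"
    "C1 F F2" "\<forall>x. H x = (\<Sum>c<3*n. evec c * F2 c x) - iota n (F x)"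
    by (auto simp: hasD_def)
  have "F1 c x = F2 c x" for c
  proof (rule ga_eqI)
    fix J
    show "coef (F1 c x) J = coef (F2 c x) J"
      using *(1,3) by (intro vector_derivative_unique_at[of "\<lambda>s. coef (F (x(c := s))) J" _ "x c"]) (simp_all add: C1_def)
  qed
  then show ?thesis by (simp add: *)
qed

text \<open>Since \<open>D (D V) = - \<xi> V\<close> for the contracted vector field \<open>\<xi>\<close>, the last condition says that \<open>\<xi>\<close> acts on \<open>V\<close>
  by conjugation: \<open>\<xi> V = [i/2, V]\<close>.\<close>
definition ufield :: "nat \<Rightarrow> (pt \<Rightarrow> quat) \<Rightarrow> (pt \<Rightarrow> quat ga) \<Rightarrow> bool" where
  "ufield n V dV \<longleftrightarrow> (\<forall>x. V x \<in> Sp1) \<and> (\<forall>x. gam (dV x) = - dV x) \<and>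
     hasD n (\<lambda>x. cst (V x)) dV \<and> hasD n dV (\<lambda>x. cst (V x * ehalf - ehalf * V x))"

lemma ufield_mult:
  assumes "ufield n V dV" "ufield n W dW"
  shows "ufield n (\<lambda>x. V x * W x) (\<lambda>x. dV x * cst (W x) + cst (V x) * dW x)"
proof -
  have V: "hasD n (\<lambda>x. cst (V x)) dV" "hasD n dV (\<lambda>x. cst (V x * ehalf - ehalf * V x))" "\<And>x. gam (dV x) = - dV x"
    and W: "hasD n (\<lambda>x. cst (W x)) dW" "hasD n dW (\<lambda>x. cst (W x * ehalf - ehalf * W x))" "\<And>x. gam (dW x) = - dW x"
    using assms by (auto simp: ufield_def)
  have "hasD n (\<lambda>x. cst (V x * W x)) (\<lambda>x. dV x * cst (W x) + cst (V x) * dW x)"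
    by (rule hasD_cong[OF hasD_mult[OF V(1) W(1)]]) (simp_all add: cst_mult)
  moreover have "hasD n (\<lambda>x. dV x * cst (W x) + cst (V x) * dW x)
      (\<lambda>x. cst (V x * W x * ehalf - ehalf * (V x * W x)))"
    by (rule hasD_cong[OF hasD_add[OF hasD_mult[OF V(2) W(1)] hasD_mult[OF V(1) W(2)]]])
      (simp_all add: V(3) cst_mult cst_diff algebra_simps)
  ultimately show ?thesis
    using assms by (auto simp: ufield_def Sp1_mult V W)
qed

lemma ufield_one: "ufield n (\<lambda>x. 1) (\<lambda>x. 0)"
  using hasD_const[of n 1] by (simp add: ufield_def Sp1_one hasD_zero flip: cst_simps(2))

lemma qconj_ehalf: "qconj ehalf = - ehalf"
  by (auto simp: ehalf_def qconj_def intro!: quat.expand)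

lemma ufield_conj:
  assumes "ufield n V dV"
  shows "ufield n (\<lambda>x. qconj (V x)) (\<lambda>x. mapga qconj (dV x))"
proof -
  note m = mapga_simps[OF linear_quat(5)] and bl = bounded_linear_quat(5)
  have V: "hasD n (\<lambda>x. cst (V x)) dV" "hasD n dV (\<lambda>x. cst (V x * ehalf - ehalf * V x))" "\<And>x. gam (dV x) = - dV x"
    using assms by (auto simp: ufield_def)
  have "hasD n (\<lambda>x. cst (qconj (V x))) (\<lambda>x. mapga qconj (dV x))"
    by (rule hasD_cong[OF hasD_map[OF V(1) bl]]) (simp_all add: m)
  moreover have "hasD n (\<lambda>x. mapga qconj (dV x)) (\<lambda>x. cst (qconj (V x) * ehalf - ehalf * qconj (V x)))"
    by (rule hasD_cong[OF hasD_map[OF V(2) bl]]) (simp_all add: m qconj_mult qconj_ehalf)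
  ultimately show ?thesis
    using assms by (auto simp: ufield_def Sp1_qconj V m simp flip: m(7))
qed

lemma ufield_dconj:
  assumes "ufield n V dV"
  shows "mapga qconj (dV x) = - (cst (qconj (V x)) * dV x * cst (qconj (V x)))"
proof -
  have 1: "cst (V x) * cst (qconj (V x)) = 1" "cst (qconj (V x)) * cst (V x) = 1" for x
    using assms by (simp_all add: ufield_def Sp1_inverse flip: cst_mult)
  have "hasD n (\<lambda>x. cst (V x * qconj (V x))) (\<lambda>x. dV x * cst (qconj (V x)) + cst (V x) * mapga qconj (dV x))"
    using ufield_mult[OF assms ufield_conj[OF assms]] by (simp add: ufield_def)
  then have "hasD n (\<lambda>x. 1) (\<lambda>x. dV x * cst (qconj (V x)) + cst (V x) * mapga qconj (dV x))"
    by (rule hasD_cong) (simp_all add: cst_mult 1)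
  then have "dV x * cst (qconj (V x)) + cst (V x) * mapga qconj (dV x) = - iota n 1"
    by (rule hasD_unique[OF _ hasD_const])
  then have "cst (V x) * mapga qconj (dV x) = - (dV x * cst (qconj (V x)))"
    using iota_simps(4)[of n "1::quat"] by (simp add: eq_neg_iff_add_eq_0 add.commute)
  then have "cst (qconj (V x)) * (cst (V x) * mapga qconj (dV x)) = - (cst (qconj (V x)) * (dV x * cst (qconj (V x))))"
    by simp
  then show ?thesis by (simp add: 1 flip: mult.assoc)
qed

text \<open>Inversion exchanges the left and the right form up to sign. The linear term is symmetric
  in the two, and the cubes of the two are conjugate, so both terms just change sign.\<close>

lemma chi_conj:
  assumes "ufield n V dV"
  shows "chi (qconj (V x)) (mapga qconj (dV x)) = - chi (V x) (dV x)"
proof -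
  define v X a where "v = cst (V x)" and "X = cst (qconj (V x))" and "a = dV x"
  have [simp]: "v * X = 1" "X * v = 1"
    using assms by (simp_all add: v_def X_def ufield_def Sp1_inverse flip: cst_mult)
  have [simp]: "v * (X * z) = z" "X * (v * z) = z" for z
    by (simp_all flip: mult.assoc)
  have L: "Lform (qconj (V x)) (mapga qconj (dV x)) = - (a * X)" "Rform (qconj (V x)) (mapga qconj (dV x)) = - (X * a)"
    using ufield_dconj[OF assms, of x] by (simp_all add: Lform_def Rform_def mult.assoc flip: v_def X_def a_def)
  have L': "Lform (V x) (dV x) = X * a" "Rform (V x) (dV x) = a * X"
    by (simp_all add: Lform_def Rform_def flip: v_def X_def a_def)
  have "Re_ga (X * (a * X * (a * X) * (a * X)) * v) = Re_ga (a * X * (a * X) * (a * X))"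
    by (rule Re_ga_conj) (simp add: X_def, simp)
  then show ?thesis
    unfolding chi_def L L' by (simp add: Re_ga_simps algebra_simps)
qed

lemma hasD_Lform:
  assumes "ufield n V dV"
  shows "hasD n (\<lambda>x. Lform (V x) (dV x))
    (\<lambda>x. - (Lform (V x) (dV x) * Lform (V x) (dV x)) + cst (ehalf - qconj (V x) * ehalf * V x))"
proof -
  have V: "hasD n dV (\<lambda>x. cst (V x * ehalf - ehalf * V x))" "\<And>x. qconj (V x) * V x = 1"
    using assms by (auto simp: ufield_def Sp1_iff(2))
  have C: "hasD n (\<lambda>x. cst (qconj (V x))) (\<lambda>x. mapga qconj (dV x))"
    using ufield_conj[OF assms] by (auto simp: ufield_def)
  show ?thesis
  proof (rule hasD_cong[OF hasD_mult[OF C V(1)]])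
    fix x
    have "cst (qconj (V x)) * cst (V x * ehalf - ehalf * V x) = cst (ehalf - qconj (V x) * ehalf * V x)"
      using V(2)[of x] by (simp add: algebra_simps flip: cst_mult) (simp flip: mult.assoc)
    then show "mapga qconj (dV x) * dV x + gam (cst (qconj (V x))) * cst (V x * ehalf - ehalf * V x) =
        - (Lform (V x) (dV x) * Lform (V x) (dV x)) + cst (ehalf - qconj (V x) * ehalf * V x)"
      by (simp add: Lform_def ufield_dconj[OF assms] mult.assoc)
  qed (simp add: Lform_def)
qed

lemma hasD_Rform:
  assumes "ufield n V dV"
  shows "hasD n (\<lambda>x. Rform (V x) (dV x))
    (\<lambda>x. Rform (V x) (dV x) * Rform (V x) (dV x) + cst (V x * ehalf * qconj (V x) - ehalf))"
proof -
  have V: "hasD n dV (\<lambda>x. cst (V x * ehalf - ehalf * V x))" "\<And>x. V x * qconj (V x) = 1" "\<And>x. gam (dV x) = - dV x"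
    using assms by (auto simp: ufield_def Sp1_iff(1))
  have C: "hasD n (\<lambda>x. cst (qconj (V x))) (\<lambda>x. mapga qconj (dV x))"
    using ufield_conj[OF assms] by (auto simp: ufield_def)
  show ?thesis
  proof (rule hasD_cong[OF hasD_mult[OF V(1) C]])
    fix x
    have "cst (V x * ehalf - ehalf * V x) * cst (qconj (V x)) = cst (V x * ehalf * qconj (V x) - ehalf)"
      using V(2)[of x] by (simp add: algebra_simps flip: cst_mult)
    then show "cst (V x * ehalf - ehalf * V x) * cst (qconj (V x)) + gam (dV x) * mapga qconj (dV x) =
        Rform (V x) (dV x) * Rform (V x) (dV x) + cst (V x * ehalf * qconj (V x) - ehalf)"
      by (simp add: Rform_def ufield_dconj[OF assms] V(3) mult.assoc)
  qed (simp add: Rform_def)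
qed

lemma polyakov_wiegmann:
  assumes "ufield n V dV" "ufield n W dW"
  shows "hasD n (\<lambda>x. (-3) *\<^sub>R Re_ga (Lform (V x) (dV x) * Rform (W x) (dW x)))
    (\<lambda>x. chi (V x * W x) (dV x * cst (W x) + cst (V x) * dW x) - chi (V x) (dV x) - chi (W x) (dW x))"
proof (rule hasD_cong[OF hasD_scaleR[OF hasD_map[OF hasD_mult[OF hasD_Lform[OF assms(1)] hasD_Rform[OF assms(2)]]
        bounded_linear_quat(1)]]])
  fix x
  have a: "V x \<in> Sp1" "W x \<in> Sp1" "gam (dV x) = - dV x" "gam (dW x) = - dW x"
    using assms by (auto simp: ufield_def)
  then have "gam (Lform (V x) (dV x)) = - Lform (V x) (dV x)" by (simp add: Lform_def)
  then show "(-3) *\<^sub>R Re_ga ((- (Lform (V x) (dV x) * Lform (V x) (dV x)) + cst (ehalf - qconj (V x) * ehalf * V x)) *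
      Rform (W x) (dW x) + gam (Lform (V x) (dV x)) *
      (Rform (W x) (dW x) * Rform (W x) (dW x) + cst (W x * ehalf * qconj (W x) - ehalf))) =
    chi (V x * W x) (dV x * cst (W x) + cst (V x) * dW x) - chi (V x) (dV x) - chi (W x) (dW x)"
    unfolding chi_mult[OF a] by simp
qed simp

section \<open>Words\<close>

lemma word_hom_simps [simp]: "word_hom q [] = 1" "word_hom q (a # w) = qletter q a * word_hom q w"
  by (simp_all add: word_hom_def one_quat_def times_quat_def)

lemma word_hom_append: "word_hom q (a @ b) = word_hom q a * word_hom q b"
  by (induction a) (simp_all add: mult.assoc)

lemma word_hom_free_equiv:
  assumes q: "\<And>i. q i \<in> Sp1" and "free_equiv a b"
  shows "word_hom q a = word_hom q b"
proof -
  have letter: "qletter q x * (qletter q (letter_inv x) * y) = y" for x y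
    using q[of "fst x"] by (auto simp: qletter_def letter_inv_def Sp1_inverse simp flip: mult.assoc)
  have step: "word_hom q a = word_hom q b" if "red_step a b" for a b
    using that by (auto simp: red_step_def word_hom_append letter)
  show ?thesis
    using assms(2) unfolding free_equiv_def
    by (induction rule: equivclp_induct) (auto dest: step)
qed

definition dletter :: "(nat \<Rightarrow> quat ga) \<Rightarrow> nat \<times> bool \<Rightarrow> quat ga" where
  "dletter dq a = (if snd a then dq (fst a) else mapga qconj (dq (fst a)))"

primrec dword :: "(nat \<Rightarrow> quat) \<Rightarrow> (nat \<Rightarrow> quat ga) \<Rightarrow> word \<Rightarrow> quat ga" where
  "dword q dq [] = 0"
| "dword q dq (a # w) = dletter dq a * cst (word_hom q w) + cst (qletter q a) * dword q dq w"

text \<open>Collects one Polyakov--Wiegmann primitive for each left multiplication by a letter;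
  \<open>dword\<close> is the matching Leibniz rule.\<close>

primrec Pword :: "(nat \<Rightarrow> quat) \<Rightarrow> (nat \<Rightarrow> quat ga) \<Rightarrow> word \<Rightarrow> real ga" where
  "Pword q dq [] = 0"
| "Pword q dq (a # w) = Pword q dq w +
     (-3) *\<^sub>R Re_ga (Lform (qletter q a) (dletter dq a) * Rform (word_hom q w) (dword q dq w))"

definition letsum :: "(nat \<Rightarrow> 'a::real_vector) \<Rightarrow> word \<Rightarrow> 'a" where
  "letsum f w = (\<Sum>a\<leftarrow>w. (if snd a then 1 else -1) *\<^sub>R f (fst a))"

lemma letsum_simps [simp]: "letsum f [] = 0"
  "letsum f (a # w) = (if snd a then 1 else -1) *\<^sub>R f (fst a) + letsum f w"
  "letsum f (w @ w') = letsum f w + letsum f w'"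
  by (simp_all add: letsum_def)

lemma letsum_word_inv [simp]: "letsum f (word_inv w) = - letsum f w"
  by (induction w) (auto simp: word_inv_def letter_inv_def)

lemma letsum_commutator [simp]: "letsum f (commutator a b) = 0"
  by (simp add: commutator_def)

lemma letsum_commutators: "letsum f (concat (map (\<lambda>l. commutator (u l) (u' l)) ls)) = 0"
  by (induction ls) simp_all

context
  fixes n :: nat and q :: "pt \<Rightarrow> nat \<Rightarrow> quat" and dq :: "pt \<Rightarrow> nat \<Rightarrow> quat ga"
  assumes uf: "\<And>i. ufield n (\<lambda>x. q x i) (\<lambda>x. dq x i)"
begin

lemma ufield_letter: "ufield n (\<lambda>x. qletter (q x) a) (\<lambda>x. dletter (dq x) a)"
  using uf ufield_conj[OF uf] by (cases "snd a") (simp_all add: qletter_def dletter_def)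

lemma ufield_word: "ufield n (\<lambda>x. word_hom (q x) w) (\<lambda>x. dword (q x) (dq x) w)"
  by (induction w) (simp_all add: ufield_one ufield_mult ufield_letter)

lemma chi_letter: "chi (qletter (q x) a) (dletter (dq x) a) =
    (if snd a then 1 else -1) *\<^sub>R chi (q x (fst a)) (dq x (fst a))"
  using chi_conj[OF uf] by (simp add: qletter_def dletter_def)

text \<open>The sum over the letters is what is left after all corrections. It vanishes for products
  of commutators, and this is where the shape of v_0 enters on the analytic side.\<close>

lemma hasD_Pword:
  "hasD n (\<lambda>x. Pword (q x) (dq x) w)
    (\<lambda>x. chi (word_hom (q x) w) (dword (q x) (dq x) w) - letsum (\<lambda>i. chi (q x i) (dq x i)) w)"
proof (induction w)
  case Nil
  then show ?case by (rule hasD_cong[OF hasD_zero]) (simp_all add: chi_def Lform_def Rform_def Re_ga_simps)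
next
  case (Cons a w)
  show ?case
    by (rule hasD_cong[OF hasD_add[OF Cons polyakov_wiegmann[OF ufield_letter[of a] ufield_word[of w]]]])
      (simp_all add: chi_letter)
qed

end

section \<open>Explicit forms on the three-sphere\<close>

lemma iota_one [simp]: "iota n 1 = 0"
  using iota_simps(4)[of n 1] by simp

lemma real_odd_anticommute:
  fixes x y :: "real ga"
  assumes x: "gam x = - x" and y: "gam y = - y"
  shows "x * y = - (y * x)"
proof (rule ga_eqI)
  fix J :: "nat set" assume J: "finite J"
  have odd: "coef z A = 0" if "gam z = - z" "even (card A)" for z :: "real ga" and A
    using arg_cong[OF that(1), of "\<lambda>w. coef w A"] that(2) by simp
  have "coef (x * y) J = (\<Sum>A\<in>Pow J. - (sg (J - A) A * (coef y (J - A) * coef x A)))"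
    unfolding coef_mult[OF J]
  proof (rule sum.cong[OF refl])
    fix A assume A: "A \<in> Pow J"
    then have fin: "finite A" "finite (J - A)" using J by (auto intro: finite_subset)
    show "sg A (J - A) *\<^sub>R (coef x A * coef y (J - A)) = - (sg (J - A) A * (coef y (J - A) * coef x A))"
    proof (cases "even (card A) \<or> even (card (J - A))")
      case True
      then show ?thesis using odd[OF x, of A] odd[OF y, of "J - A"] by auto
    next
      case False
      then have "sg (J - A) A = - sg A (J - A)" using sg_swap[of A "J - A"] fin by auto
      then show ?thesis by simp
    qed
  qed
  also have "\<dots> = (\<Sum>A\<in>Pow J. - (sg A (J - A) * (coef y A * coef x (J - A))))"
    by (rule sum.reindex_bij_witness[of _ "\<lambda>A. J - A" "\<lambda>A. J - A"]) (auto simp: double_diff)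
  also have "\<dots> = coef (- (y * x)) J"
    by (simp add: coef_mult[OF J] sum_negf)
  finally show "coef (x * y) J = coef (- (y * x)) J" .
qed

lemma real_odd_square:
  fixes x :: "real ga"
  assumes "gam x = - x"
  shows "x * x = 0"
proof (rule ga_eqI)
  fix J
  have "coef (x * x) J = - coef (x * x) J"
    by (metis assms coef_uminus real_odd_anticommute)
  then show "coef (x * x) J = coef 0 J" by simp
qed

section \<open>Real components of quaternion-valued forms\<close>

definition emb :: "quat \<Rightarrow> real ga \<Rightarrow> quat ga" where
  "emb u x = mapga (\<lambda>r. r *\<^sub>R u) x"

lemma coef_emb: "coef (emb u x) J = coef x J *\<^sub>R u"
  by (simp add: emb_def coef_mapga bounded_linear.linear[OF bounded_linear_scaleR_left])

lemma emb_mult: "emb u x * emb v y = emb (u * v) (x * y)"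
  by (rule ga_eqI) (simp add: coef_mult coef_emb scaleR_sum_left mult_ac)

lemma Re_emb: "Re_ga (emb u x) = re u *\<^sub>R x"
  by (rule ga_eqI) (simp add: coef_mapga linear_quat coef_emb)

lemma emb_add: "emb u (x + y) = emb u x + emb u y"
  by (rule ga_eqI) (simp add: coef_emb algebra_simps)

abbreviation "qI \<equiv> Quat 0 1 0 0"
abbreviation "qJ \<equiv> Quat 0 0 1 0"
abbreviation "qK \<equiv> Quat 0 0 0 1"

lemma quat_units:
  "qI * qI = -1" "qJ * qJ = -1" "qK * qK = -1" "qI * qJ = qK" "qJ * qI = - qK"
  "qJ * qK = qI" "qK * qJ = - qI" "qK * qI = qJ" "qI * qK = - qJ"
  by (auto intro!: quat.expand)

lemma emb_neg: "emb (- u) x = - emb u x"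
  by (rule ga_eqI) (simp add: coef_emb)

text \<open>Odd real forms square to 0, so only the six products with three different units remain.
  For each of them the sign of the product of units matches the sign of reordering the forms, and qI
  qJ qK = -1.\<close>

lemma Re_cube:
  fixes l1 l2 l3 :: "real ga"
  assumes "gam l1 = - l1" "gam l2 = - l2" "gam l3 = - l3"
  defines "L \<equiv> emb qI l1 + emb qJ l2 + emb qK l3"
  shows "Re_ga (L * L * L) = (-6) *\<^sub>R (l1 * l2 * l3)"
proof -
  have s: "l1 * l1 = 0" "l2 * l2 = 0" "l3 * l3 = 0"
    using assms real_odd_square by blast+
  have a: "l2 * l1 = - (l1 * l2)" "l3 * l1 = - (l1 * l3)" "l3 * l2 = - (l2 * l3)"
    using assms real_odd_anticommute by blast+
  have s': "l1 * (l1 * z) = 0" "l2 * (l2 * z) = 0" "l3 * (l3 * z) = 0"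
    "l2 * (l1 * z) = - (l1 * (l2 * z))" "l3 * (l1 * z) = - (l1 * (l3 * z))" "l3 * (l2 * z) = - (l2 * (l3 * z))" for z
    by (simp_all add: s a flip: mult.assoc)
  show ?thesis
    by (rule ga_eqI)
      (simp add: L_def algebra_simps emb_mult Re_emb Re_ga_simps s a s')
qed

definition comp0 :: "quat ga \<Rightarrow> real ga" where "comp0 = mapga re"
definition comp1 :: "quat ga \<Rightarrow> real ga" where "comp1 = mapga im_i"
definition comp2 :: "quat ga \<Rightarrow> real ga" where "comp2 = mapga im_j"
definition comp3 :: "quat ga \<Rightarrow> real ga" where "comp3 = mapga im_k"

lemmas comp_defs = comp0_def comp1_def comp2_def comp3_def

text \<open>On the unit sphere \<open>Sform\<close> is the pullback of the area form of the two-sphere, scaled by the cube of the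
  norm of the imaginary part.\<close>
definition Sform :: "quat \<Rightarrow> quat ga \<Rightarrow> real ga" where
  "Sform v a = im_i v *\<^sub>R (comp2 a * comp3 a) + im_j v *\<^sub>R (comp3 a * comp1 a) + im_k v *\<^sub>R (comp1 a * comp2 a)"

text \<open>The contraction of dx0 dx1 dx2 dx3 with the radial field, where x0 is the real
  part.\<close>

definition volform :: "quat \<Rightarrow> quat ga \<Rightarrow> real ga" where
  "volform v a = re v *\<^sub>R (comp1 a * comp2 a * comp3 a) - comp0 a * Sform v a"

text \<open>A rotationally symmetric ansatz for a primitive of \<open>chi\<close> off the point -1.
  The factor of \<open>im_i v\<close> is forced by comparing the coefficients of
  \<open>comp1 a\<close>.\<close>

definition varpi :: "(real \<Rightarrow> real) \<Rightarrow> quat \<Rightarrow> quat ga \<Rightarrow> real ga" where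
  "varpi k v a = k (re v) *\<^sub>R Sform v a + cst ((k (re v) * (1 - (re v)\<^sup>2) - 3 * re v) * im_i v)"

text \<open>Under W' = -(1 - t^2) g this is, on the sphere, W'(x0) times the volume form plus W(x0)
  dx1: a bump form with its equivariant extension. On the circle exp(i s) only W(cos s) cos s ds
  remains.\<close>

definition Bform :: "(real \<Rightarrow> real) \<Rightarrow> (real \<Rightarrow> real) \<Rightarrow> quat \<Rightarrow> quat ga \<Rightarrow> real ga" where
  "Bform g W v a = g (re v) *\<^sub>R (comp0 a * Sform v a) + W (re v) *\<^sub>R comp1 a"

section \<open>Relations between the coordinate differentials on the sphere\<close>

context
  fixes v :: quat and a :: "quat ga"
  assumes v: "v \<in> Sp1" and odd: "gam a = - a"
    and orth: "re v *\<^sub>R comp0 a + im_i v *\<^sub>R comp1 a + im_j v *\<^sub>R comp2 a + im_k v *\<^sub>R comp3 a = 0"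
begin

lemma comp_odd: "gam (comp0 a) = - comp0 a" "gam (comp1 a) = - comp1 a" "gam (comp2 a) = - comp2 a" "gam (comp3 a) = - comp3 a"
  by (simp_all add: comp_defs mapga_simps linear_quat odd flip: mapga_simps(7))

lemma comp_square: "comp0 a * comp0 a = 0" "comp1 a * comp1 a = 0" "comp2 a * comp2 a = 0" "comp3 a * comp3 a = 0"
  using comp_odd real_odd_square by blast+

lemma comp_anticommute: "comp1 a * comp0 a = - (comp0 a * comp1 a)" "comp2 a * comp0 a = - (comp0 a * comp2 a)"
  "comp3 a * comp0 a = - (comp0 a * comp3 a)" "comp2 a * comp1 a = - (comp1 a * comp2 a)"
  "comp3 a * comp1 a = - (comp1 a * comp3 a)" "comp3 a * comp2 a = - (comp2 a * comp3 a)"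
  using comp_odd real_odd_anticommute by blast+

lemma comp_left: "comp0 a * (comp0 a * z) = 0" "comp1 a * (comp1 a * z) = 0" "comp2 a * (comp2 a * z) = 0" "comp3 a * (comp3 a * z) = 0"
  "comp1 a * (comp0 a * z) = - (comp0 a * (comp1 a * z))" "comp2 a * (comp0 a * z) = - (comp0 a * (comp2 a * z))"
  "comp3 a * (comp0 a * z) = - (comp0 a * (comp3 a * z))" "comp2 a * (comp1 a * z) = - (comp1 a * (comp2 a * z))"
  "comp3 a * (comp1 a * z) = - (comp1 a * (comp3 a * z))" "comp3 a * (comp2 a * z) = - (comp2 a * (comp3 a * z))"
  by (simp_all add: comp_square comp_anticommute flip: mult.assoc)

lemmas comp_rules = comp_square comp_anticommute comp_left

lemma norm_sq: "re v * re v + im_i v * im_i v + im_j v * im_j v + im_k v * im_k v = 1"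
  using v by (simp add: Sp1_def power2_eq_square)

text \<open>After multiplication by \<open>re v\<close>, the relation \<open>orth\<close> eliminates
  \<open>comp0 a\<close>. Each term then becomes the square of a coordinate times the same
  three-form, and the squares add up to 1.\<close>

lemma vol_dp: "comp1 a * (comp2 a * comp3 a) = re v *\<^sub>R volform v a"
proof -
  define X where "X = im_i v *\<^sub>R comp1 a + im_j v *\<^sub>R comp2 a + im_k v *\<^sub>R comp3 a"
  have d0: "re v *\<^sub>R comp0 a = - X"
    unfolding X_def eq_neg_iff_add_eq_0 using orth by (simp only: add.assoc)
  have "re v *\<^sub>R volform v a = (re v * re v) *\<^sub>R (comp1 a * (comp2 a * comp3 a)) - (re v *\<^sub>R comp0 a) * Sform v a"
    by (simp add: volform_def algebra_simps)
  also have "\<dots> = (re v * re v + im_i v * im_i v + im_j v * im_j v + im_k v * im_k v) *\<^sub>R (comp1 a * (comp2 a * comp3 a))"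
    unfolding d0 X_def Sform_def by (rule ga_eqI) (simp add: algebra_simps comp_rules)
  finally show ?thesis by (simp add: norm_sq)
qed

lemma vol_dp0: "comp0 a * Sform v a = ((re v)\<^sup>2 - 1) *\<^sub>R volform v a"
proof -
  have "comp0 a * Sform v a = re v *\<^sub>R (comp1 a * (comp2 a * comp3 a)) - volform v a"
    by (simp add: volform_def mult.assoc)
  then show ?thesis
    unfolding vol_dp by (simp add: algebra_simps power2_eq_square)
qed

text \<open>A four-form on a three-dimensional sphere. Multiplying \<open>orth\<close> by three of
  the differentials shows that each coordinate times the form is 0, and the coordinates do not
  vanish together.\<close>

lemma vol_dp_all: "comp0 a * (comp1 a * (comp2 a * comp3 a)) = 0"
proof -
  have *: "r *\<^sub>R (comp0 a * (comp1 a * (comp2 a * comp3 a))) = 0"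
    if "r \<in> {re v, im_i v, im_j v, im_k v}" for r
  proof -
    have "0 = (re v *\<^sub>R comp0 a + im_i v *\<^sub>R comp1 a + im_j v *\<^sub>R comp2 a + im_k v *\<^sub>R comp3 a) * (comp1 a * (comp2 a * comp3 a))"
      "0 = (re v *\<^sub>R comp0 a + im_i v *\<^sub>R comp1 a + im_j v *\<^sub>R comp2 a + im_k v *\<^sub>R comp3 a) * (comp0 a * (comp2 a * comp3 a))"
      "0 = (re v *\<^sub>R comp0 a + im_i v *\<^sub>R comp1 a + im_j v *\<^sub>R comp2 a + im_k v *\<^sub>R comp3 a) * (comp0 a * (comp1 a * comp3 a))"
      "0 = (re v *\<^sub>R comp0 a + im_i v *\<^sub>R comp1 a + im_j v *\<^sub>R comp2 a + im_k v *\<^sub>R comp3 a) * (comp0 a * (comp1 a * comp2 a))"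
      using orth by simp_all
    then show ?thesis using that by (auto simp: algebra_simps comp_rules)
  qed
  show ?thesis
  proof (rule ccontr)
    assume "comp0 a * (comp1 a * (comp2 a * comp3 a)) \<noteq> 0"
    then have "re v = 0" "im_i v = 0" "im_j v = 0" "im_k v = 0" using * by auto
    then show False using norm_sq by simp
  qed
qed

text \<open>The real component of v^-1 dv is 0 by \<open>orth\<close>; the other three form an
  orthonormal coframe, whose product is the volume form.\<close>

lemma chi_explicit: "chi v a = (-6) *\<^sub>R volform v a - 3 *\<^sub>R (re v *\<^sub>R comp1 a - im_i v *\<^sub>R comp0 a)"
proof -
  define l1 l2 l3 where
    "l1 = re v *\<^sub>R comp1 a - im_i v *\<^sub>R comp0 a - im_j v *\<^sub>R comp3 a + im_k v *\<^sub>R comp2 a" and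
    "l2 = re v *\<^sub>R comp2 a - im_j v *\<^sub>R comp0 a - im_k v *\<^sub>R comp1 a + im_i v *\<^sub>R comp3 a" and
    "l3 = re v *\<^sub>R comp3 a - im_k v *\<^sub>R comp0 a - im_i v *\<^sub>R comp2 a + im_j v *\<^sub>R comp1 a"
  have l: "gam l1 = - l1" "gam l2 = - l2" "gam l3 = - l3"
    by (simp_all add: l1_def l2_def l3_def comp_odd algebra_simps)
  have L: "Lform v a = emb qI l1 + emb qJ l2 + emb qK l3"
  proof (rule ga_eqI)
    fix J
    have "coef (re v *\<^sub>R comp0 a + im_i v *\<^sub>R comp1 a + im_j v *\<^sub>R comp2 a + im_k v *\<^sub>R comp3 a) J = 0"
      using orth by simp
    then show "coef (Lform v a) J = coef (emb qI l1 + emb qJ l2 + emb qK l3) J"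
      by (auto simp: Lform_def l1_def l2_def l3_def coef_emb comp_defs coef_mapga linear_quat intro!: quat.expand)
  qed
  have "l1 * l2 * l3 = (re v * re v + im_i v * im_i v + im_j v * im_j v + im_k v * im_k v) *\<^sub>R volform v a"
    unfolding l1_def l2_def l3_def volform_def Sform_def
    by (rule ga_eqI) (simp add: algebra_simps comp_rules)
  then have vol: "l1 * l2 * l3 = volform v a" by (simp add: norm_sq)
  have "Re_ga (cst ehalf * (Lform v a + Rform v a)) = - (re v *\<^sub>R comp1 a - im_i v *\<^sub>R comp0 a)"
    by (rule ga_eqI)
      (simp add: coef_mapga linear_quat Lform_def Rform_def comp_defs ehalf_def algebra_simps)
  then show ?thesis
    by (simp add: chi_def mapga_simps(2,5) linear_quat L Re_cube[OF l] vol scaleR_diff_right)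
qed

end

lemma Bform_zero: "g (re v) = 0 \<Longrightarrow> W (re v) = 0 \<Longrightarrow> Bform g W v a = 0"
  by (simp add: Bform_def)

section \<open>Equivariant differentials of the forms on the sphere\<close>

context
  fixes n :: nat and V :: "pt \<Rightarrow> quat" and dV :: "pt \<Rightarrow> quat ga"
  assumes uf: "ufield n V dV"
begin

lemma ufield_comp:
  "hasD n (\<lambda>x. cst (re (V x))) (\<lambda>x. comp0 (dV x))" "hasD n (\<lambda>x. cst (im_i (V x))) (\<lambda>x. comp1 (dV x))"
  "hasD n (\<lambda>x. cst (im_j (V x))) (\<lambda>x. comp2 (dV x))" "hasD n (\<lambda>x. cst (im_k (V x))) (\<lambda>x. comp3 (dV x))"
proof -
  have V: "hasD n (\<lambda>x. cst (V x)) dV" using uf by (simp add: ufield_def)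
  show "hasD n (\<lambda>x. cst (re (V x))) (\<lambda>x. comp0 (dV x))" "hasD n (\<lambda>x. cst (im_i (V x))) (\<lambda>x. comp1 (dV x))"
    "hasD n (\<lambda>x. cst (im_j (V x))) (\<lambda>x. comp2 (dV x))" "hasD n (\<lambda>x. cst (im_k (V x))) (\<lambda>x. comp3 (dV x))"
    by (rule hasD_cong[OF hasD_map[OF V bounded_linear_quat(1)]] hasD_cong[OF hasD_map[OF V bounded_linear_quat(2)]]
        hasD_cong[OF hasD_map[OF V bounded_linear_quat(3)]] hasD_cong[OF hasD_map[OF V bounded_linear_quat(4)]];
        simp add: comp_defs mapga_simps linear_quat)+
qed

lemma ufield_dcomp:
  "hasD n (\<lambda>x. comp0 (dV x)) (\<lambda>x. 0)" "hasD n (\<lambda>x. comp1 (dV x)) (\<lambda>x. 0)"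
  "hasD n (\<lambda>x. comp2 (dV x)) (\<lambda>x. cst (im_k (V x)))" "hasD n (\<lambda>x. comp3 (dV x)) (\<lambda>x. cst (- im_j (V x)))"
proof -
  have V: "hasD n dV (\<lambda>x. cst (V x * ehalf - ehalf * V x))" using uf by (simp add: ufield_def)
  show "hasD n (\<lambda>x. comp0 (dV x)) (\<lambda>x. 0)" "hasD n (\<lambda>x. comp1 (dV x)) (\<lambda>x. 0)"
    "hasD n (\<lambda>x. comp2 (dV x)) (\<lambda>x. cst (im_k (V x)))" "hasD n (\<lambda>x. comp3 (dV x)) (\<lambda>x. cst (- im_j (V x)))"
    by (rule hasD_cong[OF hasD_map[OF V bounded_linear_quat(1)]] hasD_cong[OF hasD_map[OF V bounded_linear_quat(2)]]
        hasD_cong[OF hasD_map[OF V bounded_linear_quat(3)]] hasD_cong[OF hasD_map[OF V bounded_linear_quat(4)]];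
        simp add: comp_defs mapga_simps linear_quat ehalf_def)+
qed

lemma ufield_Sp1: "V x \<in> Sp1" and ufield_odd: "gam (dV x) = - dV x"
  using uf by (auto simp: ufield_def)

lemma ufield_orth:
  "re (V x) *\<^sub>R comp0 (dV x) + im_i (V x) *\<^sub>R comp1 (dV x) + im_j (V x) *\<^sub>R comp2 (dV x) + im_k (V x) *\<^sub>R comp3 (dV x) = 0"
proof -
  note c = ufield_comp
  have "hasD n (\<lambda>x. cst (re (V x)) * cst (re (V x)) + cst (im_i (V x)) * cst (im_i (V x)) +
      cst (im_j (V x)) * cst (im_j (V x)) + cst (im_k (V x)) * cst (im_k (V x)))
    (\<lambda>x. 2 *\<^sub>R (re (V x) *\<^sub>R comp0 (dV x) + im_i (V x) *\<^sub>R comp1 (dV x) + im_j (V x) *\<^sub>R comp2 (dV x) + im_k (V x) *\<^sub>R comp3 (dV x)))"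
    by (rule hasD_cong[OF hasD_add[OF hasD_add[OF hasD_add[OF hasD_mult[OF c(1) c(1)] hasD_mult[OF c(2) c(2)]]
        hasD_mult[OF c(3) c(3)]] hasD_mult[OF c(4) c(4)]]])
      (simp, rule ga_eqI, simp add: algebra_simps)
  moreover have "cst (re (V x)) * cst (re (V x)) + cst (im_i (V x)) * cst (im_i (V x)) +
      cst (im_j (V x)) * cst (im_j (V x)) + cst (im_k (V x)) * cst (im_k (V x)) = cst (1::real)" for x
    using ufield_Sp1[of x] unfolding cst_mult[symmetric] cst_add[symmetric]
    by (intro arg_cong[where f = cst]) (simp add: Sp1_def power2_eq_square)
  ultimately have "hasD n (\<lambda>x. cst (1::real)) (\<lambda>x. 2 *\<^sub>R (re (V x) *\<^sub>R comp0 (dV x) + im_i (V x) *\<^sub>R comp1 (dV x) + im_j (V x) *\<^sub>R comp2 (dV x) + im_k (V x) *\<^sub>R comp3 (dV x)))"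
    by simp
  from hasD_unique[OF this hasD_const, of x] show ?thesis by simp
qed

lemma hasD_Sform:
  "hasD n (\<lambda>x. Sform (V x) (dV x)) (\<lambda>x. 3 *\<^sub>R (comp1 (dV x) * (comp2 (dV x) * comp3 (dV x))) -
    (re (V x) * im_i (V x)) *\<^sub>R comp0 (dV x) - (1 - (re (V x))\<^sup>2) *\<^sub>R comp1 (dV x))"
proof -
  note c = ufield_comp and d = ufield_dcomp
  show ?thesis
  proof (rule hasD_cong[OF hasD_add[OF hasD_add[OF
          hasD_mult[OF c(2) hasD_mult[OF d(3) d(4)]] hasD_mult[OF c(3) hasD_mult[OF d(4) d(2)]]]
          hasD_mult[OF c(4) hasD_mult[OF d(2) d(3)]]]], goal_cases)
    case (1 x)
    then show ?case by (simp add: Sform_def cst_real)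
  next
    case (2 x)
    note f = ufield_Sp1[of x] ufield_odd[of x] ufield_orth[of x]
    note r = comp_rules[OF f] and o = comp_odd[OF f]
    have N: "1 - (re (V x))\<^sup>2 = im_i (V x) * im_i (V x) + im_j (V x) * im_j (V x) + im_k (V x) * im_k (V x)"
      using ufield_Sp1[of x] by (simp add: Sp1_def power2_eq_square)
    show ?case unfolding N
    proof (rule ga_eqI)
      fix J
      have "coef (im_i (V x) *\<^sub>R (re (V x) *\<^sub>R comp0 (dV x) + im_i (V x) *\<^sub>R comp1 (dV x) +
          im_j (V x) *\<^sub>R comp2 (dV x) + im_k (V x) *\<^sub>R comp3 (dV x))) J = 0"
        by (simp only: ufield_orth scaleR_zero_right coef_zero)
      then show "coef (comp1 (dV x) * (comp2 (dV x) * comp3 (dV x)) + gam (cst (im_i (V x))) *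
          (cst (im_k (V x)) * comp3 (dV x) + gam (comp2 (dV x)) * cst (- im_j (V x))) +
          (comp2 (dV x) * (comp3 (dV x) * comp1 (dV x)) + gam (cst (im_j (V x))) *
          (cst (- im_j (V x)) * comp1 (dV x) + gam (comp3 (dV x)) * 0)) +
          (comp3 (dV x) * (comp1 (dV x) * comp2 (dV x)) + gam (cst (im_k (V x))) *
          (0 * comp2 (dV x) + gam (comp1 (dV x)) * cst (im_k (V x))))) J =
        coef (3 *\<^sub>R (comp1 (dV x) * (comp2 (dV x) * comp3 (dV x))) - (re (V x) * im_i (V x)) *\<^sub>R comp0 (dV x) -
          (im_i (V x) * im_i (V x) + im_j (V x) * im_j (V x) + im_k (V x) * im_k (V x)) *\<^sub>R comp1 (dV x)) J"
        by (simp add: cst_real cst_uminus o r algebra_simps)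
    qed
  qed
qed

text \<open>With t the real part, comparison with \<open>chi\<close> gives one condition in degree
  three and, after the choice of \<open>m\<close>, the condition m' = t k + 3 in degree one. Both
  are the same differential equation for k. Where it fails nothing is claimed about
  \<open>G\<close>; there a bump factor will be 0.\<close>

lemma hasD_varpi:
  assumes k: "\<And>t. (k has_real_derivative k' t) (at t)" "continuous_on UNIV k'"
  shows "\<exists>G. hasD n (\<lambda>x. varpi k (V x) (dV x)) G \<and>
    (\<forall>x. k' (re (V x)) * (1 - (re (V x))\<^sup>2) = 6 + 3 * re (V x) * k (re (V x)) \<longrightarrow> G x = chi (V x) (dV x))"
proof -
  note c = ufield_comp and d = ufield_dcomp
  define m where "m t = k t * (1 - t\<^sup>2) - 3 * t" for t
  define m' where "m' t = k' t * (1 - t\<^sup>2) - 2 * t * k t - 3" for t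
  have "continuous_on UNIV k"
    by (meson DERIV_continuous continuous_at_imp_continuous_on k(1))
  then have m: "\<And>t. (m has_real_derivative m' t) (at t)" "continuous_on UNIV m'"
    unfolding m_def m'_def by (auto intro!: derivative_eq_intros k continuous_intros)
  let ?G = "\<lambda>x. k' (re (V x)) *\<^sub>R (comp0 (dV x) * Sform (V x) (dV x)) + k (re (V x)) *\<^sub>R
      (3 *\<^sub>R (comp1 (dV x) * (comp2 (dV x) * comp3 (dV x))) -
    (re (V x) * im_i (V x)) *\<^sub>R comp0 (dV x) - (1 - (re (V x))\<^sup>2) *\<^sub>R comp1 (dV x)) +
    (m' (re (V x)) * im_i (V x)) *\<^sub>R comp0 (dV x) + m (re (V x)) *\<^sub>R comp1 (dV x)"
  have "hasD n (\<lambda>x. varpi k (V x) (dV x)) ?G"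
    by (rule hasD_cong[OF hasD_add[OF hasD_mult[OF hasD_fun[OF c(1) k] hasD_Sform] hasD_mult[OF hasD_fun[OF c(1) m] c(2)]]])
      (simp_all add: varpi_def m_def cst_real mult.commute flip: cst_scaleR)
  moreover have "?G x = chi (V x) (dV x)"
    if eq: "k' (re (V x)) * (1 - (re (V x))\<^sup>2) = 6 + 3 * re (V x) * k (re (V x))" for x
  proof -
    note f = ufield_Sp1[of x] ufield_odd[of x] ufield_orth[of x]
    define t p d0 d1 Z where "t = re (V x)" and "p = im_i (V x)" and "d0 = comp0 (dV x)" and "d1 = comp1 (dV x)" and "Z = volform (V x) (dV x)"
    have m't: "m' t = k t * t + 3"
      using eq by (simp add: m'_def t_def)
    have e: "d1 * (comp2 (dV x) * comp3 (dV x)) = t *\<^sub>R Z" "d0 * Sform (V x) (dV x) = (t\<^sup>2 - 1) *\<^sub>R Z"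
      by (simp_all add: t_def d0_def d1_def Z_def vol_dp[OF f] vol_dp0[OF f])
    have "?G x = k' t *\<^sub>R ((t\<^sup>2 - 1) *\<^sub>R Z) + k t *\<^sub>R (3 *\<^sub>R (t *\<^sub>R Z) - (t * p) *\<^sub>R d0 - (1 - t\<^sup>2) *\<^sub>R d1) +
        ((k t * t + 3) * p) *\<^sub>R d0 + (k t * (1 - t\<^sup>2) - 3 * t) *\<^sub>R d1"
      unfolding t_def[symmetric] p_def[symmetric] d0_def[symmetric] d1_def[symmetric] m't e
      by (simp add: m_def)
    also have "\<dots> = (- (k' t * (1 - t\<^sup>2)) + 3 * t * k t) *\<^sub>R Z + (3 * p) *\<^sub>R d0 - (3 * t) *\<^sub>R d1"
      by (rule ga_eqI) (simp add: algebra_simps)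
    also have "\<dots> = chi (V x) (dV x)"
      unfolding chi_explicit[OF f] t_def[symmetric] p_def[symmetric] d0_def[symmetric] d1_def[symmetric] Z_def[symmetric]
        eq[folded t_def]
      by (rule ga_eqI) (simp add: algebra_simps)
    finally show ?thesis .
  qed
  ultimately show ?thesis by blast
qed

text \<open>The part of degree four is 0 on the sphere. In degree two the contraction of the first
  summand leaves (1 - t^2) g times dx0 dx1, which the derivative of W cancels.\<close>

lemma hasD_Bform:
  assumes g: "\<And>t. (g has_real_derivative g' t) (at t)" "continuous_on UNIV g'"
    and W: "\<And>t. (W has_real_derivative - (1 - t\<^sup>2) * g t) (at t)"
  shows "hasD n (\<lambda>x. Bform g W (V x) (dV x)) (\<lambda>x. 0)"
proof -
  note c = ufield_comp and d = ufield_dcomp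
  have "continuous_on UNIV g"
    by (meson DERIV_continuous continuous_at_imp_continuous_on g(1))
  then have cW: "continuous_on UNIV (\<lambda>t. - (1 - t\<^sup>2) * g t)"
    by (auto intro!: continuous_intros)
  show ?thesis
  proof (rule hasD_cong[OF hasD_add[OF hasD_mult[OF hasD_fun[OF c(1) g] hasD_mult[OF d(1) hasD_Sform]]
          hasD_mult[OF hasD_fun[OF c(1) W cW] d(2)]]], goal_cases)
    case (1 x)
    then show ?case by (simp add: Bform_def cst_real)
  next
    case (2 x)
    note f = ufield_Sp1[of x] ufield_odd[of x] ufield_orth[of x]
    show ?case
      by (simp add: cst_real comp_rules[OF f] comp_odd[OF f] vol_dp_all[OF f] algebra_simps)
  qed
qed

end

section \<open>Iterated integrals and the localization argument\<close>

text \<open>The generator number \<open>i\<close> will be \<open>cos \<tau> exp (\<theta> i) + sin \<tau> exp (\<psi> i) j\<close>, where the coordinates \<open>\<theta>\<close>, \<open>\<tau>\<close>, \<open>\<psi>\<close> have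
  the numbers \<open>i\<close>, \<open>n + i\<close> and \<open>2 n + i\<close>, and \<open>\<tau>\<close> runs through \<open>[0, \<pi>/2]\<close>.\<close>
definition hi :: "nat \<Rightarrow> nat \<Rightarrow> real" where
  "hi n c = (if n \<le> c \<and> c < 2 * n then pi / 2 else 2 * pi)"

lemma hi_pos: "0 < hi n c"
  by (simp add: hi_def)

text \<open>Coordinates outside the list keep their values from \<open>x\<close>. The base point
  used later is 0, at which every generator is the quaternion 1.\<close>

primrec iint :: "nat \<Rightarrow> nat list \<Rightarrow> (pt \<Rightarrow> real) \<Rightarrow> pt \<Rightarrow> real" where
  "iint n [] f x = f x"
| "iint n (c # cs) f x = integral {0..hi n c} (\<lambda>s. iint n cs f (x(c := s)))"

lemma continuous_on_upd:
  assumes "continuous_on A f" "continuous_on A g"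
  shows "continuous_on A (\<lambda>z. (f z)(c := g z) :: pt)"
proof (rule continuous_on_coordinatewise_then_product)
  fix i
  show "continuous_on A (\<lambda>z. ((f z)(c := g z)) i)"
    using assms(2) continuous_on_product_then_coordinatewise[OF assms(1), of i] by (cases "i = c") auto
qed

lemma continuous_on_slice:
  fixes f :: "pt \<Rightarrow> real"
  assumes "continuous_on UNIV f"
  shows "continuous_on A (\<lambda>s. f (x(c := s)))"
  by (rule continuous_on_compose2[OF assms continuous_on_upd]) auto

lemma continuous_on_integral_slice:
  fixes f :: "pt \<Rightarrow> real"
  assumes "continuous_on UNIV f"
  shows "continuous_on UNIV (\<lambda>x. integral {a..b} (\<lambda>s. f (x(c := s))))"
proof -
  have "continuous_on (UNIV \<times> cbox a b) (\<lambda>(x, s). f (x(c := s)))"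
    unfolding split_beta
    by (rule continuous_on_compose2[OF assms continuous_on_upd[OF continuous_on_fst[OF continuous_on_id]
            continuous_on_snd[OF continuous_on_id]]]) auto
  from integral_continuous_on_param[OF this] show ?thesis by simp
qed

lemma continuous_iint: "continuous_on UNIV f \<Longrightarrow> continuous_on UNIV (iint n cs f)"
  by (induction cs) (auto intro: continuous_on_integral_slice)

lemma iint_append: "iint n (as @ bs) f x = iint n as (iint n bs f) x"
  by (induction as arbitrary: x) simp_all

lemma iint_cong:
  assumes "\<And>y. (\<And>c. c \<notin> set cs \<Longrightarrow> y c = x c) \<Longrightarrow> f y = g y"
  shows "iint n cs f x = iint n cs g x"
  using assms
proof (induction cs arbitrary: x)
  case (Cons c cs)
  have "iint n cs f (x(c := s)) = iint n cs g (x(c := s))" for s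
    by (rule Cons.IH, rule Cons.prems) auto
  then show ?case by simp
qed (simp add: eq_commute)

lemma iint_zero: "iint n cs (\<lambda>y. 0) x = 0"
  by (induction cs arbitrary: x) simp_all

lemma iint_scale: "iint n cs (\<lambda>y. r * f y) x = r * iint n cs f x"
  by (induction cs arbitrary: x) simp_all

lemma iint_add:
  assumes "continuous_on UNIV f" "continuous_on UNIV g"
  shows "iint n cs (\<lambda>y. f y + g y) x = iint n cs f x + iint n cs g x"
proof (induction cs arbitrary: x)
  case (Cons c cs)
  have "(\<lambda>s. iint n cs h (x(c := s))) integrable_on {0..hi n c}" if "continuous_on UNIV h" for h
    by (intro integrable_continuous_interval continuous_on_slice continuous_iint that)
  from integral_add[OF this[OF assms(1)] this[OF assms(2)]] show ?case
    by (simp add: Cons del: fun_upd_apply)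
qed simp

lemma iint_sum:
  assumes "finite A" "\<And>a. a \<in> A \<Longrightarrow> continuous_on UNIV (f a)"
  shows "iint n cs (\<lambda>y. \<Sum>a\<in>A. f a y) x = (\<Sum>a\<in>A. iint n cs (f a) x)"
  using assms by (induction A) (simp_all add: iint_zero iint_add continuous_on_sum)

lemma iint_swap:
  assumes "continuous_on UNIV f" "c \<notin> set cs"
  shows "integral {0..b} (\<lambda>s. iint n cs f (x(c := s))) = iint n cs (\<lambda>y. integral {0..b} (\<lambda>s. f (y(c := s)))) x"
  using assms(2)
proof (induction cs arbitrary: x)
  case (Cons d cs)
  have "continuous_on (cbox (0, 0) (b, hi n d)) (\<lambda>(s, t). iint n cs f (x(c := s, d := t)))"
    unfolding split_beta
    by (rule continuous_on_compose2[OF continuous_iint[OF assms(1)]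
          continuous_on_upd[OF continuous_on_upd[OF continuous_on_const continuous_on_fst[OF continuous_on_id]]
            continuous_on_snd[OF continuous_on_id]]]) auto
  from integral_swap_continuous[OF this]
  have "integral {0..b} (\<lambda>s. iint n (d # cs) f (x(c := s))) =
      integral {0..hi n d} (\<lambda>t. integral {0..b} (\<lambda>s. iint n cs f (x(c := s, d := t))))"
    by simp
  also have "\<dots> = integral {0..hi n d} (\<lambda>t. integral {0..b} (\<lambda>s. iint n cs f (x(d := t, c := s))))"
    using Cons.prems by (simp add: fun_upd_twist)
  also have "\<dots> = integral {0..hi n d} (\<lambda>t. iint n cs (\<lambda>y. integral {0..b} (\<lambda>s. f (y(c := s)))) (x(d := t)))"
    by (rule integral_cong, rule Cons.IH) (use Cons.prems in simp)
  finally show ?case by (simp only: iint.simps)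
qed simp

text \<open>Fubini moves the integration over \<open>c\<close> inside all the later ones, where the
  fundamental theorem of calculus applies.\<close>

lemma iint_deriv:
  assumes cs: "distinct cs" "c \<in> set cs"
    and h: "\<And>x. ((\<lambda>s. h (x(c := s))) has_vector_derivative h' x) (at (x c))"
    and cont: "continuous_on UNIV h'"
  shows "iint n cs h' x = iint n (remove1 c cs) (\<lambda>y. h (y(c := hi n c)) - h (y(c := 0))) x"
proof -
  obtain as bs where cs': "cs = as @ c # bs" "c \<notin> set as" "c \<notin> set bs"
    using cs by (metis distinct.simps(2) distinct_append split_list_first)
  have "integral {0..hi n c} (\<lambda>s. h' (y(c := s))) = h (y(c := hi n c)) - h (y(c := 0))" for y
  proof (rule integral_unique, rule fundamental_theorem_of_calculus)
    show "0 \<le> hi n c" using hi_pos[of n c] by simp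
    show "((\<lambda>s. h (y(c := s))) has_vector_derivative h' (y(c := t))) (at t within {0..hi n c})" for t
      using has_vector_derivative_at_within[OF h[of "y(c := t)"]] by simp
  qed
  then have "iint n (c # bs) h' = iint n bs (\<lambda>y. h (y(c := hi n c)) - h (y(c := 0)))"
    using iint_swap[OF cont cs'(3), where b = "hi n c"] by (intro ext) simp
  then show ?thesis
    using cs' by (simp add: iint_append remove1_append del: iint.simps)
qed

lemma iint_nonneg:
  assumes "continuous_on UNIV f" "\<And>y. 0 \<le> f y"
  shows "0 \<le> iint n cs f x"
  by (induction cs arbitrary: x)
    (auto simp: assms intro!: integral_nonneg integrable_continuous_interval continuous_on_slice continuous_iint)

lemma iint_eq_0:
  assumes f: "continuous_on UNIV f" "\<And>y. 0 \<le> f y"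
    and "iint n cs f x = 0" "\<And>c. c \<notin> set cs \<Longrightarrow> y c = x c" "\<And>c. c \<in> set cs \<Longrightarrow> y c \<in> {0..hi n c}"
  shows "f y = 0"
  using assms(3-)
proof (induction cs arbitrary: x)
  case Nil
  then have "y = x" by auto
  with Nil show ?case by simp
next
  case (Cons c cs)
  have "\<forall>s\<in>{0..hi n c}. iint n cs f (x(c := s)) = 0"
    using Cons.prems(1) f hi_pos[of n c]
    by (subst (asm) iint.simps, subst (asm) integral_eq_0_iff)
      (auto intro!: continuous_on_slice continuous_iint iint_nonneg)
  then have "iint n cs f (x(c := y c)) = 0"
    using Cons.prems(3) by simp
  then show ?case
    by (rule Cons.IH) (use Cons.prems in auto)
qed

text \<open>The conditions \<open>per\<close>, \<open>deg0\<close> and \<open>deg1\<close> are what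
  remains of being pulled back from a product of three-spheres: the angles are periodic, the circle
  of \<psi> collapses at \<tau> = 0 and that of \<theta> at \<tau> = \<pi>/2. The condition
  \<open>top\<close> starts a descent that takes generators out of \<open>S\<close> one by
  one.\<close>

lemma localization:
  fixes \<Omega> :: "pt \<Rightarrow> real ga"
  assumes I: "I \<subseteq> {..<n}"
    and closed: "hasD n \<Omega> (\<lambda>x. 0)"
    and per: "\<And>y c. c < n \<or> 2 * n \<le> c \<and> c < 3 * n \<Longrightarrow> \<Omega> (y(c := 2 * pi)) = \<Omega> (y(c := 0))"
    and deg0: "\<And>y i J. i < n \<Longrightarrow> y (n + i) = 0 \<Longrightarrow> 2 * n + i \<in> J \<Longrightarrow> coef (\<Omega> y) J = 0"
    and deg1: "\<And>y i J. i < n \<Longrightarrow> y (n + i) = pi / 2 \<Longrightarrow> i \<in> J \<Longrightarrow> coef (\<Omega> y) J = 0"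
    and top: "\<And>y. coef (\<Omega> y) (I \<union> (+) n ` I \<union> (+) (2 * n) ` I) = 0"
  shows "iint n (sorted_list_of_set (I \<union> (+) (2 * n) ` I)) (\<lambda>y. coef (\<Omega> y) I) (\<lambda>_. 0) = 0"
proof -
  have finI: "finite I" using I finite_subset by blast
  define X where "X S = I \<union> (+) (2 * n) ` I \<union> (+) n ` S" for S
  define idx where "idx S = I \<union> (+) n ` S \<union> (+) (2 * n) ` S" for S
  \<comment> \<open>In \<open>A S\<close> the generators outside \<open>S\<close> lie in the torus. Stokes' theorem in the coordinate \<open>\<tau>\<close> of \<open>j \<in> S\<close> leaves
    only the face \<open>\<tau> = 0\<close>, which gives \<open>A (S - {j})\<close>; the contraction with \<open>\<xi>\<close> gives \<open>A S\<close>.\<close>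
  define A where "A S = iint n (sorted_list_of_set (X S)) (\<lambda>y. coef (\<Omega> y) (idx S)) (\<lambda>_. 0)" for S
  obtain F' where F': "C1 \<Omega> F'" "\<And>y. 0 = (\<Sum>c<3*n. evec c * F' c y) - iota n (\<Omega> y)"
    using closed by (auto simp: hasD_def)
  have cont: "\<And>J. continuous_on UNIV (\<lambda>x. coef (\<Omega> x) J)" "\<And>c J. continuous_on UNIV (\<lambda>x. coef (F' c x) J)"
    and der: "\<And>c J x. ((\<lambda>s. coef (\<Omega> (x(c := s))) J) has_vector_derivative coef (F' c x) J) (at (x c))"
    using F'(1) by (auto simp: C1_def)
  have step: "A (S - {j}) = 0" if S: "S \<subseteq> I" "j \<in> S" and AS: "A S = 0" for S j
  proof -
    define S' where "S' = S - {j}"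
    \<comment> \<open>\<open>idx S\<close> without the index of d\<psi> for \<open>j\<close>. The
      component of the closedness equation at \<open>K\<close> contains derivatives of coefficients
      with one index fewer and, from the contraction, coefficients with one \<psi>-index more;
      adding the index of \<open>j\<close> returns \<open>idx S\<close>.\<close>
    define K where "K = I \<union> (+) n ` S \<union> (+) (2 * n) ` S'"
    have finS: "finite S" "finite S'" using S finI finite_subset by (auto simp: S'_def)
    have finX: "finite (X S)" by (simp add: X_def finI finS)
    have finK: "finite K" by (simp add: K_def finI finS)
    have lt: "i < n" if "i \<in> S \<or> i \<in> S' \<or> i \<in> I" for i using that S I by (auto simp: S'_def)
    have K3: "K \<subseteq> {..<3 * n}" and KX: "K \<subseteq> X S"
      using lt S by (force simp: K_def X_def S'_def)+
    define L where "L = sorted_list_of_set (X S)"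
    have L: "distinct L" "set L = X S" using finX by (auto simp: L_def)
    have "(\<Sum>c\<in>K. sg {c} (K - {c}) * coef (F' c y) (K - {c})) =
        (\<Sum>c\<in>{2*n..<3*n} - K. sg {c} K * coef (\<Omega> y) (insert c K))" for y
    proof -
      have "coef (\<Sum>c<3*n. evec c * F' c y) K = coef (iota n (\<Omega> y)) K"
        using F'(2)[of y] by simp
      moreover have "coef (\<Sum>c<3*n. evec c * F' c y) K = (\<Sum>c\<in>K. sg {c} (K - {c}) * coef (F' c y) (K - {c}))"
        using K3 by (simp add: coef_evec_mult) (rule sum.mono_neutral_cong_right; auto)
      moreover have "coef (iota n (\<Omega> y)) K = (\<Sum>c\<in>{2*n..<3*n} - K. sg {c} K * coef (\<Omega> y) (insert c K))"
        by (simp add: iota_def coef_iota1) (rule sum.mono_neutral_cong_right; auto)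
      ultimately show ?thesis by simp
    qed
    then have "iint n L (\<lambda>y. \<Sum>c\<in>K. sg {c} (K - {c}) * coef (F' c y) (K - {c})) (\<lambda>_. 0) =
        iint n L (\<lambda>y. \<Sum>c\<in>{2*n..<3*n} - K. sg {c} K * coef (\<Omega> y) (insert c K)) (\<lambda>_. 0)"
      by simp
    then have main: "(\<Sum>c\<in>K. sg {c} (K - {c}) * iint n L (\<lambda>y. coef (F' c y) (K - {c})) (\<lambda>_. 0)) =
        (\<Sum>c\<in>{2*n..<3*n} - K. sg {c} K * iint n L (\<lambda>y. coef (\<Omega> y) (insert c K)) (\<lambda>_. 0))"
      by (subst (asm) iint_sum, simp add: finK, force intro!: continuous_intros cont,
          subst (asm) iint_sum, simp, force intro!: continuous_intros cont, simp add: iint_scale)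
    have right: "iint n L (\<lambda>y. coef (\<Omega> y) (insert c K)) (\<lambda>_. 0) = 0" if c: "c \<in> {2*n..<3*n} - K" for c
    proof -
      define l where "l = c - 2 * n"
      have l: "c = 2 * n + l" "l < n" using c by (auto simp: l_def)
      then have l': "l \<notin> S'" using c by (auto simp: K_def)
      show ?thesis
      proof (cases "l = j")
        case True
        then have "insert c K = idx S" using l l' S by (auto simp: K_def idx_def S'_def)
        then show ?thesis using AS by (simp add: A_def L_def)
      next
        case False
        \<comment> \<open>Here \<open>l\<close> lies outside \<open>S\<close>, so its \<tau> is not
          integrated and stays 0, where no coefficient involves d\<psi> for
          \<open>l\<close>.\<close>
        then have "n + l \<notin> X S" using l l' lt by (auto simp: X_def S'_def)
        then have "iint n L (\<lambda>y. coef (\<Omega> y) (insert c K)) (\<lambda>_. 0) = iint n L (\<lambda>y. 0) (\<lambda>_. 0)"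
          by (intro iint_cong deg0[of l]) (use l L in auto)
        then show ?thesis by (simp add: iint_zero)
      qed
    qed
    have deriv: "iint n L (\<lambda>y. coef (F' c y) (K - {c})) (\<lambda>_. 0) = iint n (remove1 c L)
        (\<lambda>y. coef (\<Omega> (y(c := hi n c))) (K - {c}) - coef (\<Omega> (y(c := 0))) (K - {c})) (\<lambda>_. 0)" if "c \<in> K" for c
      by (rule iint_deriv[OF L(1) _ der cont(2)]) (use that KX L in auto)
    \<comment> \<open>Angles drop out by periodicity. For \<tau> of a generator \<open>l\<close>
      other than \<open>j\<close> both faces vanish, since \<open>K - {c}\<close> still contains
      both angular indices of \<open>l\<close>.\<close>
    have left: "iint n L (\<lambda>y. coef (F' c y) (K - {c})) (\<lambda>_. 0) = 0" if c: "c \<in> K" "c \<noteq> n + j" for c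
    proof -
      have "coef (\<Omega> (y(c := hi n c))) (K - {c}) - coef (\<Omega> (y(c := 0))) (K - {c}) = 0" for y
      proof (cases "c < n \<or> 2 * n \<le> c")
        case True
        then show ?thesis using per[of c y] c K3 by (auto simp: hi_def)
      next
        case False
        then obtain l where l: "c = n + l" "l \<in> S'" "l < n"
          using c lt by (auto simp: K_def S'_def)
        then have "hi n c = pi / 2" "l \<in> K - {c}" "2 * n + l \<in> K - {c}"
          using S by (auto simp: hi_def K_def S'_def)
        then show ?thesis using l deg1[of l "y(c := hi n c)"] deg0[of l "y(c := 0)"] by simp
      qed
      then show ?thesis using deriv[OF c(1)] by (simp add: iint_zero)
    qed
    have jK: "n + j \<in> K" using S by (auto simp: K_def)
    have j: "j < n" using S lt by blast
    have notin: "n + j \<notin> I" "n + j \<notin> (+) (2 * n) ` T" for T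
      using lt[of "n + j"] j by auto
    have img: "(+) n ` S - {n + j} = (+) n ` S'" by (auto simp: S'_def)
    have Kj: "K - {n + j} = idx S'"
      using notin(1) notin(2)[of S'] img unfolding K_def idx_def by blast
    have Xj: "X S - {n + j} = X S'"
      using notin(1) notin(2)[of I] img unfolding X_def by blast
    have rem: "remove1 (n + j) L = sorted_list_of_set (X S')"
      using sorted_list_of_set_remove[OF finX, of "n + j"] by (simp add: L_def Xj)
    \<comment> \<open>The index of \<psi> for \<open>j\<close> is missing from
      \<open>idx S'\<close>, so \<open>deg0\<close> does not apply. The face \<tau> = \<pi>/2
      vanishes and the face \<tau> = 0, a lower limit, survives with sign -1.\<close>
    have "iint n L (\<lambda>y. coef (F' (n + j) y) (idx S')) (\<lambda>_. 0) =
        iint n (sorted_list_of_set (X S')) (\<lambda>y. (-1) * coef (\<Omega> y) (idx S')) (\<lambda>_. 0)"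
      unfolding deriv[OF jK, unfolded Kj rem]
    proof (rule iint_cong)
      fix y :: pt assume y: "\<And>c. c \<notin> set (sorted_list_of_set (X S')) \<Longrightarrow> y c = 0"
      have "finite (X S')" using finite_Diff[OF finX, of "{n + j}"] unfolding Xj .
      moreover have "n + j \<notin> X S'" unfolding Xj[symmetric] by blast
      ultimately have "y (n + j) = 0" by (intro y) simp
      then have "y(n + j := 0) = y" by auto
      moreover have "hi n (n + j) = pi / 2" "j \<in> idx S'"
        using j S by (auto simp: hi_def idx_def)
      ultimately show "coef (\<Omega> (y(n + j := hi n (n + j)))) (idx S') - coef (\<Omega> (y(n + j := 0))) (idx S') =
          (-1) * coef (\<Omega> y) (idx S')"
        using deg1[OF j, of "y(n + j := hi n (n + j))"] by simp
    qed
    then have Aj: "iint n L (\<lambda>y. coef (F' (n + j) y) (K - {n + j})) (\<lambda>_. 0) = - A S'"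
      unfolding Kj iint_scale A_def by simp
    have "(\<Sum>c\<in>K. sg {c} (K - {c}) * iint n L (\<lambda>y. coef (F' c y) (K - {c})) (\<lambda>_. 0)) =
        (\<Sum>c\<in>{n + j}. sg {c} (K - {c}) * iint n L (\<lambda>y. coef (F' c y) (K - {c})) (\<lambda>_. 0))"
      by (rule sum.mono_neutral_right) (use jK finK left in auto)
    then have "sg {n + j} (K - {n + j}) * A S' = 0"
      using main Aj by (simp add: right)
    then show ?thesis by (simp add: S'_def)
  qed
  have "A (I - T) = 0" if "T \<subseteq> I" for T
    using finite_subset[OF that finI] that
  proof (induction T)
    case empty
    then show ?case using top by (simp add: A_def idx_def iint_zero)
  next
    case (insert j T)
    then have "A (I - T - {j}) = 0" by (intro step) auto
    then show ?case by (metis Diff_insert)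
  qed
  from this[of I] show ?thesis by (simp add: A_def X_def idx_def)
qed

section \<open>One-variable functions\<close>

text \<open>A truncated power that is just smooth enough: one continuous derivative suffices
  throughout.\<close>

definition pl :: "real \<Rightarrow> real" where "pl t = (max 0 t)\<^sup>2"

lemma has_derivative_pl: "(pl has_real_derivative 2 * max 0 t) (at t)"
proof -
  consider "t > 0" | "t < 0" | "t = 0" by linarith
  then show ?thesis
  proof cases
    case 1
    have "((\<lambda>t. t\<^sup>2) has_real_derivative 2 * max 0 t) (at t)"
      using 1 by (auto intro!: derivative_eq_intros)
    then show ?thesis
      by (rule has_field_derivative_transform_within_open[where S = "{0<..}"]) (use 1 in \<open>auto simp: pl_def\<close>)
  next
    case 2
    have "((\<lambda>t. 0) has_real_derivative 2 * max 0 t) (at t)"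
      using 2 by auto
    then show ?thesis
      by (rule has_field_derivative_transform_within_open[where S = "{..<0}"]) (use 2 in \<open>auto simp: pl_def\<close>)
  next
    case 3
    have "((\<lambda>h. max 0 h) \<longlongrightarrow> max 0 (0::real)) (at 0)"
      by (intro tendsto_intros)
    then have "((\<lambda>h. (pl (0 + h) - pl 0) / h) \<longlongrightarrow> 0) (at 0)"
      by (rule Lim_transform_eventually[OF tendsto_eq_rhs])
        (auto simp: eventually_at_filter pl_def max_def power2_eq_square)
    then show ?thesis using 3 by (simp add: DERIV_def)
  qed
qed

lemma bump_exists:
  fixes \<epsilon> \<delta> :: real
  assumes eps: "\<epsilon> = 1 \<or> \<epsilon> = -1" and d: "0 < \<delta>" "\<delta> \<le> 1"
  obtains g g' W :: "real \<Rightarrow> real" where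
    "\<And>t. (g has_real_derivative g' t) (at t)" "continuous_on UNIV g'"
    "\<And>t. (W has_real_derivative - (1 - t\<^sup>2) * g t) (at t)"
    "\<And>t. \<epsilon> * t \<le> 1 - \<delta> \<Longrightarrow> g t = 0 \<and> W t = 0"
    "\<And>t. \<bar>t\<bar> \<le> 1 \<Longrightarrow> 0 \<le> \<epsilon> * (W t * t)" "0 < W \<epsilon>"
proof
  define c where "c = 1 - \<delta>"
  \<comment> \<open>With y = \<epsilon> t - c the condition on W reads dW/dy = (1 - (y + c)^2) y^2
    for y > 0. \<open>h\<close> is the antiderivative vanishing at 0, divided by y^2.\<close>
  define h where "h y = (1 - c\<^sup>2) * y / 3 - c * y\<^sup>2 / 2 - y ^ 3 / 5" for y
  define g where "g t = - \<epsilon> * pl (\<epsilon> * t - c)" for t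
  define W where "W t = pl (\<epsilon> * t - c) * h (\<epsilon> * t - c)" for t
  have c: "0 \<le> c" "c < 1" using d by (auto simp: c_def)
  have e2: "\<epsilon> * \<epsilon> = 1" "\<epsilon>\<^sup>2 = 1" using eps by auto
  show "(g has_real_derivative - 2 * max 0 (\<epsilon> * t - c)) (at t)" for t
    unfolding g_def
    by (rule derivative_eq_intros DERIV_chain2[OF has_derivative_pl] refl)+ (simp add: e2 algebra_simps)
  show "continuous_on UNIV (\<lambda>t. - 2 * max 0 (\<epsilon> * t - c))"
    by (intro continuous_intros)
  show "(W has_real_derivative - (1 - t\<^sup>2) * g t) (at t)" for t
  proof -
    define y where "y = \<epsilon> * t - c"
    have "(h has_real_derivative (1 - c\<^sup>2) / 3 - c * y - 3 * y\<^sup>2 / 5) (at y)"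
      unfolding h_def by (auto intro!: derivative_eq_intros simp: power2_eq_square)
    from DERIV_mult[OF has_derivative_pl this]
    have "((\<lambda>y. pl y * h y) has_real_derivative 2 * max 0 y * h y + ((1 - c\<^sup>2) / 3 - c * y - 3 * y\<^sup>2 / 5) * pl y) (at (\<epsilon> * t - c))"
      by (simp add: y_def)
    moreover have "((\<lambda>t. \<epsilon> * t - c) has_real_derivative \<epsilon>) (at t)"
      by (auto intro!: derivative_eq_intros)
    ultimately have "(W has_real_derivative (2 * max 0 y * h y + ((1 - c\<^sup>2) / 3 - c * y - 3 * y\<^sup>2 / 5) * pl y) * \<epsilon>) (at t)"
      unfolding W_def by (rule DERIV_chain2)
    moreover have "2 * max 0 y * h y = pl y * (2 * ((1 - c\<^sup>2) / 3 - c * y / 2 - y\<^sup>2 / 5))"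
      by (cases "y \<ge> 0") (simp_all add: h_def pl_def power2_eq_square power3_eq_cube field_simps)
    moreover have "2 * ((1 - c\<^sup>2) / 3 - c * y / 2 - y\<^sup>2 / 5) + ((1 - c\<^sup>2) / 3 - c * y - 3 * y\<^sup>2 / 5) = 1 - (y + c)\<^sup>2"
      by (simp add: field_simps power2_eq_square)
    then have "(pl y * (2 * ((1 - c\<^sup>2) / 3 - c * y / 2 - y\<^sup>2 / 5)) + ((1 - c\<^sup>2) / 3 - c * y - 3 * y\<^sup>2 / 5) * pl y) * \<epsilon> =
        (1 - (y + c)\<^sup>2) * pl y * \<epsilon>"
      by (metis distrib_left mult.commute)
    ultimately have "(W has_real_derivative (1 - (y + c)\<^sup>2) * pl y * \<epsilon>) (at t)"
      by (simp only:)
    moreover have "t\<^sup>2 = (y + c)\<^sup>2" by (simp add: y_def power_mult_distrib e2)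
    then have "- (1 - t\<^sup>2) * g t = (1 - (y + c)\<^sup>2) * pl y * \<epsilon>"
      by (simp add: g_def flip: y_def) (simp add: algebra_simps)
    ultimately show ?thesis
      by (simp only:)
  qed
  show "g t = 0 \<and> W t = 0" if "\<epsilon> * t \<le> 1 - \<delta>" for t
    using that by (simp add: g_def W_def pl_def c_def)
  \<comment> \<open>After division by y the two subtracted terms grow with y, so y = 1 - c is the
    worst case; there the value is (1 - c)(4 + c)/30.\<close>
  have hpos: "0 < h y" if "0 < y" "y \<le> 1 - c" for y
  proof -
    have "c * y \<le> c * (1 - c)" "y\<^sup>2 \<le> (1 - c)\<^sup>2"
      using that c by (auto intro: mult_left_mono power_mono)
    moreover have "(1 - c\<^sup>2) / 3 - c * (1 - c) / 2 - (1 - c)\<^sup>2 / 5 = (1 - c) * (4 + c) / 30"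
      by (simp add: field_simps power2_eq_square)
    moreover have "0 < (1 - c) * (4 + c) / 30" using c by simp
    ultimately have "0 < (1 - c\<^sup>2) / 3 - c * y / 2 - y\<^sup>2 / 5" by linarith
    then have "0 < y * ((1 - c\<^sup>2) / 3 - c * y / 2 - y\<^sup>2 / 5)" using that by simp
    then show ?thesis by (simp add: h_def algebra_simps power2_eq_square power3_eq_cube)
  qed
  show "0 \<le> \<epsilon> * (W t * t)" if "\<bar>t\<bar> \<le> 1" for t
  proof (cases "\<epsilon> * t \<le> c")
    case True
    then show ?thesis by (simp add: W_def pl_def)
  next
    case False
    have "\<epsilon> * t \<le> 1" using that eps by auto
    then have "0 < h (\<epsilon> * t - c)" using False by (intro hpos) auto
    then have "0 \<le> pl (\<epsilon> * t - c) * h (\<epsilon> * t - c)" by (simp add: pl_def)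
    moreover have "0 \<le> \<epsilon> * t" using False c by linarith
    ultimately have "0 \<le> pl (\<epsilon> * t - c) * h (\<epsilon> * t - c) * (\<epsilon> * t)"
      by (rule mult_nonneg_nonneg)
    then show ?thesis by (simp add: W_def mult_ac)
  qed
  show "0 < W \<epsilon>"
    using hpos[of "1 - c"] c by (simp add: W_def e2 pl_def)
qed

text \<open>The ordinary differential equation is the one for which \<open>varpi k\<close> is a primitive of \<open>chi\<close>; it is singular
  at \<open>1\<close>, where the solution given by the integral below is regular.\<close>
lemma profile_exists:
  fixes a :: real
  assumes a: "-1 < a"
  obtains k k' :: "real \<Rightarrow> real" where
    "\<And>t. (k has_real_derivative k' t) (at t)" "continuous_on UNIV k'"
    "\<And>t. a \<le> t \<Longrightarrow> k' t * (1 - t\<^sup>2) = 6 + 3 * t * k t"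
proof
  \<comment> \<open>The regular solution is -6 (1 - t^2)^(-3/2) times the integral of sqrt(1 - r^2)
    over [t, 1]. The half-angle substitution r = (1 - z s^2)/(1 + z s^2) with z = (1 - t)/(1 + t)
    turns it into -6 (1 + z)^3 F(z). This has no roots and is smooth across t = 1, that is, z =
    0.\<close>
  define f where "f z s = s\<^sup>2 / (1 + z * s\<^sup>2) ^ 3" for z s :: real
  define fz where "fz z s = - 3 * s ^ 4 / (1 + z * s\<^sup>2) ^ 4" for z s :: real
  define F where "F z = integral {0..1} (f z)" for z
  define Fz where "Fz z = integral {0..1} (fz z)" for z
  have pos: "0 < 1 + z * s\<^sup>2" if "-1 < z" "s \<in> {0..1}" for z s :: real
  proof (cases "s = 0")
    case False
    then have "0 < s\<^sup>2" "s\<^sup>2 \<le> 1" using that by (auto simp: power_le_one)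
    then have "- (s\<^sup>2) < z * s\<^sup>2" using that mult_strict_right_mono[of "-1" z "s\<^sup>2"] by simp
    then show ?thesis using \<open>s\<^sup>2 \<le> 1\<close> by linarith
  qed simp
  have cf: "continuous_on {0..1} (f z)" if "-1 < z" for z
    unfolding f_def using pos[OF that] by (fastforce intro!: continuous_intros)
  have cfz: "continuous_on ({-1<..} \<times> cbox 0 1) (\<lambda>(z, s). fz z s)"
    unfolding fz_def split_beta
    by (intro continuous_intros ballI) (use pos in fastforce)
  have cFz: "continuous_on {-1<..} Fz"
    using integral_continuous_on_param[OF cfz] by (simp add: Fz_def)
  have dF: "(F has_real_derivative Fz z) (at z)" if "-1 < z" for z
  proof -
    have "((\<lambda>z. integral (cbox 0 1) (f z)) has_field_derivative integral (cbox 0 1) (fz z)) (at z within {-1<..})"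
    proof (rule leibniz_rule_field_derivative[OF _ _ cfz])
      fix y s :: real assume y: "y \<in> {-1<..}" and s: "s \<in> cbox 0 1"
      then have p: "1 + y * s\<^sup>2 \<noteq> 0" using pos[of y s] by auto
      have "(1 + y * s\<^sup>2) ^ 6 = (1 + y * s\<^sup>2) ^ 4 * (1 + y * s\<^sup>2)\<^sup>2"
        by (simp flip: power_add)
      then show "((\<lambda>z. f z s) has_field_derivative fz y s) (at y within {-1<..})"
        unfolding f_def fz_def using p
        by (auto intro!: derivative_eq_intros simp: power_mult[symmetric] power2_eq_square power4_eq_xxxx divide_simps)
    qed (use that cf in \<open>auto intro: integrable_continuous_interval convex_real_interval\<close>)
    then show ?thesis
      using that at_within_open[of z "{-1<..}"] by (simp add: F_def[abs_def] Fz_def)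
  qed
  have parts: "3 * F z + 2 * z * Fz z = 1 / (1 + z) ^ 3" if z: "-1 < z" for z
  proof -
    have "((\<lambda>s. 3 * f z s + 2 * z * fz z s) has_integral 1 ^ 3 / (1 + z * 1\<^sup>2) ^ 3 - 0 ^ 3 / (1 + z * 0\<^sup>2) ^ 3) {0..1}"
    proof (rule fundamental_theorem_of_calculus)
      fix s :: real assume s: "s \<in> {0..1}"
      have p: "1 + z * s\<^sup>2 \<noteq> 0" using pos[OF z s] by auto
      define D where "D = 1 + z * s\<^sup>2"
      have "((\<lambda>s. s ^ 3 / (1 + z * s\<^sup>2) ^ 3) has_real_derivative
          (3 * s\<^sup>2 * D ^ 3 - s ^ 3 * (3 * D\<^sup>2 * (z * (2 * s)))) / (D ^ 3 * D ^ 3)) (at s)"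
        using p unfolding D_def by (auto intro!: derivative_eq_intros)
      moreover have "(3 * s\<^sup>2 * D ^ 3 - s ^ 3 * (3 * D\<^sup>2 * (z * (2 * s)))) / (D ^ 3 * D ^ 3) = 3 * f z s + 2 * z * fz z s"
        unfolding f_def fz_def using p unfolding D_def[symmetric]
        by (simp add: divide_simps) (simp add: eval_nat_numeral algebra_simps)
      ultimately show "((\<lambda>s. s ^ 3 / (1 + z * s\<^sup>2) ^ 3) has_vector_derivative 3 * f z s + 2 * z * fz z s) (at s within {0..1})"
        by (simp add: has_field_derivative_at_within has_real_derivative_iff_has_vector_derivative[symmetric])
    qed simp
    then have "integral {0..1} (\<lambda>s. 3 * f z s + 2 * z * fz z s) = 1 / (1 + z) ^ 3"
      by (simp add: integral_unique)
    moreover have "continuous_on {0..1} (fz z)"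
      unfolding fz_def using pos[OF z] by (fastforce intro!: continuous_intros)
    then have "(\<lambda>s. 3 * f z s) integrable_on {0..1}" "(\<lambda>s. 2 * z * fz z s) integrable_on {0..1}"
      using cf[OF z] by (auto intro!: integrable_continuous_interval continuous_on_mult_left)
    ultimately show ?thesis
      using integral_add[of "\<lambda>s. 3 * f z s" "{0..1}" "\<lambda>s. 2 * z * fz z s"] by (simp add: F_def Fz_def)
  qed
  define \<zeta> where "\<zeta> t = (1 - t) / (1 + t)" for t :: real
  define K where "K t = - 6 * (1 + \<zeta> t) ^ 3 * F (\<zeta> t)" for t
  define K' where "K' t = (- 18 * (1 + \<zeta> t)\<^sup>2 * F (\<zeta> t) - 6 * (1 + \<zeta> t) ^ 3 * Fz (\<zeta> t)) * (- 2 / (1 + t)\<^sup>2)" for t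
  have \<zeta>: "-1 < \<zeta> t" if "-1 < t" for t using that by (simp add: \<zeta>_def field_simps)
  have dK: "(K has_real_derivative K' t) (at t)" if t: "-1 < t" for t
  proof -
    have d\<zeta>: "(\<zeta> has_real_derivative - 2 / (1 + t)\<^sup>2) (at t)"
      unfolding \<zeta>_def using t by (auto intro!: derivative_eq_intros simp: power2_eq_square)
    have "((\<lambda>z. - 6 * (1 + z) ^ 3 * F z) has_real_derivative - 18 * (1 + \<zeta> t)\<^sup>2 * F (\<zeta> t) - 6 * (1 + \<zeta> t) ^ 3 * Fz (\<zeta> t)) (at (\<zeta> t))"
      using \<zeta>[OF t] by (auto intro!: derivative_eq_intros dF)
    from DERIV_chain2[OF this d\<zeta>] show ?thesis by (simp add: K_def[abs_def] K'_def)
  qed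
  have c\<zeta>: "continuous_on {-1<..} \<zeta>"
    unfolding \<zeta>_def by (auto intro!: continuous_intros)
  have cF: "continuous_on {-1<..} F"
    by (meson DERIV_isCont continuous_at_imp_continuous_on dF greaterThan_iff)
  have cK': "continuous_on {-1<..} K'"
    unfolding K'_def
    by (intro continuous_intros c\<zeta> continuous_on_compose2[OF cF c\<zeta>] continuous_on_compose2[OF cFz c\<zeta>])
      (use \<zeta> in auto)
  have ode: "K' t * (1 - t\<^sup>2) = 6 + 3 * t * K t" if t: "-1 < t" for t
  proof -
    define z where "z = \<zeta> t"
    have z: "-1 < z" using \<zeta>[OF t] by (simp add: z_def)
    have zt: "1 + z = 2 / (1 + t)" "t * (1 + z) = 1 - z"
      using t by (simp_all add: z_def \<zeta>_def field_simps)
    have "(- 2 / (1 + t)\<^sup>2) * (1 - t\<^sup>2) = - 2 * z"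
      using t by (simp add: z_def \<zeta>_def power2_eq_square divide_simps) (simp add: algebra_simps)
    then have "K' t * (1 - t\<^sup>2) = (- 18 * (1 + z)\<^sup>2 * F z - 6 * (1 + z) ^ 3 * Fz z) * (- 2 * z)"
      unfolding K'_def z_def[symmetric] by (metis mult.assoc)
    also have "\<dots> = 36 * z * (1 + z)\<^sup>2 * F z + 6 * (1 + z) ^ 3 * (2 * z * Fz z)"
      by (simp add: algebra_simps)
    also have "2 * z * Fz z = 1 / (1 + z) ^ 3 - 3 * F z"
      using parts[OF z] by linarith
    also have "6 * (1 + z) ^ 3 * (1 / (1 + z) ^ 3 - 3 * F z) = 6 - 18 * (1 + z) ^ 3 * F z"
      using z by (simp add: right_diff_distrib)
    also have "36 * z * (1 + z)\<^sup>2 * F z + (6 - 18 * (1 + z) ^ 3 * F z) = 6 - 18 * (1 - z) * (1 + z)\<^sup>2 * F z"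
      by (simp add: power2_eq_square power3_eq_cube algebra_simps)
    also have "\<dots> = 6 + 3 * t * K t"
      unfolding K_def z_def[symmetric] zt(2)[symmetric] by (simp add: power2_eq_square power3_eq_cube)
    finally show ?thesis .
  qed
  \<comment> \<open>\<open>\<sigma>\<close> is the identity from \<open>a\<close> on and maps the
    whole line into the domain t > -1 of \<open>K\<close>. With this \<open>C\<close> its minimum
    below \<open>a\<close> is attained at t = -1 and equals (a - 1)/2 > -1.\<close>
  define C where "C = 1 / (2 * (a + 1))"
  define \<sigma> where "\<sigma> t = t + C * pl (a - t)" for t
  have \<sigma>: "-1 < \<sigma> t" for t
  proof (cases "a \<le> t")
    case True
    then show ?thesis using a by (simp add: \<sigma>_def pl_def)
  next
    case False
    have C: "2 * (a + 1) * C = 1" using a by (simp add: C_def)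
    have "2 * (a + 1) * (\<sigma> t - (a - 1) / 2) = 2 * (a + 1) * (t - (a - 1) / 2) + (2 * (a + 1) * C) * (a - t)\<^sup>2"
      using False by (simp add: \<sigma>_def pl_def algebra_simps)
    also have "\<dots> = (t + 1)\<^sup>2"
      unfolding C by (simp add: field_simps power2_eq_square)
    finally have "2 * (a + 1) * (\<sigma> t - (a - 1) / 2) \<ge> 0" by simp
    then have "(a - 1) / 2 \<le> \<sigma> t" using a by (simp add: zero_le_mult_iff)
    moreover have "-1 < (a - 1) / 2" using a by (simp add: field_simps)
    ultimately show ?thesis by (rule less_le_trans[rotated])
  qed
  have d\<sigma>: "(\<sigma> has_real_derivative 1 - 2 * C * max 0 (a - t)) (at t)" for t
    unfolding \<sigma>_def
    by (rule derivative_eq_intros DERIV_chain2[OF has_derivative_pl] refl)+ simp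
  have c\<sigma>: "continuous_on UNIV \<sigma>"
    by (meson DERIV_isCont continuous_at_imp_continuous_on d\<sigma>)
  show "((\<lambda>t. K (\<sigma> t)) has_real_derivative K' (\<sigma> t) * (1 - 2 * C * max 0 (a - t))) (at t)" for t
    by (rule DERIV_chain2[OF dK[OF \<sigma>] d\<sigma>])
  show "continuous_on UNIV (\<lambda>t. K' (\<sigma> t) * (1 - 2 * C * max 0 (a - t)))"
    by (intro continuous_intros continuous_on_compose2[OF cK' c\<sigma>]) (use \<sigma> in auto)
  show "K' (\<sigma> t) * (1 - 2 * C * max 0 (a - t)) * (1 - t\<^sup>2) = 6 + 3 * t * K (\<sigma> t)" if "a \<le> t" for t
    using ode[of t] that a by (simp add: \<sigma>_def pl_def)
qed

section \<open>A parametrization of tuples of unit quaternions\<close>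

definition qpar :: "nat \<Rightarrow> pt \<Rightarrow> nat \<Rightarrow> quat" where
  "qpar n x i = (if i < n then
     Quat (cos (x (n + i)) * cos (x i)) (cos (x (n + i)) * sin (x i))
       (sin (x (n + i)) * cos (x (2 * n + i))) (sin (x (n + i)) * sin (x (2 * n + i)))
   else 1)"

definition dqpar :: "nat \<Rightarrow> pt \<Rightarrow> nat \<Rightarrow> quat ga" where
  "dqpar n x i = (if i < n then
     emb 1 ((- sin (x (n + i)) * cos (x i)) *\<^sub>R evec (n + i) + (cos (x (n + i)) * - sin (x i)) *\<^sub>R evec i) +
     emb qI ((- sin (x (n + i)) * sin (x i)) *\<^sub>R evec (n + i) + (cos (x (n + i)) * cos (x i)) *\<^sub>R evec i) +
     emb qJ ((cos (x (n + i)) * cos (x (2 * n + i))) *\<^sub>R evec (n + i) +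
       (sin (x (n + i)) * - sin (x (2 * n + i))) *\<^sub>R evec (2 * n + i)) +
     emb qK ((cos (x (n + i)) * sin (x (2 * n + i))) *\<^sub>R evec (n + i) +
       (sin (x (n + i)) * cos (x (2 * n + i))) *\<^sub>R evec (2 * n + i))
   else 0)"

lemma hasD_product:
  assumes c: "c < 3 * n" "d < 3 * n"
    and F: "\<And>t. (F has_real_derivative F' t) (at t)" "continuous_on UNIV F'"
    and G: "\<And>t. (G has_real_derivative G' t) (at t)" "continuous_on UNIV G'"
  shows "hasD n (\<lambda>x. cst (F (x c) * G (x d))) (\<lambda>x. (F' (x c) * G (x d)) *\<^sub>R evec c + (F (x c) * G' (x d)) *\<^sub>R evec d)"
  by (rule hasD_cong[OF hasD_mult[OF hasD_fun[OF hasD_coord[OF c(1)] F] hasD_fun[OF hasD_coord[OF c(2)] G]]])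
    (simp_all add: cst_mult cst_real mult.commute)

text \<open>The form is the exterior differential of F G. Its own exterior derivative cancels by
  anticommutation, so only the contraction is left.\<close>

lemma hasD_dproduct:
  assumes c: "c < 3 * n" "d < 3 * n"
    and F: "\<And>t. (F has_real_derivative F' t) (at t)" "continuous_on UNIV F'"
    and F': "\<And>t. (F' has_real_derivative F'' t) (at t)" "continuous_on UNIV F''"
    and G: "\<And>t. (G has_real_derivative G' t) (at t)" "continuous_on UNIV G'"
    and G': "\<And>t. (G' has_real_derivative G'' t) (at t)" "continuous_on UNIV G''"
  shows "hasD n (\<lambda>x. (F' (x c) * G (x d)) *\<^sub>R (evec c :: real ga) + (F (x c) * G' (x d)) *\<^sub>R evec d)
    (\<lambda>x. - ((F' (x c) * G (x d)) *\<^sub>R iota n (evec c) + (F (x c) * G' (x d)) *\<^sub>R iota n (evec d)))"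
proof -
  have sq: "evec e * evec e = (0 :: real ga)" for e
    by (rule real_odd_square) simp
  have ac: "evec d * evec c = - (evec c * evec d :: real ga)"
    by (rule real_odd_anticommute) simp_all
  show ?thesis
    by (rule hasD_cong[OF hasD_add[OF hasD_mult[OF hasD_product[OF c F' G] hasD_const[of n "evec c :: real ga"]]
        hasD_mult[OF hasD_product[OF c F G'] hasD_const[of n "evec d :: real ga"]]]])
      (simp_all add: cst_real sq ac algebra_simps)
qed

lemma hasD_emb: "hasD n F G \<Longrightarrow> hasD n (\<lambda>x. emb u (F x)) (\<lambda>x. emb u (G x))"
  unfolding emb_def by (erule hasD_map) (rule bounded_linear_scaleR_left)

lemma cst_Quat: "cst (Quat a b c d) = emb 1 (cst a) + emb qI (cst b) + emb qJ (cst c) + emb qK (cst d)"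
  by (rule ga_eqI) (auto simp: coef_cst coef_emb intro!: quat.expand)

lemma gam_emb [simp]: "gam (emb u x) = emb u (gam x)"
  by (rule ga_eqI) (simp add: coef_emb)

lemma emb_uminus: "emb u (- x) = - emb u x"
  by (rule ga_eqI) (simp add: coef_emb)

lemma emb_zero [simp]: "emb u 0 = 0"
  by (rule ga_eqI) (simp add: coef_emb)

lemma qpar_Sp1: "qpar n x i \<in> Sp1"
proof (cases "i < n")
  case True
  define C S where "C = cos (x (n + i))" and "S = sin (x (n + i))"
  have "(C * cos (x i))\<^sup>2 + (C * sin (x i))\<^sup>2 + (S * cos (x (2 * n + i)))\<^sup>2 + (S * sin (x (2 * n + i)))\<^sup>2
      = C\<^sup>2 * ((sin (x i))\<^sup>2 + (cos (x i))\<^sup>2) + S\<^sup>2 * ((sin (x (2 * n + i)))\<^sup>2 + (cos (x (2 * n + i)))\<^sup>2)"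
    by (simp only: power_mult_distrib distrib_left add_ac)
  also have "\<dots> = 1"
    by (simp only: sin_cos_squared_add C_def S_def mult_1_right) simp
  finally show ?thesis using True by (simp add: qpar_def Sp1_def C_def S_def)
qed (simp add: qpar_def Sp1_one)

text \<open>Conjugation by exp(i s/2) adds s to \<psi> and fixes \<theta> and \<tau>, so its
  generator is the sum of the fields of the coordinates \<psi>.\<close>

lemma ufield_qpar: "ufield n (\<lambda>x. qpar n x i) (\<lambda>x. dqpar n x i)"
proof (cases "i < n")
  case True
  have c: "n + i < 3 * n" "i < 3 * n" "2 * n + i < 3 * n" using True by auto
  have S: "\<And>t. (sin has_real_derivative cos t) (at t)" "continuous_on UNIV (cos :: real \<Rightarrow> real)"
    and C: "\<And>t. (cos has_real_derivative - sin t) (at t)" "continuous_on UNIV (\<lambda>t::real. - sin t)"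
    and S': "\<And>t. ((\<lambda>t. - sin t) has_real_derivative - cos t) (at t)" "continuous_on UNIV (\<lambda>t::real. - cos t)"
    by (auto intro!: derivative_eq_intros continuous_intros)
  have "hasD n (\<lambda>x. cst (qpar n x i)) (\<lambda>x. dqpar n x i)"
    by (rule hasD_cong[OF hasD_add[OF hasD_add[OF hasD_add[OF hasD_emb[OF hasD_product[OF c(1,2) C C]]
        hasD_emb[OF hasD_product[OF c(1,2) C S]]] hasD_emb[OF hasD_product[OF c(1,3) S C]]]
        hasD_emb[OF hasD_product[OF c(1,3) S S]]]])
      (use True in \<open>simp_all add: qpar_def dqpar_def cst_Quat\<close>)
  moreover have e: "qpar n x i * ehalf - ehalf * qpar n x i =
      Quat 0 0 (sin (x (n + i)) * sin (x (2 * n + i))) (- (sin (x (n + i)) * cos (x (2 * n + i))))" for x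
    using True by (auto simp: qpar_def ehalf_def intro!: quat.expand)
  have "hasD n (\<lambda>x. dqpar n x i) (\<lambda>x. cst (qpar n x i * ehalf - ehalf * qpar n x i))"
    unfolding e cst_Quat
    by (rule hasD_cong[OF hasD_add[OF hasD_add[OF hasD_add[OF hasD_emb[OF hasD_dproduct[OF c(1,2) C S' C S']]
        hasD_emb[OF hasD_dproduct[OF c(1,2) C S' S C]]] hasD_emb[OF hasD_dproduct[OF c(1,3) S C C S']]]
        hasD_emb[OF hasD_dproduct[OF c(1,3) S C S C]]]])
      (use True in \<open>simp add: dqpar_def\<close>, use True in \<open>auto simp: coef_emb coef_cst one_ga_def coef_mk intro!: ga_eqI\<close>)
  moreover have "gam (dqpar n x i) = - dqpar n x i" for x
    using True by (simp add: dqpar_def) (rule ga_eqI, simp add: coef_emb algebra_simps)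
  ultimately show ?thesis by (simp add: ufield_def qpar_Sp1)
qed (use ufield_one in \<open>simp add: qpar_def dqpar_def\<close>)

section \<open>Restriction to a set of coordinates\<close>

text \<open>Pullback to a slice on which the coordinates outside \<open>N\<close> are constant. As
  an algebra homomorphism it passes through all constructions from the differentials of the
  generators.\<close>

definition restr :: "nat set \<Rightarrow> 'a::real_algebra_1 ga \<Rightarrow> 'a ga" where
  "restr N x = mk (\<lambda>J. if J \<subseteq> N then coef x J else 0)"

lemma coef_restr: "coef (restr N x) J = (if J \<subseteq> N then coef x J else 0)"
  by (cases "finite J") (simp_all add: restr_def coef_mk)

lemma restr_simps [simp]: "restr N 0 = 0" "restr N 1 = 1" "restr N (x + y) = restr N x + restr N y"
  "restr N (x - y) = restr N x - restr N y" "restr N (- x) = - restr N x" "restr N (r *\<^sub>R x) = r *\<^sub>R restr N x" "restr N (cst a) = cst a"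
  "restr N (evec c) = (if c \<in> N then evec c else 0)"
  by (rule ga_eqI; auto simp: coef_restr coef_cst coef_evec one_ga_def coef_mk)+

lemma restr_mult [simp]: "restr N (x * y) = restr N x * restr N y"
proof (rule ga_eqI)
  fix J :: "nat set" assume J: "finite J"
  show "coef (restr N (x * y)) J = coef (restr N x * restr N y) J"
  proof (cases "J \<subseteq> N")
    case True
    then show ?thesis
      unfolding coef_restr coef_mult[OF J] by (auto intro!: sum.cong)
  next
    case False
    then have "coef (restr N x) A * coef (restr N y) (J - A) = 0" for A
      by (auto simp: coef_restr)
    then show ?thesis using False by (simp add: coef_restr coef_mult[OF J])
  qed
qed

lemma restr_mapga: "linear f \<Longrightarrow> restr N (mapga f x) = mapga f (restr N x)"
  by (rule ga_eqI) (simp add: coef_restr coef_mapga linear_0)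

lemma restr_emb [simp]: "restr N (emb u x) = emb u (restr N x)"
  by (rule ga_eqI) (simp add: coef_restr coef_emb)

lemma restr_prod_list: "restr N (prod_list xs) = prod_list (map (restr N) xs)"
  by (induction xs) simp_all

lemma restr_dword: "restr N (dword q dq w) = dword q (\<lambda>i. restr N (dq i)) w"
  by (induction w) (simp_all add: dletter_def restr_mapga linear_quat)

lemma restr_Pword: "restr N (Pword q dq w) = Pword q (\<lambda>i. restr N (dq i)) w"
  by (induction w) (simp_all add: dletter_def restr_mapga linear_quat restr_dword Lform_def Rform_def)

lemma restr_Sform: "restr N (Sform v a) = Sform v (restr N a)"
  by (simp add: Sform_def comp_defs restr_mapga linear_quat)

lemma restr_varpi: "restr N (varpi k v a) = varpi k v (restr N a)"
  by (simp add: varpi_def restr_Sform)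

lemma restr_Bform: "restr N (Bform g W v a) = Bform g W v (restr N a)"
  by (simp add: Bform_def restr_Sform comp_defs restr_mapga linear_quat)

text \<open>An algebraic expression in the quaternions and their differentials without reference to
  coordinates; periodicity, degree bounds and restriction to the torus are therefore inherited from
  \<open>qpar\<close> and \<open>dqpar\<close>.\<close>

definition Omega :: "(real \<Rightarrow> real) \<Rightarrow> (nat \<Rightarrow> real \<Rightarrow> real) \<Rightarrow> (nat \<Rightarrow> real \<Rightarrow> real) \<Rightarrow> word \<Rightarrow> (nat \<Rightarrow> word) \<Rightarrow> nat list \<Rightarrow>
    (nat \<Rightarrow> quat) \<Rightarrow> (nat \<Rightarrow> quat ga) \<Rightarrow> real ga" where
  "Omega k g W w v is q dq = (Pword q dq w - varpi k (word_hom q w) (dword q dq w)) *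
     prod_list (map (\<lambda>i. Bform (g i) (W i) (word_hom q (v i)) (dword q dq (v i))) is)"

lemma restr_Omega: "restr N (Omega k g W w v is q dq) = Omega k g W w v is q (\<lambda>i. restr N (dq i))"
  by (simp add: Omega_def restr_prod_list restr_Pword restr_varpi restr_dword restr_Bform o_def)

lemma Omega_coef_zero:
  assumes "\<And>i. restr (- {c}) (dq i) = dq i" "c \<in> J"
  shows "coef (Omega k g W w v is q dq) J = 0"
proof -
  have "restr (- {c}) (Omega k g W w v is q dq) = Omega k g W w v is q dq"
    unfolding restr_Omega assms(1) ..
  then have "coef (Omega k g W w v is q dq) J = coef (restr (- {c}) (Omega k g W w v is q dq)) J" by simp
  then show ?thesis using assms(2) by (simp add: coef_restr)
qed

text \<open>d\<psi> occurs only with the factor sin \<tau>; in the next lemma d\<theta> occurs only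
  with cos \<tau>.\<close>

lemma restr_dqpar_psi: "i < n \<Longrightarrow> x (n + i) = 0 \<Longrightarrow> restr (- {2 * n + i}) (dqpar n x j) = dqpar n x j"
  by (auto simp: dqpar_def)

lemma restr_dqpar_theta: "i < n \<Longrightarrow> x (n + i) = pi / 2 \<Longrightarrow> restr (- {i}) (dqpar n x j) = dqpar n x j"
proof -
  assume "i < n" "x (n + i) = pi / 2"
  moreover from this have "cos (x (n + i)) = 0" by (simp only: cos_pi_half)
  ultimately show ?thesis by (cases "j = i") (auto simp: dqpar_def)
qed

subsection \<open>Degrees\<close>

definition deg_le :: "nat \<Rightarrow> 'a::real_algebra_1 ga \<Rightarrow> bool" where
  "deg_le m x \<longleftrightarrow> (\<forall>J. m < card J \<longrightarrow> coef x J = 0)"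

lemma deg_le_simps: "deg_le m 0" "deg_le m (cst a)" "deg_le m 1" "deg_le m x \<Longrightarrow> deg_le m (r *\<^sub>R x)"
  "deg_le m x \<Longrightarrow> deg_le m y \<Longrightarrow> deg_le m (x + y)" "deg_le m x \<Longrightarrow> deg_le m y \<Longrightarrow> deg_le m (x - y)"
  "deg_le 1 (evec c)" "linear f \<Longrightarrow> deg_le m z \<Longrightarrow> deg_le m (mapga f z)" "deg_le m t \<Longrightarrow> deg_le m (emb u t)"
  "deg_le m x \<Longrightarrow> deg_le m (- x)"
  by (auto simp: deg_le_def coef_cst coef_evec one_ga_def coef_mk coef_mapga linear_0 coef_emb)

lemma deg_le_mult:
  assumes x: "deg_le k x" and y: "deg_le l y" and m: "k + l = m"
  shows "deg_le m (x * y)"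
  unfolding deg_le_def
proof (intro allI impI)
  fix J :: "nat set" assume "m < card J"
  then have J: "k + l < card J" by (simp add: m)
  then have fin: "finite J" using card.infinite by force
  have "coef x A * coef y (J - A) = 0" if "A \<in> Pow J" for A
  proof -
    have "card J = card A + card (J - A)"
      using that fin by (metis PowD card_Diff_subset card_mono finite_subset le_add_diff_inverse)
    then have "k < card A \<or> l < card (J - A)" using J by linarith
    then show ?thesis using x y by (auto simp: deg_le_def)
  qed
  then show "coef (x * y) J = 0" by (simp add: coef_mult[OF fin])
qed

lemma deg_le_mono: "deg_le k x \<Longrightarrow> k \<le> l \<Longrightarrow> deg_le l x"
  by (auto simp: deg_le_def)

lemma deg_le_cst_mult: "deg_le m x \<Longrightarrow> deg_le m (cst a * x)" "deg_le m x \<Longrightarrow> deg_le m (x * cst a)"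
  by (auto simp: deg_le_def)

lemma deg_le_dword: "(\<And>i. deg_le 1 (dq i)) \<Longrightarrow> deg_le 1 (dword q dq w)"
  by (induction w) (auto simp: dletter_def intro!: deg_le_simps deg_le_cst_mult linear_quat)

lemma deg_le_Pword: "(\<And>i. deg_le 1 (dq i)) \<Longrightarrow> deg_le 2 (Pword q dq w)"
proof (induction w)
  case (Cons a w)
  have "deg_le 1 (dletter dq a)"
    unfolding dletter_def using Cons.prems by (cases "snd a") (simp_all add: deg_le_simps(8) linear_quat del: One_nat_def)
  then have "deg_le 2 (Lform (qletter q a) (dletter dq a) * Rform (word_hom q w) (dword q dq w))"
    unfolding Lform_def Rform_def
    by (intro deg_le_mult[of 1 _ 1] deg_le_cst_mult deg_le_dword Cons.prems) simp_all
  then show ?case using Cons by (auto intro!: deg_le_simps linear_quat)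
qed (simp add: deg_le_simps)

lemma deg_le_Sform: "deg_le 1 a \<Longrightarrow> deg_le 2 (Sform v a)"
proof -
  assume a: "deg_le 1 a"
  have "deg_le 2 (comp2 a * comp3 a)" "deg_le 2 (comp3 a * comp1 a)" "deg_le 2 (comp1 a * comp2 a)"
    unfolding comp_defs by (intro deg_le_mult[of 1 _ 1] deg_le_simps linear_quat a; simp)+
  then show ?thesis unfolding Sform_def by (auto intro!: deg_le_simps)
qed

lemma deg_le_varpi: "deg_le 1 a \<Longrightarrow> deg_le 2 (varpi k v a)"
  unfolding varpi_def by (intro deg_le_simps deg_le_Sform)

lemma deg_le_Bform: 
  assumes a: "deg_le 1 a" shows "deg_le 3 (Bform g W v a)"
proof -
  have "deg_le 3 (comp0 a * Sform v a)"
    unfolding comp_defs by (intro deg_le_mult[of 1 _ 2] deg_le_simps linear_quat a deg_le_Sform) simp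
  moreover have "deg_le 3 (comp1 a)"
    unfolding comp_defs by (intro deg_le_mono[OF deg_le_simps(8)[OF linear_quat(2) a]]) simp
  ultimately show ?thesis unfolding Bform_def by (auto intro!: deg_le_simps)
qed

lemma deg_le_Omega:
  assumes "\<And>i. deg_le 1 (dq i)"
  shows "deg_le (2 + 3 * length is) (Omega k g W w v is q dq)"
  unfolding Omega_def
proof (rule deg_le_mult)
  show "2 + 3 * length is = 2 + 3 * length is" ..
  show "deg_le 2 (Pword q dq w - varpi k (word_hom q w) (dword q dq w))"
    by (intro deg_le_simps deg_le_Pword deg_le_varpi deg_le_dword assms)
  show "deg_le (3 * length is) (prod_list (map (\<lambda>i. Bform (g i) (W i) (word_hom q (v i)) (dword q dq (v i))) is))"
  proof (induction "is")
    case (Cons a "is")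
    have "deg_le (3 * length (a # is)) (Bform (g a) (W a) (word_hom q (v a)) (dword q dq (v a)) *
        prod_list (map (\<lambda>i. Bform (g i) (W i) (word_hom q (v i)) (dword q dq (v i))) is))"
      by (intro deg_le_mult[of 3, OF _ Cons] deg_le_Bform deg_le_dword assms) simp
    then show ?case by simp
  qed (simp add: deg_le_simps)
qed

lemma deg_le_dqpar: "deg_le 1 (dqpar n x i)"
  by (cases "i < n") (auto simp: dqpar_def simp del: One_nat_def mult_minus_left mult_minus_right intro!: deg_le_simps)

section \<open>Evaluation on the maximal torus\<close>

definition Eq :: "real \<Rightarrow> quat" where "Eq t = Quat (cos t) (sin t) 0 0"

lemma Eq_simps: "Eq 0 = 1" "Eq s * Eq t = Eq (s + t)" "qconj (Eq t) = Eq (- t)" "qI * Eq t = Eq t * qI"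
  by (auto simp: Eq_def cos_add sin_add intro!: quat.expand)

section \<open>Abelianization as one-forms on the torus\<close>

definition ell :: "word \<Rightarrow> real ga" where "ell w = letsum evec w"

lemma ell_simps [simp]: "ell [] = 0" "ell (a # w) = (if snd a then 1 else -1) *\<^sub>R evec (fst a) + ell w"
  "ell (w @ w') = ell w + ell w'" "ell (word_inv w) = - ell w" "ell (commutator w1 w2) = 0"
  by (simp_all add: ell_def)

lemma gam_ell [simp]: "gam (ell w) = - ell w"
  by (induction w) (simp_all add: algebra_simps)

lemma ell_square: "ell w * ell w = 0"
  by (rule real_odd_square) simp

lemma ell_anticommute: "ell w * ell w' = - (ell w' * ell w)"
  by (rule real_odd_anticommute) simp_all

text \<open>The sum of products of letter forms over all pairs of positions in increasing order. It
  is additive up to the term \<open>ell w * ell w'\<close>, and this term turns commutators into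
  \<lambda>.\<close>

primrec Qword :: "word \<Rightarrow> real ga" where
  "Qword [] = 0"
| "Qword (a # w) = Qword w + ell [a] * ell w"

lemma Qword_append: "Qword (w @ w') = Qword w + Qword w' + ell w * ell w'"
  by (induction w) (simp_all add: algebra_simps)

lemma Qword_word_inv: "Qword (word_inv w) = - Qword w"
proof (induction w)
  case (Cons a w)
  have inv: "word_inv (a # w) = word_inv w @ word_inv [a]" by (simp add: word_inv_def)
  have "Qword (word_inv [a]) = 0" by (simp add: word_inv_def)
  then show ?case
    unfolding inv Qword_append ell_simps(4) Cons using ell_anticommute[of w "[a]"] by (simp del: ell_simps(2))
qed (simp add: word_inv_def)

lemma Qword_commutator: "Qword (commutator a b) = 2 *\<^sub>R (ell a * ell b)"
  unfolding commutator_def Qword_append Qword_word_inv ell_simps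
  using ell_anticommute[of b a] by (simp add: algebra_simps ell_square scaleR_2)

lemma Qword_commutators:
  "Qword (concat (map (\<lambda>l. commutator (u l) (u' l)) ls)) = 2 *\<^sub>R (\<Sum>l\<leftarrow>ls. ell (u l) * ell (u' l))"
  by (induction ls) (simp_all add: Qword_append Qword_commutator algebra_simps)

context
  fixes n :: nat and \<theta> :: "nat \<Rightarrow> real" and q :: "nat \<Rightarrow> quat" and dq :: "nat \<Rightarrow> quat ga"
  assumes q: "\<And>i. i < n \<Longrightarrow> q i = Eq (\<theta> i)" and dq: "\<And>i. i < n \<Longrightarrow> dq i = emb (qI * Eq (\<theta> i)) (evec i)"
begin

lemma emb_cst: "emb u x * cst a = emb (u * a) x" "cst a * emb u x = emb (a * u) x"
  by (rule ga_eqI; simp add: coef_emb)+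

lemma mapga_qconj_emb: "mapga qconj (emb u x) = emb (qconj u) x"
  by (rule ga_eqI) (simp add: coef_mapga linear_quat coef_emb)

lemma torus_letter:
  assumes "fst a < n"
  shows "qletter q a = Eq (letsum \<theta> [a])" "dletter dq a = emb (qI * Eq (letsum \<theta> [a])) (ell [a])"
proof -
  show "qletter q a = Eq (letsum \<theta> [a])"
    using assms by (simp add: qletter_def q Eq_simps)
  have "qconj (qI * Eq (\<theta> (fst a))) = - (qI * Eq (- \<theta> (fst a)))"
    by (auto simp: Eq_def intro!: quat.expand)
  then show "dletter dq a = emb (qI * Eq (letsum \<theta> [a])) (ell [a])"
    using assms by (simp add: dletter_def dq mapga_qconj_emb emb_neg emb_uminus)
qed

lemma torus_word:
  assumes "in_Fn n w"
  shows "word_hom q w = Eq (letsum \<theta> w)" "dword q dq w = emb (qI * Eq (letsum \<theta> w)) (ell w)"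
proof -
  have "word_hom q w = Eq (letsum \<theta> w) \<and> dword q dq w = emb (qI * Eq (letsum \<theta> w)) (ell w)"
    using assms
  proof (induction w)
    case (Cons a w)
    then have a: "fst a < n" and w: "in_Fn n w" by (auto simp: in_Fn_def)
    note t = torus_letter[OF a]
    have e: "letsum \<theta> (a # w) = letsum \<theta> [a] + letsum \<theta> w" "ell (a # w) = ell [a] + ell w" by simp_all
    show ?case
      unfolding word_hom_simps dword.simps e t using Cons.IH[OF w]
      by (simp only: Eq_simps(2) emb_cst emb_add mult.assoc) (simp only: Eq_simps(4) mult.assoc[symmetric] Eq_simps(2))
  qed (simp add: Eq_simps)
  then show "word_hom q w = Eq (letsum \<theta> w)" "dword q dq w = emb (qI * Eq (letsum \<theta> w)) (ell w)" by auto
qed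

lemma torus_LR: "Lform (Eq t) (emb (qI * Eq t) x) = emb qI x" "Rform (Eq t) (emb (qI * Eq t) x) = emb qI x"
proof -
  have "qconj (Eq t) * (qI * Eq t) = qI" "qI * Eq t * qconj (Eq t) = qI"
    by (simp_all only: Eq_simps(3,4), simp_all only: mult.assoc)
      (simp_all only: Eq_simps(4), simp_all add: Eq_simps(1,2) flip: mult.assoc)
  then show "Lform (Eq t) (emb (qI * Eq t) x) = emb qI x" "Rform (Eq t) (emb (qI * Eq t) x) = emb qI x"
    by (simp_all only: Lform_def Rform_def emb_cst)
qed

text \<open>Both Maurer--Cartan forms are i times \<open>ell\<close> on the torus, so -3 Re(i i) = 3
  is the factor.\<close>

lemma torus_Pword: "in_Fn n w \<Longrightarrow> Pword q dq w = 3 *\<^sub>R Qword w"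
proof (induction w)
  case (Cons a w)
  then have a: "fst a < n" and w: "in_Fn n w" by (auto simp: in_Fn_def)
  show ?case
    unfolding Pword.simps Qword.simps torus_letter[OF a] torus_word[OF w] torus_LR emb_mult quat_units Re_emb
    using Cons.IH[OF w] by (simp add: scaleR_right_distrib)
qed simp

lemma torus_comp: "comp0 (emb (qI * Eq t) x) = - sin t *\<^sub>R x" "comp1 (emb (qI * Eq t) x) = cos t *\<^sub>R x"
  "comp2 (emb (qI * Eq t) x) = 0" "comp3 (emb (qI * Eq t) x) = 0"
  by (rule ga_eqI; simp add: comp_defs coef_mapga linear_quat coef_emb Eq_def)+

lemma torus_Sform: "Sform (Eq t) (emb (qI * Eq t) x) = 0"
  by (simp add: Sform_def torus_comp)

lemma torus_Bform:
  "in_Fn n w \<Longrightarrow> Bform g W (word_hom q w) (dword q dq w) = (W (cos (letsum \<theta> w)) * cos (letsum \<theta> w)) *\<^sub>R ell w"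
  by (simp add: torus_word Bform_def torus_Sform torus_comp(2)) (simp add: Eq_def)

lemma torus_varpi: "in_Fn n w \<Longrightarrow> letsum \<theta> w = 0 \<Longrightarrow> varpi k (word_hom q w) (dword q dq w) = 0"
  by (simp only: torus_word varpi_def torus_Sform) (simp add: Eq_def)

lemma torus_Omega:
  assumes "in_Fn n w" "letsum \<theta> w = 0" "\<And>i. i \<in> set is \<Longrightarrow> in_Fn n (v i)"
  shows "Omega k g W w v is q dq = (3 * (\<Prod>i\<leftarrow>is. W i (cos (letsum \<theta> (v i))) * cos (letsum \<theta> (v i)))) *\<^sub>R
    (Qword w * prod_list (map (\<lambda>i. ell (v i)) is))"
proof -
  have "prod_list (map (\<lambda>i. Bform (g i) (W i) (word_hom q (v i)) (dword q dq (v i))) is) =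
      (\<Prod>i\<leftarrow>is. W i (cos (letsum \<theta> (v i))) * cos (letsum \<theta> (v i))) *\<^sub>R prod_list (map (\<lambda>i. ell (v i)) is)"
    using assms(3) by (induction "is") (simp_all add: torus_Bform mult_ac)
  then show ?thesis
    by (simp add: Omega_def torus_Pword[OF assms(1)] torus_varpi[OF assms(1,2)])
qed

end

lemma restr_dqpar_torus:
  assumes "\<And>j. j < n \<Longrightarrow> x (n + j) = 0" "i < n"
  shows "qpar n x i = Eq (x i)" "restr {..<n} (dqpar n x i) = emb (qI * Eq (x i)) (evec i)"
proof -
  show "qpar n x i = Eq (x i)" using assms by (simp add: qpar_def Eq_def)
  show "restr {..<n} (dqpar n x i) = emb (qI * Eq (x i)) (evec i)"
    using assms by (auto simp: dqpar_def Eq_def coef_emb intro!: ga_eqI quat.expand)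
qed

section \<open>The exterior algebra of the statement\<close>

definition ofe :: "ext \<Rightarrow> real ga" where "ofe \<alpha> = mk (\<lambda>J. of_int (\<alpha> J))"

lemma coef_ofe: "coef (ofe \<alpha>) J = (if finite J then of_int (\<alpha> J) else 0)"
  by (simp add: ofe_def coef_mk)

lemma ofe_mult: "ofe (\<alpha> \<and>\<^sub>e \<beta>) = ofe \<alpha> * ofe \<beta>"
proof (rule ga_eqI)
  fix J :: "nat set" assume J: "finite J"
  then have "finite A" if "A \<in> Pow J" for A using that finite_subset by auto
  then show "coef (ofe (\<alpha> \<and>\<^sub>e \<beta>)) J = coef (ofe \<alpha> * ofe \<beta>) J"
    using J by (simp add: coef_ofe coef_mult ext_mult_def sg_def mult.assoc)
qed

lemma ofe_add: "ofe (ext_add \<alpha> \<beta>) = ofe \<alpha> + ofe \<beta>"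
  by (rule ga_eqI) (simp add: coef_ofe ext_add_def)

lemma ofe_zero: "ofe ext_zero = 0"
  by (rule ga_eqI) (simp add: coef_ofe ext_zero_def)

lemma abel_simps: "abel [] c = 0"
  "abel (a # w) c = (if fst a = c then (if snd a then 1 else -1) else 0) + abel w c"
  by (simp_all add: abel_def)

lemma coef_ell: "coef (ell w) J = (if card J = 1 then of_int (abel w (the_elem J)) else 0)"
proof (induction w)
  case Nil
  then show ?case by (simp add: abel_simps)
next
  case (Cons a w)
  have "coef (evec (fst a)) J = (if card J = 1 then if fst a = the_elem J then 1 else 0 else 0 :: real)"
    by (auto simp: coef_evec card_1_singleton_iff)
  then show ?case using Cons by (auto simp: abel_simps)
qed

lemma ofe_abel: "ofe (ext_vec (abel w)) = ell w"
  by (rule ga_eqI) (simp add: coef_ofe coef_ell ext_vec_def)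

lemma ofe_foldl: "ofe (foldl (\<lambda>acc i. acc \<and>\<^sub>e f i) \<alpha> is) = ofe \<alpha> * prod_list (map (\<lambda>i. ofe (f i)) is)"
  by (induction "is" arbitrary: \<alpha>) (simp_all add: ofe_mult mult.assoc)

lemma ofe_foldr: "ofe (foldr ext_add \<alpha>s ext_zero) = sum_list (map ofe \<alpha>s)"
  by (induction \<alpha>s) (simp_all add: ofe_add ofe_zero)

lemma ext_mult_infinite: "infinite J \<Longrightarrow> (\<alpha> \<and>\<^sub>e \<beta>) J = 0"
  by (simp add: ext_mult_def)

lemma foldl_infinite:
  "infinite J \<Longrightarrow> \<alpha> J = 0 \<Longrightarrow> foldl (\<lambda>acc i. acc \<and>\<^sub>e f i) \<alpha> is J = 0"
  by (induction "is" arbitrary: \<alpha>) (simp_all add: ext_mult_infinite)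

lemma foldr_infinite:
  "infinite J \<Longrightarrow> foldr ext_add (map (\<lambda>l. a l \<and>\<^sub>e b l) ls) ext_zero J = 0"
  by (induction ls) (simp_all add: ext_zero_def ext_add_def ext_mult_infinite)

text \<open>Applied to the product in the hypothesis, this bounds \<open>card I\<close> below by k +
  2, which is what puts the degree of \<open>Omega\<close> below the top.\<close>

definition deg_ge :: "nat \<Rightarrow> real ga \<Rightarrow> bool" where
  "deg_ge m x \<longleftrightarrow> (\<forall>J. finite J \<longrightarrow> card J < m \<longrightarrow> coef x J = 0)"

lemma deg_ge_mult:
  assumes x: "deg_ge k x" and y: "deg_ge l y"
  shows "deg_ge (k + l) (x * y)"
  unfolding deg_ge_def
proof (intro allI impI)
  fix J :: "nat set" assume fin: "finite J" and J: "card J < k + l"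
  have "coef x A * coef y (J - A) = 0" if "A \<in> Pow J" for A
  proof -
    have A: "finite A" "finite (J - A)" using that fin finite_subset by auto
    have "card J = card A + card (J - A)"
      using that fin by (metis PowD card_Diff_subset card_mono finite_subset le_add_diff_inverse)
    then have "card A < k \<or> card (J - A) < l" using J by linarith
    then show ?thesis using x y A by (auto simp: deg_ge_def)
  qed
  then show "coef (x * y) J = 0"
    unfolding coef_mult[OF fin] by (intro sum.neutral ballI) simp
qed

lemma deg_ge_ell: "deg_ge 1 (ell w)"
  by (auto simp: deg_ge_def coef_ell)

lemma deg_ge_prod_list: "deg_ge (length is) (prod_list (map (\<lambda>i. ell (v i)) is))"
proof (induction "is")
  case (Cons a "is")
  then show ?case using deg_ge_mult[OF deg_ge_ell] by fastforce
qed (simp add: deg_ge_def)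

lemma deg_ge_sum_list: "deg_ge 2 (\<Sum>l\<leftarrow>ls. ell (u l) * ell (u' l))"
proof (induction ls)
  case (Cons l ls)
  have "deg_ge 2 (ell (u l) * ell (u' l))"
    using deg_ge_mult[OF deg_ge_ell deg_ge_ell] by (simp add: numeral_2_eq_2)
  then show ?case using Cons by (simp add: deg_ge_def)
qed (simp add: deg_ge_def)

lemma restr_ell: "in_Fn n w \<Longrightarrow> restr {..<n} (ell w) = ell w"
  by (induction w) (auto simp: in_Fn_def)

section \<open>Independence of the abelianized words\<close>

lemma restr_ell_sum: "finite I \<Longrightarrow> restr I (ell w) = (\<Sum>c\<in>I. of_int (abel w c) *\<^sub>R evec c)"
proof (induction w)
  case (Cons a w)
  have "(\<Sum>c\<in>I. (if fst a = c then if snd a then 1 else -1 else 0) *\<^sub>R evec c) =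
      (if fst a \<in> I then (if snd a then 1 else -1) *\<^sub>R evec (fst a) else (0 :: real ga))"
    using Cons.prems by (simp add: if_distrib[of "\<lambda>r. r *\<^sub>R _"] cong: if_cong)
  moreover have "(\<Sum>c\<in>I. of_int (abel (a # w) c) *\<^sub>R evec c) =
      (\<Sum>c\<in>I. (if fst a = c then if snd a then 1 else -1 else 0) *\<^sub>R evec c) + (\<Sum>c\<in>I. of_int (abel w c) *\<^sub>R (evec c :: real ga))"
    unfolding sum.distrib[symmetric] by (rule sum.cong) (auto simp: abel_simps algebra_simps)
  ultimately show ?case using Cons by simp
qed (simp add: abel_simps)

lemma letsum_sum:
  assumes "finite I" "\<And>c. c \<notin> I \<Longrightarrow> \<theta> c = (0::real)"
  shows "letsum \<theta> w = (\<Sum>c\<in>I. of_int (abel w c) * \<theta> c)"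
proof (induction w)
  case (Cons a w)
  have "(\<Sum>c\<in>I. (if fst a = c then if snd a then 1 else -1 else 0) * \<theta> c) =
      (if snd a then 1 else -1) * \<theta> (fst a)"
    using assms by (simp add: if_distrib[of "\<lambda>r. r * _"] cong: if_cong)
  moreover have "(\<Sum>c\<in>I. of_int (abel (a # w) c) * \<theta> c) =
      (\<Sum>c\<in>I. (if fst a = c then if snd a then 1 else -1 else 0) * \<theta> c) + (\<Sum>c\<in>I. of_int (abel w c) * \<theta> c)"
    unfolding sum.distrib[symmetric] by (rule sum.cong) (auto simp: abel_simps algebra_simps)
  ultimately show ?case using Cons by simp
qed (simp add: abel_simps)

text \<open>Linear algebra by induction: if no functional depends on its predecessors, a dual family
  for the first \<open>m\<close> is corrected by a vector in their common kernel on which the next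
  functional is not 0.\<close>

lemma surjective_or_dependent:
  fixes f :: "nat \<Rightarrow> nat \<Rightarrow> real"
  assumes I: "finite I"
  shows "(\<forall>t. \<exists>\<theta>. (\<forall>c. c \<notin> I \<longrightarrow> \<theta> c = 0) \<and> (\<forall>i\<in>{1..m}. (\<Sum>c\<in>I. f i c * \<theta> c) = t i)) \<or>
    (\<exists>j\<in>{1..m}. \<exists>a. \<forall>c\<in>I. f j c = (\<Sum>i\<in>{1..<j}. a i * f i c))"
proof (induction m)
  case 0
  show ?case by (auto intro: exI[of _ "\<lambda>_. 0"])
next
  case (Suc m)
  show ?case
  proof (cases "\<exists>j\<in>{1..Suc m}. \<exists>a. \<forall>c\<in>I. f j c = (\<Sum>i\<in>{1..<j}. a i * f i c)")
    case False
    define p where "p i \<theta> = (\<Sum>c\<in>I. f i c * \<theta> c)" for i \<theta>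
    have p_add: "p i (\<lambda>c. x c + r * y c) = p i x + r * p i y" for i x r y
      by (simp add: p_def algebra_simps sum.distrib sum_distrib_left)
    have surj: "\<exists>\<theta>. (\<forall>c. c \<notin> I \<longrightarrow> \<theta> c = 0) \<and> (\<forall>i\<in>{1..m}. p i \<theta> = t i)" for t
    proof -
      have "\<not> (\<exists>j\<in>{1..m}. \<exists>a. \<forall>c\<in>I. f j c = (\<Sum>i\<in>{1..<j}. a i * f i c))"
        using False by (meson atLeastAtMost_iff le_Suc_eq)
      then show ?thesis using Suc.IH unfolding p_def by blast
    qed
    have "\<exists>e. \<forall>j. (\<forall>c. c \<notin> I \<longrightarrow> e j c = 0) \<and> (\<forall>i\<in>{1..m}. p i (e j) = (if i = j then 1 else 0))"
    proof (rule choice, rule allI)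
      fix j
      show "\<exists>\<theta>. (\<forall>c. c \<notin> I \<longrightarrow> \<theta> c = 0) \<and> (\<forall>i\<in>{1..m}. p i \<theta> = (if i = j then 1 else 0))"
        by (rule surj)
    qed
    then obtain e where e0: "\<And>j c. c \<notin> I \<Longrightarrow> e j c = 0"
      and e: "\<And>i j. i \<in> {1..m} \<Longrightarrow> p i (e j) = (if i = j then 1 else 0)" by blast
    have "Suc m \<in> {1..Suc m}" "{1..<Suc m} = {1..m}" by auto
    then obtain b where b: "b \<in> I" "f (Suc m) b \<noteq> (\<Sum>i\<in>{1..m}. p (Suc m) (e i) * f i b)"
      using False by metis
    \<comment> \<open>The projection of the basis vector of \<open>b\<close> to the common kernel of
      the first \<open>m\<close> functionals. If the next functional vanished on all such
      projections, it would be a combination of the earlier ones; \<open>b\<close> is chosen against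
      that.\<close>
    define \<theta>' where "\<theta>' c = (if c = b then 1 else 0) - (\<Sum>j\<in>{1..m}. f j b * e j c)" for c
    have p_\<theta>': "p i \<theta>' = f i b - (\<Sum>j\<in>{1..m}. f j b * p i (e j))" for i
    proof -
      have "p i \<theta>' = (\<Sum>c\<in>I. if c = b then f i c else 0) - (\<Sum>c\<in>I. \<Sum>j\<in>{1..m}. f i c * (f j b * e j c))"
        by (simp add: p_def \<theta>'_def algebra_simps sum_subtractf sum_distrib_left if_distrib[of "\<lambda>r. _ * r"] cong: if_cong)
      also have "(\<Sum>c\<in>I. \<Sum>j\<in>{1..m}. f i c * (f j b * e j c)) = (\<Sum>j\<in>{1..m}. \<Sum>c\<in>I. f i c * (f j b * e j c))"
        by (rule sum.swap)
      also have "\<dots> = (\<Sum>j\<in>{1..m}. f j b * p i (e j))"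
        by (simp add: p_def sum_distrib_left mult_ac)
      finally show ?thesis using I b by simp
    qed
    have \<theta>'1: "p i \<theta>' = 0" if "i \<in> {1..m}" for i
      using that by (simp add: p_\<theta>' e if_distrib[of "\<lambda>r. _ * r"] cong: if_cong)
    have \<theta>'2: "p (Suc m) \<theta>' \<noteq> 0"
      using b by (simp add: p_\<theta>' mult.commute)
    have "\<exists>\<theta>. (\<forall>c. c \<notin> I \<longrightarrow> \<theta> c = 0) \<and> (\<forall>i\<in>{1..Suc m}. p i \<theta> = t i)" for t
    proof -
      obtain \<theta> where \<theta>: "\<And>c. c \<notin> I \<Longrightarrow> \<theta> c = 0" "\<And>i. i \<in> {1..m} \<Longrightarrow> p i \<theta> = t i"
        using surj by blast
      define r where "r = (t (Suc m) - p (Suc m) \<theta>) / p (Suc m) \<theta>'"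
      have "p i (\<lambda>c. \<theta> c + r * \<theta>' c) = t i" if "i \<in> {1..Suc m}" for i
      proof (cases "i = Suc m")
        case True
        then show ?thesis unfolding p_add using \<theta>'2 by (simp add: r_def)
      next
        case False
        then have "i \<in> {1..m}" using that by auto
        then show ?thesis unfolding p_add by (simp add: \<theta> \<theta>'1)
      qed
      moreover have "\<theta> c + r * \<theta>' c = 0" if "c \<notin> I" for c
        using that b by (auto simp: \<theta> \<theta>'_def e0)
      ultimately show ?thesis
        by (intro exI[of _ "\<lambda>c. \<theta> c + r * \<theta>' c"] conjI allI impI ballI)
    qed
    then show ?thesis unfolding p_def by (intro disjI1 allI)
  qed blast
qed

lemma prod_ell_mult:
  fixes x :: "nat \<Rightarrow> real ga"
  assumes "\<And>i. gam (x i) = - x i" "i \<in> set is"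
  shows "prod_list (map x is) * x i = 0"
proof -
  have comm: "prod_list (map x js) * x i = (-1) ^ length js *\<^sub>R (x i * prod_list (map x js))" for js
  proof (induction js)
    case (Cons j js)
    have "x j * (prod_list (map x js) * x i) = (-1) ^ length js *\<^sub>R ((x j * x i) * prod_list (map x js))"
      unfolding Cons by (simp add: mult.assoc)
    also have "x j * x i = - (x i * x j)"
      by (rule real_odd_anticommute) (simp_all add: assms)
    finally show ?case by (simp add: mult.assoc)
  qed simp
  obtain as bs where "is = as @ i # bs" using assms(2) by (meson split_list)
  moreover have "x i * x i = 0" by (rule real_odd_square) (simp add: assms)
  then have "x i * (x i * z) = 0" for z by (simp flip: mult.assoc)
  ultimately show ?thesis using comm[of bs] by (simp add: mult.assoc)
qed

text \<open>A dependence among the abelianized words on \<open>I\<close> would make their product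
  vanish after restriction to \<open>I\<close>, since a repeated odd factor gives 0. Restriction to
  \<open>I\<close> does not change the coefficient at \<open>I\<close>.\<close>

lemma angles_exist:
  fixes v :: "nat \<Rightarrow> word" and t :: "nat \<Rightarrow> real"
  assumes I: "finite I" and nz: "coef (A * prod_list (map (\<lambda>i. ell (v i)) [1..<k+1])) I \<noteq> 0"
  obtains \<theta> where "\<And>c. c \<notin> I \<Longrightarrow> \<theta> c = 0" "\<And>i. i \<in> {1..k} \<Longrightarrow> letsum \<theta> (v i) = t i"
proof -
  define x where "x i = restr I (ell (v i))" for i
  have gam: "gam (x i) = - x i" for i
    by (rule ga_eqI) (use gam_ell[of "v i"] in \<open>auto simp: x_def coef_restr coef_ell\<close>)
  have nz': "prod_list (map x [1..<k+1]) \<noteq> 0"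
  proof
    assume "prod_list (map x [1..<k+1]) = 0"
    then have "restr I (A * prod_list (map (\<lambda>i. ell (v i)) [1..<k+1])) = 0"
      by (simp add: restr_prod_list o_def x_def[abs_def] del: upt_Suc)
    then have "coef (restr I (A * prod_list (map (\<lambda>i. ell (v i)) [1..<k+1]))) I = 0" by simp
    then show False using nz by (simp only: coef_restr subset_refl if_True)
  qed
  have False if j: "j \<in> {1..k}" and a: "\<forall>c\<in>I. of_int (abel (v j) c) = (\<Sum>i\<in>{1..<j}. a i * of_int (abel (v i) c))"
    for j and a :: "nat \<Rightarrow> real"
  proof -
    have "x j = (\<Sum>c\<in>I. (\<Sum>i\<in>{1..<j}. a i * of_int (abel (v i) c)) *\<^sub>R evec c)"
      unfolding x_def restr_ell_sum[OF I] by (rule sum.cong) (use a in auto)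
    also have "\<dots> = (\<Sum>i\<in>{1..<j}. a i *\<^sub>R x i)"
      unfolding x_def restr_ell_sum[OF I] scaleR_sum_right scaleR_sum_left by (subst sum.swap) simp
    finally have "prod_list (map x [1..<j]) * x j = (\<Sum>i\<in>{1..<j}. a i *\<^sub>R (prod_list (map x [1..<j]) * x i))"
      by (simp add: sum_distrib_left)
    also have "\<dots> = 0"
    proof (rule sum.neutral, rule ballI)
      fix i assume "i \<in> {1..<j}"
      then have "prod_list (map x [1..<j]) * x i = 0"
        by (intro prod_ell_mult gam) simp
      then show "a i *\<^sub>R (prod_list (map x [1..<j]) * x i) = 0" by simp
    qed
    finally have "prod_list (map x [1..<j]) * x j = 0" .
    moreover have "[1..<k+1] = [1..<j] @ j # [Suc j..<k+1]"
      using j upt_add_eq_append[of 1 j "k + 1 - j"] upt_conv_Cons[of j "k+1"] by simp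
    ultimately show False using nz' by (simp flip: mult.assoc)
  qed
  then have "\<not> (\<exists>j\<in>{1..k}. \<exists>a :: nat \<Rightarrow> real. \<forall>c\<in>I. of_int (abel (v j) c) = (\<Sum>i\<in>{1..<j}. a i * of_int (abel (v i) c)))"
    by blast
  then have "\<exists>\<theta>. (\<forall>c. c \<notin> I \<longrightarrow> \<theta> c = 0) \<and> (\<forall>i\<in>{1..k}. (\<Sum>c\<in>I. of_int (abel (v i) c) * \<theta> c) = t i)"
    using surjective_or_dependent[OF I, of k "\<lambda>i c. of_int (abel (v i) c)"] by (elim disjE) (drule spec, assumption, rule notE)
  then obtain \<theta> where \<theta>: "\<forall>c. c \<notin> I \<longrightarrow> \<theta> c = 0" "\<forall>i\<in>{1..k}. (\<Sum>c\<in>I. of_int (abel (v i) c) * \<theta> c) = t i"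
    by (elim exE conjE)
  show thesis
    by (rule that[of \<theta>]) (use \<theta> letsum_sum[OF I, of \<theta>] in auto)
qed

section \<open>Periodicity and compactness\<close>

definition red :: "pt \<Rightarrow> pt" where "red x c = x c - 2 * pi * of_int \<lfloor>x c / (2 * pi)\<rfloor>"

lemma red_trig: "cos (red x c) = cos (x c)" "sin (red x c) = sin (x c)"
  by (simp_all add: red_def cos_diff sin_diff cos_int_2pin sin_int_2pin)

lemma red_range: "red x c \<in> {0..2 * pi}"
proof -
  define t where "t = x c / (2 * pi)"
  have "red x c = 2 * pi * (t - of_int \<lfloor>t\<rfloor>)"
    by (simp add: red_def t_def right_diff_distrib)
  moreover have "0 \<le> t - of_int \<lfloor>t\<rfloor>" "t - of_int \<lfloor>t\<rfloor> \<le> 1" by linarith+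
  ultimately show ?thesis using mult_left_mono[of "t - of_int \<lfloor>t\<rfloor>" 1 "2 * pi"] by simp
qed

lemma qpar_red: "qpar n (red x) = qpar n x"
  by (rule ext) (simp add: qpar_def red_trig)

text \<open>Points have infinitely many coordinates, so this is Tychonoff's theorem.\<close>

lemma compact_box: "compact {x :: pt. \<forall>c. x c \<in> {0..b}}"
proof -
  have "compactin (product_topology (\<lambda>_. euclidean) UNIV) (PiE UNIV (\<lambda>_::nat. {0..b}))"
    by (simp add: compactin_PiE)
  moreover have "PiE UNIV (\<lambda>_::nat. {0..b}) = {x :: pt. \<forall>c. x c \<in> {0..b}}"
    by (auto simp: PiE_def Pi_def)
  ultimately show ?thesis by (simp add: euclidean_product_topology)
qed

lemma Sp1_re_le: "p \<in> Sp1 \<Longrightarrow> \<bar>re p\<bar> \<le> 1"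
proof -
  assume "p \<in> Sp1"
  then have "(re p)\<^sup>2 \<le> 1\<^sup>2" by (simp add: Sp1_def) (smt (verit) zero_le_power2)
  then show ?thesis using abs_le_square_iff[of "re p" 1] by simp
qed

lemma Sp1_re_sign:
  assumes "p \<in> Sp1" "re p = \<epsilon>" "\<epsilon> = 1 \<or> \<epsilon> = -1"
  shows "p = qreal \<epsilon>"
proof -
  have "(im_i p)\<^sup>2 + (im_j p)\<^sup>2 + (im_k p)\<^sup>2 = 0"
    using assms by (auto simp: Sp1_def)
  then have "im_i p = 0" "im_j p = 0" "im_k p = 0"
    by (simp_all add: add_nonneg_eq_0_iff)
  then show ?thesis using assms(2) by (cases p) (simp add: qreal_def)
qed

section \<open>The theorem\<close>

lemma prod_list_zero: "(0 :: 'a::real_algebra_1) \<in> set xs \<Longrightarrow> prod_list xs = 0"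
  by (induction xs) auto

lemma continuous_letsum: "continuous_on UNIV (\<lambda>y :: pt. letsum y w)"
  by (induction w) (auto intro!: continuous_intros)

lemma continuous_on_prod_list:
  fixes f :: "'i \<Rightarrow> 'a::topological_space \<Rightarrow> real"
  assumes "\<And>i. i \<in> set is \<Longrightarrow> continuous_on S (f i)"
  shows "continuous_on S (\<lambda>x. \<Prod>i\<leftarrow>is. f i x)"
  using assms by (induction "is") (auto intro!: continuous_intros)

lemma qpar_periodic:
  shows "qpar n (y(c := 2 * pi)) = qpar n (y(c := 0))" "dqpar n (y(c := 2 * pi)) = dqpar n (y(c := 0))"
proof -
  have trig: "cos ((y(c := 2 * pi)) i) = cos ((y(c := 0)) i)" "sin ((y(c := 2 * pi)) i) = sin ((y(c := 0)) i)" for i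
    by (auto simp: fun_upd_def)
  show "qpar n (y(c := 2 * pi)) = qpar n (y(c := 0))"
    unfolding qpar_def fun_eq_iff trig by simp
  show "dqpar n (y(c := 2 * pi)) = dqpar n (y(c := 0))"
    unfolding dqpar_def fun_eq_iff trig by simp
qed

lemma solution_exists:
  fixes n k :: nat and w :: word and v :: "nat \<Rightarrow> word" and \<epsilon> :: "nat \<Rightarrow> real" and u u' :: "nat \<Rightarrow> word"
  assumes w: "w = concat (map (\<lambda>l. commutator (u l) (u' l)) ls)" and w_in: "in_Fn n w"
    and v_in: "\<And>i. i \<in> {1..k} \<Longrightarrow> in_Fn n (v i)"
    and eps: "\<And>i. i \<in> {1..k} \<Longrightarrow> \<epsilon> i = 1 \<or> \<epsilon> i = -1"
    and I: "I \<subseteq> {..<n}" "k + 2 \<le> card I"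
    and nz: "coef ((\<Sum>l\<leftarrow>ls. ell (u l) * ell (u' l)) * prod_list (map (\<lambda>i. ell (v i)) [1..<k+1])) I \<noteq> 0"
  shows "\<exists>x. word_hom (qpar n x) w = qreal (-1) \<and> (\<forall>i\<in>{1..k}. word_hom (qpar n x) (v i) = qreal (\<epsilon> i))"
proof (rule ccontr)
  assume none: "\<not> ?thesis"
  define ix where "ix = [1..<k+1]"
  have set_is: "set ix = {1..k}" "length ix = k" by (auto simp: ix_def)
  define V where "V w x = word_hom (qpar n x) w" for w x
  define dV where "dV w x = dword (qpar n x) (dqpar n x) w" for w x
  have uf: "ufield n (V w) (dV w)" for w
    unfolding V_def[abs_def] dV_def[abs_def] by (rule ufield_word[where q = "qpar n" and dq = "dqpar n", OF ufield_qpar])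
  have Sp1: "V w x \<in> Sp1" for w x
    using uf by (auto simp: ufield_def)
  have cV: "continuous_on UNIV (\<lambda>x. re (V w x))" for w
    using hasD_continuous[OF ufield_comp(1)[OF uf], where J = "{}"] by (simp add: coef_cst)

  \<comment> \<open>Nonnegative, and zero exactly at the solutions. Being periodic, it attains its
    minimum, which is positive when there are none.\<close>
  define \<phi> where "\<phi> x = re (V w x) + 1 + (\<Sum>i\<in>{1..k}. 1 - \<epsilon> i * re (V (v i) x))" for x
  have nonneg: "0 \<le> re (V w x) + 1" "\<And>i. i \<in> {1..k} \<Longrightarrow> 0 \<le> 1 - \<epsilon> i * re (V (v i) x)" for x
  proof -
    show "0 \<le> re (V w x) + 1" using Sp1_re_le[OF Sp1[of w x]] by linarith
    fix i assume "i \<in> {1..k}"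
    then show "0 \<le> 1 - \<epsilon> i * re (V (v i) x)"
      using eps[of i] Sp1_re_le[OF Sp1[of "v i" x]] by auto
  qed
  have pos: "0 < \<phi> x" for x
  proof (rule ccontr)
    assume "\<not> 0 < \<phi> x"
    moreover have sum_nn: "0 \<le> (\<Sum>i\<in>{1..k}. 1 - \<epsilon> i * re (V (v i) x))"
      by (rule sum_nonneg) (rule nonneg)
    ultimately have "re (V w x) = -1" "(\<Sum>i\<in>{1..k}. 1 - \<epsilon> i * re (V (v i) x)) = 0"
      using nonneg(1)[of x] by (auto simp: \<phi>_def)
    moreover from this(2) have "\<forall>i\<in>{1..k}. 1 - \<epsilon> i * re (V (v i) x) = 0"
      by (subst (asm) sum_nonneg_eq_0_iff) (use nonneg in auto)
    then have "\<forall>i\<in>{1..k}. re (V (v i) x) = \<epsilon> i"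
      using eps by (metis add.inverse_inverse eq_iff_diff_eq_0 mult_1 mult_minus1)
    ultimately have "word_hom (qpar n x) w = qreal (-1) \<and> (\<forall>i\<in>{1..k}. word_hom (qpar n x) (v i) = qreal (\<epsilon> i))"
      using Sp1_re_sign[OF Sp1] eps unfolding V_def by blast
    then show False using none by blast
  qed
  have "continuous_on {x. \<forall>c. x c \<in> {0..2 * pi}} \<phi>"
    unfolding \<phi>_def by (intro continuous_intros continuous_on_subset[OF cV]) auto
  moreover have "(\<lambda>_. 0) \<in> {x :: pt. \<forall>c. x c \<in> {0..2 * pi}}" by simp
  ultimately obtain x0 where x0: "\<And>y. (\<forall>c. y c \<in> {0..2 * pi}) \<Longrightarrow> \<phi> x0 \<le> \<phi> y"
    using continuous_attains_inf[OF compact_box, of "2 * pi" \<phi>] by blast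
  have min: "\<phi> x0 \<le> \<phi> y" for y
  proof -
    have "\<phi> (red y) = \<phi> y" by (simp add: \<phi>_def V_def qpar_red)
    then show ?thesis using x0[of "red y"] red_range by simp
  qed
  \<comment> \<open>If every v_i is within \<delta> of its target, the sum in \<open>\<phi>\<close>
    is at most half the minimum, so \<open>re (V w x) + 1\<close> is at least the other half; hence
    \<open>a\<close>. The summand 1 avoids a zero denominator when k = 0, and the cap at 1 is
    required by the bumps.\<close>
  define \<delta> where "\<delta> = min 1 (\<phi> x0 / (2 * (real k + 1)))"
  have \<delta>: "0 < \<delta>" "\<delta> \<le> 1" using pos[of x0] by (auto simp: \<delta>_def)
  define a where "a = -1 + \<phi> x0 / 2"
  have a: "-1 < a" using pos[of x0] by (simp add: a_def)
  have far: "a \<le> re (V w x)" if "\<And>i. i \<in> {1..k} \<Longrightarrow> 1 - \<delta> \<le> \<epsilon> i * re (V (v i) x)" for x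
  proof -
    have "(\<Sum>i\<in>{1..k}. 1 - \<epsilon> i * re (V (v i) x)) \<le> (\<Sum>i\<in>{1..k}. \<delta>)"
      by (rule sum_mono) (use that in force)
    also have "\<dots> = real k * \<delta>" by simp
    also have "\<dots> \<le> (real k + 1) * (\<phi> x0 / (2 * (real k + 1)))"
      using \<delta> by (intro mult_mono) (auto simp: \<delta>_def)
    also have "\<dots> = \<phi> x0 / 2" by (simp add: field_simps)
    finally show ?thesis using min[of x] unfolding a_def \<phi>_def[of x] by linarith
  qed

  obtain \<kappa> \<kappa>' where \<kappa>: "\<And>t. (\<kappa> has_real_derivative \<kappa>' t) (at t)" "continuous_on UNIV \<kappa>'"
    and \<kappa>_ode: "\<And>t. a \<le> t \<Longrightarrow> \<kappa>' t * (1 - t\<^sup>2) = 6 + 3 * t * \<kappa> t"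
    using profile_exists[OF a] by blast
  define bump where "bump i g g' W \<longleftrightarrow> (\<forall>t. (g has_real_derivative g' t) (at t)) \<and> continuous_on UNIV g' \<and>
      (\<forall>t. (W has_real_derivative - (1 - t\<^sup>2) * g t) (at t)) \<and>
      (\<forall>t. \<epsilon> i * t \<le> 1 - \<delta> \<longrightarrow> g t = 0 \<and> W t = 0) \<and>
      (\<forall>t. \<bar>t\<bar> \<le> 1 \<longrightarrow> 0 \<le> \<epsilon> i * (W t * t)) \<and> 0 < W (\<epsilon> i)" for i and g g' W :: "real \<Rightarrow> real"
  have "\<exists>b. i \<in> {1..k} \<longrightarrow> bump i (fst b) (fst (snd b)) (snd (snd b))" for i
  proof (cases "i \<in> {1..k}")
    case True
    obtain g g' W where "bump i g g' W"
      using bump_exists[OF eps[OF True] \<delta>] unfolding bump_def by metis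
    then show ?thesis by (intro exI[of _ "(g, g', W)"]) simp
  qed blast
  then obtain b where b: "\<And>i. i \<in> {1..k} \<Longrightarrow> bump i (fst (b i)) (fst (snd (b i))) (snd (snd (b i)))"
    by metis
  define g g' W where "g i = fst (b i)" and "g' i = fst (snd (b i))" and "W i = snd (snd (b i))" for i
  have bump: "bump i (g i) (g' i) (W i)" if "i \<in> {1..k}" for i
    using b[OF that] by (simp add: g_def g'_def W_def)
  have g: "\<And>i t. i \<in> {1..k} \<Longrightarrow> (g i has_real_derivative g' i t) (at t)"
      "\<And>i. i \<in> {1..k} \<Longrightarrow> continuous_on UNIV (g' i)"
    and W: "\<And>i t. i \<in> {1..k} \<Longrightarrow> (W i has_real_derivative - (1 - t\<^sup>2) * g i t) (at t)"
    and supp: "\<And>i t. i \<in> {1..k} \<Longrightarrow> \<epsilon> i * t \<le> 1 - \<delta> \<Longrightarrow> g i t = 0 \<and> W i t = 0"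
    and Wnn: "\<And>i t. i \<in> {1..k} \<Longrightarrow> \<bar>t\<bar> \<le> 1 \<Longrightarrow> 0 \<le> \<epsilon> i * (W i t * t)"
    and Wpos: "\<And>i. i \<in> {1..k} \<Longrightarrow> 0 < W i (\<epsilon> i)"
    using bump unfolding bump_def by blast+

  define \<Omega> where "\<Omega> x = Omega \<kappa> g W w v ix (qpar n x) (dqpar n x)" for x
  define B where "B i x = Bform (g i) (W i) (V (v i) x) (dV (v i) x)" for i x
  obtain G where G: "hasD n (\<lambda>x. varpi \<kappa> (V w x) (dV w x)) G"
    "\<And>x. \<kappa>' (re (V w x)) * (1 - (re (V w x))\<^sup>2) = 6 + 3 * re (V w x) * \<kappa> (re (V w x)) \<Longrightarrow> G x = chi (V w x) (dV w x)"
    using hasD_varpi[OF uf[of w] \<kappa>] by blast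
  have P: "hasD n (\<lambda>x. Pword (qpar n x) (dqpar n x) w) (\<lambda>x. chi (V w x) (dV w x))"
    using hasD_Pword[where q = "qpar n" and dq = "dqpar n" and n = n and w = w, OF ufield_qpar] by (simp add: w letsum_commutators V_def dV_def)
  have Bc: "hasD n (\<lambda>x. prod_list (map (\<lambda>i. B i x) ix)) (\<lambda>x. 0)"
  proof (rule hasD_prod_list)
    fix i assume "i \<in> set ix"
    then have i: "i \<in> {1..k}" by (simp add: set_is)
    show "hasD n (B i) (\<lambda>x. 0)"
      unfolding B_def[abs_def] by (rule hasD_Bform[OF uf g(1)[OF i] g(2)[OF i] W[OF i]])
  qed
  have closed: "hasD n \<Omega> (\<lambda>x. 0)"
  proof (rule hasD_cong[OF hasD_mult[OF hasD_diff[OF P G(1)] Bc]])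
    fix x
    show "(Pword (qpar n x) (dqpar n x) w - varpi \<kappa> (V w x) (dV w x)) * prod_list (map (\<lambda>i. B i x) ix) = \<Omega> x"
      by (simp add: \<Omega>_def Omega_def V_def dV_def B_def)
    show "(chi (V w x) (dV w x) - G x) * prod_list (map (\<lambda>i. B i x) ix) +
        gam (Pword (qpar n x) (dqpar n x) w - varpi \<kappa> (V w x) (dV w x)) * 0 = 0"
    \<comment> \<open>Either all v_i are near their targets and the two primitives have the same
      differential, or one bump factor is 0.\<close>
    proof (cases "\<forall>i\<in>{1..k}. 1 - \<delta> \<le> \<epsilon> i * re (V (v i) x)")
      case True
      then have "G x = chi (V w x) (dV w x)" by (intro G(2) \<kappa>_ode far) auto
      then show ?thesis by simp
    next
      case False
      then obtain i where i: "i \<in> {1..k}" "\<epsilon> i * re (V (v i) x) \<le> 1 - \<delta>" by force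
      then have "B i x = 0" unfolding B_def by (intro Bform_zero) (use supp in blast)+
      then have "prod_list (map (\<lambda>i. B i x) ix) = 0"
        by (intro prod_list_zero) (use i set_is in force)
      then show ?thesis by simp
    qed
  qed

  have finI: "finite I" using I(1) finite_subset by blast
  have loc: "iint n (sorted_list_of_set (I \<union> (+) (2 * n) ` I)) (\<lambda>y. coef (\<Omega> y) I) (\<lambda>_. 0) = 0"
  proof (rule localization[OF I(1) closed])
    show "\<Omega> (y(c := 2 * pi)) = \<Omega> (y(c := 0))" if "c < n \<or> 2 * n \<le> c \<and> c < 3 * n" for y c
      unfolding \<Omega>_def qpar_periodic ..
    show "coef (\<Omega> y) J = 0" if "i < n" "y (n + i) = 0" "2 * n + i \<in> J" for y i J
      unfolding \<Omega>_def by (rule Omega_coef_zero[OF restr_dqpar_psi]) (use that in auto)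
    show "coef (\<Omega> y) J = 0" if "i < n" "y (n + i) = pi / 2" "i \<in> J" for y i J
      unfolding \<Omega>_def by (rule Omega_coef_zero[OF restr_dqpar_theta]) (use that in auto)
    show "coef (\<Omega> y) (I \<union> (+) n ` I \<union> (+) (2 * n) ` I) = 0" for y
    proof -
      have "card (I \<union> (+) n ` I \<union> (+) (2 * n) ` I) = card I + card I + card I"
        using finI I(1) by (subst card_Un_disjoint; (subst card_Un_disjoint)?) (auto simp: card_image)
      then have "2 + 3 * length ix < card (I \<union> (+) n ` I \<union> (+) (2 * n) ` I)"
        using I(2) by (simp add: set_is)
      moreover have "deg_le (2 + 3 * length ix) (\<Omega> y)"
        unfolding \<Omega>_def by (rule deg_le_Omega) (rule deg_le_dqpar)
      ultimately show ?thesis by (simp only: deg_le_def)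
    qed
  qed

  \<comment> \<open>The signs \<epsilon>_i make each factor nonnegative; they are compensated in
    \<open>s\<close>. The 6 is the 3 of \<open>torus_Pword\<close> times the 2 from the
    commutators.\<close>
  define H where "H y = (\<Prod>i\<leftarrow>ix. \<epsilon> i * (W i (cos (letsum y (v i))) * cos (letsum y (v i))))" for y
  define s where "s = 6 * (\<Prod>i\<leftarrow>ix. \<epsilon> i) * coef ((\<Sum>l\<leftarrow>ls. ell (u l) * ell (u' l)) * prod_list (map (\<lambda>i. ell (v i)) ix)) I"
  have "s \<noteq> 0"
  proof -
    have "(\<Prod>i\<leftarrow>ix. \<epsilon> i) \<noteq> 0"
      using eps set_is by (force simp: prod_list_zero_iff)
    then show ?thesis using nz unfolding s_def ix_def by simp
  qed
  have "iint n (sorted_list_of_set (I \<union> (+) (2 * n) ` I)) (\<lambda>y. coef (\<Omega> y) I) (\<lambda>_. 0) =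
      iint n (sorted_list_of_set (I \<union> (+) (2 * n) ` I)) (\<lambda>y. s * H y) (\<lambda>_. 0)"
  proof (rule iint_cong)
    fix y :: pt assume y: "\<And>c. c \<notin> set (sorted_list_of_set (I \<union> (+) (2 * n) ` I)) \<Longrightarrow> y c = 0"
    have tau: "y (n + j) = 0" if "j < n" for j
      using that I(1) finI by (intro y) auto
    note q = restr_dqpar_torus[where n = n and x = y, OF tau]
    have "coef (\<Omega> y) I = coef (restr {..<n} (\<Omega> y)) I"
      using I(1) by (simp add: coef_restr)
    also have "restr {..<n} (\<Omega> y) = (3 * (\<Prod>i\<leftarrow>ix. W i (cos (letsum y (v i))) * cos (letsum y (v i)))) *\<^sub>R
        (Qword w * prod_list (map (\<lambda>i. ell (v i)) ix))"
      unfolding \<Omega>_def restr_Omega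
      by (rule torus_Omega[where q = "qpar n y" and \<theta> = y and n = n and dq = "\<lambda>i. restr {..<n} (dqpar n y i)", OF q w_in]) (use v_in set_is in \<open>auto simp: w letsum_commutators\<close>)
    also have "Qword w = 2 *\<^sub>R (\<Sum>l\<leftarrow>ls. ell (u l) * ell (u' l))"
      unfolding w by (rule Qword_commutators)
    also have "(\<Prod>i\<leftarrow>ix. W i (cos (letsum y (v i))) * cos (letsum y (v i))) = (\<Prod>i\<leftarrow>ix. \<epsilon> i) * H y"
    proof -
      have signs: "(\<Prod>i\<leftarrow>js. f i) = (\<Prod>i\<leftarrow>js. \<epsilon> i) * (\<Prod>i\<leftarrow>js. \<epsilon> i * f i)" if "set js \<subseteq> {1..k}" for js and f :: "nat \<Rightarrow> real"
        using that
      proof (induction js)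
        case (Cons j js)
        then have "\<epsilon> j * \<epsilon> j = 1" using eps[of j] by auto
        then show ?case using Cons by (simp add: mult_ac)
      qed simp
      show ?thesis unfolding H_def by (rule signs) (simp add: set_is)
    qed
    finally show "coef (\<Omega> y) I = s * H y" by (simp add: s_def mult_ac)
  qed
  then have int0: "iint n (sorted_list_of_set (I \<union> (+) (2 * n) ` I)) H (\<lambda>_. 0) = 0"
    using loc \<open>s \<noteq> 0\<close> by (simp add: iint_scale)

  \<comment> \<open>A torus point at which each v_i takes its target value, so \<open>H\<close> is
    the product of the positive numbers W_i(\<epsilon>_i). It is moved into the integration box by
    \<open>red\<close>.\<close>
  obtain \<theta> where \<theta>: "\<And>c. c \<notin> I \<Longrightarrow> \<theta> c = 0" "\<And>i. i \<in> {1..k} \<Longrightarrow> letsum \<theta> (v i) = arccos (\<epsilon> i)"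
    using angles_exist[OF finI nz, where t = "\<lambda>i. arccos (\<epsilon> i)"] by blast
  have "H (red \<theta>) = 0"
  proof (rule iint_eq_0[OF _ _ int0])
    have "continuous_on UNIV (\<lambda>y. W i (cos (letsum y (v i))))" if "i \<in> {1..k}" for i
    proof -
      have "continuous_on UNIV (W i)"
        by (meson DERIV_isCont W continuous_at_imp_continuous_on that)
      then show ?thesis
        by (rule continuous_on_compose2) (auto intro!: continuous_intros continuous_letsum)
    qed
    then show "continuous_on UNIV H"
      unfolding H_def using set_is
      by (intro continuous_on_prod_list continuous_intros continuous_letsum) auto
    show "0 \<le> H y" for y
    proof -
      have "0 \<le> (\<Prod>i\<leftarrow>js. \<epsilon> i * (W i (cos (letsum y (v i))) * cos (letsum y (v i))))" if "set js \<subseteq> {1..k}" for js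
        using that by (induction js) (auto intro!: mult_nonneg_nonneg[OF Wnn])
      then show ?thesis unfolding H_def using set_is by simp
    qed
    show "red \<theta> c = 0" if "c \<notin> set (sorted_list_of_set (I \<union> (+) (2 * n) ` I))" for c
      using that finI by (simp add: red_def \<theta>)
    show "red \<theta> c \<in> {0..hi n c}" if "c \<in> set (sorted_list_of_set (I \<union> (+) (2 * n) ` I))" for c
    proof -
      have "hi n c = 2 * pi" using that finI I(1) by (auto simp: hi_def)
      then show ?thesis using red_range by simp
    qed
  qed
  moreover have "cos (letsum (red \<theta>) (v i)) = \<epsilon> i" if i: "i \<in> {1..k}" for i
  proof -
    \<comment> \<open>Reducing the angles changes \<open>letsum\<close> by a multiple of 2\<pi>;
      this is read off from the value of the word, which depends on the angles only through
      \<open>Eq\<close>.\<close>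
    have E: "word_hom (\<lambda>c. Eq (\<eta> c)) (v i) = Eq (letsum \<eta> (v i))" for \<eta>
      by (rule torus_word(1)[where dq = "\<lambda>c. emb (qI * Eq (\<eta> c)) (evec c)", OF refl refl v_in[OF i]])
    have "(\<lambda>c. Eq (red \<theta> c)) = (\<lambda>c. Eq (\<theta> c))" by (simp add: Eq_def red_trig)
    then have "Eq (letsum (red \<theta>) (v i)) = Eq (letsum \<theta> (v i))" using E[of "red \<theta>"] E[of \<theta>] by simp
    then have "cos (letsum (red \<theta>) (v i)) = cos (arccos (\<epsilon> i))" using \<theta>(2)[OF i] by (simp add: Eq_def)
    then show ?thesis using eps[OF i] by auto
  qed
  then have "H (red \<theta>) = (\<Prod>i\<leftarrow>ix. W i (\<epsilon> i))"
    unfolding H_def using eps set_is by (intro arg_cong[of _ _ prod_list] map_cong) force+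
  moreover have "(\<Prod>i\<leftarrow>ix. W i (\<epsilon> i)) \<noteq> 0"
    using Wpos set_is by (force simp: prod_list_zero_iff)
  ultimately show False by simp
qed

theorem theorem4p1:
  fixes n k \<rho> :: nat and u v :: "nat \<Rightarrow> word" and \<epsilon> :: "nat \<Rightarrow> int"
  assumes u_in: "\<forall>l \<in> {1..2*\<rho>}. in_Fn n (u l)"
    and v_in: "\<forall>i \<le> k. in_Fn n (v i)"
    and v0: "free_equiv (v 0) (concat (map (\<lambda>l. commutator (u l) (u (l + \<rho>))) [1..<\<rho>+1]))"
    and eps: "\<forall>i \<le> k. \<epsilon> i \<in> {1, -1}"
    and eps0: "\<epsilon> 0 = -1"
    and nz: "foldl (\<lambda>acc i. acc \<and>\<^sub>e ext_vec (abel (v i)))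
               (foldr ext_add
                  (map (\<lambda>l. ext_vec (abel (u l)) \<and>\<^sub>e ext_vec (abel (u (l + \<rho>)))) [1..<\<rho>+1])
                  ext_zero)
               [1..<k+1] \<noteq> ext_zero"
  shows "\<exists>q :: nat \<Rightarrow> quat. (\<forall>i < n. q i \<in> Sp1) \<and>
           (\<forall>i \<le> k. word_hom q (v i) = qreal (of_int (\<epsilon> i)))"
proof -
  define ls where "ls = [1..<\<rho>+1]"
  define w where "w = concat (map (\<lambda>l. commutator (u l) (u (l + \<rho>))) ls)"
  define \<Lambda> where "\<Lambda> = (\<Sum>l\<leftarrow>ls. ell (u l) * ell (u (l + \<rho>))) * prod_list (map (\<lambda>i. ell (v i)) [1..<k+1])"
  have ls: "\<And>l. l \<in> set ls \<Longrightarrow> in_Fn n (u l) \<and> in_Fn n (u (l + \<rho>))"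
    using u_in by (auto simp: ls_def)
  obtain I where I: "foldl (\<lambda>acc i. acc \<and>\<^sub>e ext_vec (abel (v i)))
      (foldr ext_add (map (\<lambda>l. ext_vec (abel (u l)) \<and>\<^sub>e ext_vec (abel (u (l + \<rho>)))) ls) ext_zero) [1..<k+1] I \<noteq> 0"
    using nz unfolding ext_zero_def ls_def fun_eq_iff by blast
  have finI: "finite I"
  proof (rule ccontr)
    assume inf: "infinite I"
    show False by (rule notE[OF I], rule foldl_infinite[OF inf], rule foldr_infinite[OF inf])
  qed
  have "coef (ofe (foldl (\<lambda>acc i. acc \<and>\<^sub>e ext_vec (abel (v i)))
      (foldr ext_add (map (\<lambda>l. ext_vec (abel (u l)) \<and>\<^sub>e ext_vec (abel (u (l + \<rho>)))) ls) ext_zero) [1..<k+1])) I \<noteq> 0"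
    using I finI by (simp only: coef_ofe if_True of_int_eq_0_iff not_False_eq_True)
  then have \<Lambda>: "coef \<Lambda> I \<noteq> 0"
    by (simp only: ofe_foldl ofe_foldr map_map o_def ofe_mult ofe_abel \<Lambda>_def not_False_eq_True)
  have "restr {..<n} \<Lambda> = \<Lambda>"
  proof -
    have "restr {..<n} (\<Sum>l\<leftarrow>ls. ell (u l) * ell (u (l + \<rho>))) = (\<Sum>l\<leftarrow>ls. ell (u l) * ell (u (l + \<rho>)))"
      using ls by (induction ls) (simp_all add: restr_ell)
    moreover have "map (\<lambda>i. restr {..<n} (ell (v i))) [1..<k+1] = map (\<lambda>i. ell (v i)) [1..<k+1]"
      using v_in by (intro map_cong) (auto simp: restr_ell)
    ultimately show ?thesis by (simp only: \<Lambda>_def restr_mult restr_prod_list map_map o_def)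
  qed
  \<comment> \<open>\<open>\<Lambda>\<close> is a product of forms in the first \<open>n\<close>
    covectors, so a nonzero coefficient cannot sit at a set that leaves this range.\<close>
  then have In: "I \<subseteq> {..<n}" using \<Lambda> coef_restr[of "{..<n}" \<Lambda> I] by (metis (full_types))
  have "deg_ge (2 + length [1..<k+1]) \<Lambda>"
    unfolding \<Lambda>_def by (intro deg_ge_mult deg_ge_sum_list deg_ge_prod_list)
  then have cardI: "k + 2 \<le> card I"
    using \<Lambda> finI unfolding deg_ge_def by (metis add.commute add_diff_cancel_right' length_upt not_le)
  have inv_in: "in_Fn n (word_inv z)" if "in_Fn n z" for z
    using that by (auto simp: in_Fn_def word_inv_def letter_inv_def)
  have append_in: "in_Fn n (y @ z) \<longleftrightarrow> in_Fn n y \<and> in_Fn n z" for y z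
    by (auto simp: in_Fn_def)
  have "in_Fn n (commutator (u l) (u (l + \<rho>)))" if "l \<in> set ls" for l
    using ls[OF that] inv_in by (simp add: commutator_def append_in)
  then have w_in: "in_Fn n w"
    by (fastforce simp: w_def in_Fn_def)
  obtain x where x: "word_hom (qpar n x) w = qreal (-1)"
    "\<And>i. i \<in> {1..k} \<Longrightarrow> word_hom (qpar n x) (v i) = qreal (of_int (\<epsilon> i))"
    using solution_exists[OF w_def w_in _ _ In cardI, of v "\<lambda>i. of_int (\<epsilon> i)"] v_in eps \<Lambda>[unfolded \<Lambda>_def] by force
  have "word_hom (qpar n x) (v 0) = qreal (-1)"
    using word_hom_free_equiv[OF qpar_Sp1 v0] x(1) by (simp add: w_def ls_def)
  then have "word_hom (qpar n x) (v i) = qreal (of_int (\<epsilon> i))" if "i \<le> k" for i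
    using x(2)[of i] eps0 that by (cases "i = 0") auto
  then show ?thesis using qpar_Sp1 by blast
qed

end
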